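(* For each integer $r \ge 4$, \[ \ln m(n,r) = \frac{1}{n-r+1}\binom{n}{r}\Bigl[\ln(n-r+1) + 1 - r + o(1)\Bigr] \qquad \text{as } n \to \infty . \]
   Context: $m(n,r)$ denotes the number of matroids of rank $r$ on a fixed ground set of cardinality $n$ (e.g. $[n]=\{1,\dots,n\}$). $\ln$ is the natural logarithm. *)

theory Defs
  imports Complex_Main "HOL-Library.Landau_Symbols"
begin

definition matroid :: "'a set \<Rightarrow> 'a set set \<Rightarrow> bool" where
  "matroid E \<I> \<longleftrightarrow>
     finite E \<and>
     \<I> \<subseteq> Pow E \<and>
     {} \<in> \<I> \<and>
     (\<forall>X Y. Y \<in> \<I> \<and> X \<subseteq> Y \<longrightarrow> X \<in> \<I>) \<and>
     (\<forall>X Y. X \<in> \<I> \<and> Y \<in> \<I> \<and> card X < card Y \<longrightarrow> (\<exists>y \<in> Y - X. insert y X \<in> \<I>))"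

definition matroid_rank :: "'a set set \<Rightarrow> nat" where
  "matroid_rank \<I> = Max (card ` \<I>)"

text \<open>Matroids are counted as labelled objects, that is, not up to isomorphism; distinct families
  of independent sets are distinct matroids.\<close>

definition num_matroids :: "nat \<Rightarrow> nat \<Rightarrow> nat" where
  "num_matroids n r = card {\<I>. matroid {1..n} \<I> \<and> matroid_rank \<I> = r}"

end

theory Submission
  imports Defs "HOL-Real_Asymp.Real_Asymp"
begin

text \<open>
  Write \<open>D = n - r + 1\<close> and \<open>V = n choose (r - 1)\<close>, so that the claim reads
  \<open>ln m(n,r) = V/r (ln D + 1 - r + o(1))\<close>. Let \<open>H\<close> be the hypergraph whose vertices are the
  \<open>(r-1)\<close>-subsets of the ground set and whose edges are the \<open>r\<close>-subsets; it is \<open>r\<close>-uniform, \<open>D\<close>-regular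
  and linear, and its matchings are the circuit-hyperplanes of the sparse paving matroids of rank \<open>r\<close>.

  Lower bound: choose the edges of a matching one at a time at random. The number of matchings is
  bounded below by the entropy of this process, and the sum of the squared deviations of the degrees
  from their expected trajectory stays small in expectation, because the adjacency matrix of an
  \<open>r\<close>-uniform hypergraph plus its degree matrix is positive semidefinite. Phrased as an induction on the number of
  remaining edges, no probability theory is needed. The process runs until a fraction
  \<open>D powr - \<kappa>\<close> of the vertices is uncovered.

  Upper bound: a matroid is determined by its truncation to rank \<open>r - 1\<close> and, for each hyperplane \<open>F\<close>
  that contains a circuit of size \<open>r\<close>, a maximum set \<open>U \<subseteq> F\<close> all of whose \<open>(r-1)\<close>-subsets are
  independent. These sets pairwise meet in fewer than \<open>r - 1\<close> elements. For \<open>r \<ge> 4\<close> those with more than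
  \<open>r\<close> elements cost less than their share of \<open>V/r ln D\<close>; the others form a matching in \<open>H\<close>. The number
  of matchings of given size is bounded by revealing the edges of a matching in random order, the
  conditional choices being averaged by Jensen's inequality.
\<close>

section \<open>Matroids, truncations and packings\<close>

text \<open>The constant \<open>1 - r\<close> has the same origin on both sides. When a fraction t
  of the vertices is uncovered, about a fraction \<open>t ^ r\<close> of the edges is still
  available, and the mean of \<open>r * ln t\<close> over the unit interval is \<open>- r\<close>;
  dividing by \<open>m!\<close>, since the order of the \<open>m\<close> chosen edges is forgotten,
  adds the \<open>1\<close>. An error o(1) in the bracket allows a small relative error in the
  number of choices per step, but these errors must be controlled along the whole process. In the
  lower bound only the total edge count enters the entropy, and by Cauchy-Schwarz the sum of squared
  degree deviations controls it, so no single degree has to be concentrated. That sum is amplified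
  by a factor \<open>1 + O(1/u)\<close> in a step with \<open>u\<close> uncovered vertices; a price
  for it that is polynomial in \<open>u\<close> therefore suffices. In the upper bound the obstacle
  is a matching that leaves many vertices uncovered, for which \<open>t ^ r\<close> is the wrong
  count. Each uncovered vertex saves about \<open>(ln D) / r\<close> in the exponent, and this one
  saving pays both for the wrong count and for the blocks with more than \<open>r\<close>
  elements.\<close>

lemma matroid_finite_card:
  assumes "matroid E M" "X \<in> M" shows "finite X" "X \<subseteq> E"
  using assms unfolding matroid_def by (auto intro: finite_subset)

lemma matroid_finite: "matroid E M \<Longrightarrow> finite M"
  unfolding matroid_def by (meson finite_Pow_iff finite_subset)

lemma matroid_mono: "matroid E M \<Longrightarrow> Y \<in> M \<Longrightarrow> X \<subseteq> Y \<Longrightarrow> X \<in> M"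
  unfolding matroid_def by blast

lemma matroid_augment:
  "matroid E M \<Longrightarrow> X \<in> M \<Longrightarrow> Y \<in> M \<Longrightarrow> card X < card Y \<Longrightarrow> \<exists>y\<in>Y - X. insert y X \<in> M"
  unfolding matroid_def by blast

lemma matroid_rankI:
  assumes "matroid E M" "\<And>X. X \<in> M \<Longrightarrow> card X \<le> k" "B \<in> M" "card B = k"
  shows "matroid_rank M = k"
  unfolding matroid_rank_def
  by (rule Max_eqI) (use assms matroid_finite in auto)

lemma matroid_rankD:
  assumes "matroid E M" "matroid_rank M = k"
  shows "X \<in> M \<Longrightarrow> card X \<le> k" and "\<exists>B\<in>M. card B = k"
proof -
  have f: "finite (card ` M)" and ne: "card ` M \<noteq> {}"
    using matroid_finite[OF assms(1)] assms(1) by (auto simp: matroid_def)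
  show "X \<in> M \<Longrightarrow> card X \<le> k" using Max_ge[OF f] assms(2) by (auto simp: matroid_rank_def)
  show "\<exists>B\<in>M. card B = k" using Max_in[OF f ne] assms(2) by (auto simp: matroid_rank_def)
qed

definition truncation :: "nat \<Rightarrow> 'a set set \<Rightarrow> 'a set set" where
  "truncation k M = {X \<in> M. card X \<le> k}"

lemma truncation_matroid:
  assumes M: "matroid E M" and "matroid_rank M = Suc k"
  shows "matroid E (truncation k M)" "matroid_rank (truncation k M) = k"
proof -
  show 1: "matroid E (truncation k M)"
    unfolding matroid_def truncation_def
  proof (intro conjI allI impI)
    fix X Y assume "Y \<in> {X \<in> M. card X \<le> k} \<and> X \<subseteq> Y"
    then have Y: "Y \<in> M" "card Y \<le> k" "X \<subseteq> Y" by auto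
    have "finite Y" using matroid_finite_card[OF M Y(1)] by simp
    then show "X \<in> {X \<in> M. card X \<le> k}" using Y matroid_mono[OF M Y(1,3)] card_mono[of Y X] by auto
  next
    fix X Y assume a: "X \<in> {X \<in> M. card X \<le> k} \<and> Y \<in> {X \<in> M. card X \<le> k} \<and> card X < card Y"
    then obtain y where y: "y \<in> Y - X" "insert y X \<in> M" using matroid_augment[OF M, of X Y] by auto
    have "finite X" using a matroid_finite_card[OF M] by auto
    then have "card (insert y X) \<le> k" using a y by auto
    then show "\<exists>y\<in>Y - X. insert y X \<in> {X \<in> M. card X \<le> k}" using y by auto
  qed (use M in \<open>auto simp: matroid_def\<close>)
  obtain B where B: "B \<in> M" "card B = Suc k" using matroid_rankD(2)[OF assms] by auto
  obtain B' where B': "B' \<subseteq> B" "card B' = k" using B(2) by (metis Suc_n_not_le_n le_cases obtain_subset_with_card_n)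
  show "matroid_rank (truncation k M) = k"
    by (rule matroid_rankI[OF 1, of _ B']) (use B B' matroid_mono[OF M] in \<open>auto simp: truncation_def\<close>)
qed

text \<open>An \<open>(r-1)\<close>-set lies in at most one block, so these are partial designs with
  mixed block sizes.\<close>

definition packings :: "nat \<Rightarrow> nat \<Rightarrow> nat set set set" where
  "packings n r = {P. P \<subseteq> Pow {1..n} \<and> (\<forall>U\<in>P. r \<le> card U) \<and>
     (\<forall>U\<in>P. \<forall>U'\<in>P. U \<noteq> U' \<longrightarrow> card (U \<inter> U') < r - 1)}"

lemma finite_packings: "finite (packings n r)"
  by (rule finite_subset[of _ "Pow (Pow {1..n})"]) (auto simp: packings_def)

text \<open>For independent sets of size one less than the rank this is the hyperplane they span.\<close>

definition mclosure :: "'a set \<Rightarrow> 'a set set \<Rightarrow> 'a set \<Rightarrow> 'a set" where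
  "mclosure E M B = {x \<in> E. x \<in> B \<or> insert x B \<notin> M}"

definition all_indep :: "nat \<Rightarrow> 'a set set \<Rightarrow> 'a set \<Rightarrow> bool" where
  "all_indep k M U \<longleftrightarrow> (\<forall>B\<subseteq>U. card B = k \<longrightarrow> B \<in> M)"

text \<open>\<open>SOME\<close> picks one maximum set as a function of \<open>H\<close> and
  \<open>M\<close> alone, so that independent sets with the same closure share their
  generator.\<close>

definition generator :: "nat \<Rightarrow> 'a set set \<Rightarrow> 'a set \<Rightarrow> 'a set" where
  "generator k M H = (SOME U. U \<subseteq> H \<and> all_indep k M U \<and>
      (\<forall>U'. U' \<subseteq> H \<and> all_indep k M U' \<longrightarrow> card U' \<le> card U))"

text \<open>A generator with only \<open>k\<close> elements is left out: its hyperplane contains no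
  \<open>(k+1)\<close>-set all of whose \<open>k\<close>-subsets are independent, so it says nothing
  beyond the truncation.\<close>

definition generators :: "'a set \<Rightarrow> nat \<Rightarrow> 'a set set \<Rightarrow> 'a set set" where
  "generators E k M = {U \<in> generator k M ` mclosure E M ` {B \<in> M. card B = k}. Suc k \<le> card U}"

text \<open>Recovers a hyperplane from its generator by testing sets of size at most
  \<open>k\<close> only, so that the truncation can take the place of the matroid.\<close>

definition spanned :: "'a set \<Rightarrow> nat \<Rightarrow> 'a set set \<Rightarrow> 'a set \<Rightarrow> 'a set" where
  "spanned E k M U = U \<union> {x \<in> E. \<exists>Z\<subseteq>U. Suc (card Z) = k \<and> insert x Z \<notin> M}"

context
  fixes E :: "'a set" and M :: "'a set set" and k :: nat
  assumes M: "matroid E M" and rk: "matroid_rank M = Suc k" and k: "k \<ge> 1"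
begin

text \<open>Both inclusions are the exchange axiom: an independent \<open>(k+1)\<close>-set built
  from one of the two sets would augment the other by an element of its own closure.\<close>

lemma mclosure_eq:
  assumes B1: "B1 \<in> M" "card B1 = k" and B: "B \<in> M" "card B = k" "B \<subseteq> mclosure E M B1"
  shows "mclosure E M B = mclosure E M B1"
proof -
  have sub: "mclosure E M B1 \<subseteq> mclosure E M B"
  proof
    fix x assume x: "x \<in> mclosure E M B1"
    show "x \<in> mclosure E M B"
    proof (rule ccontr)
      assume "x \<notin> mclosure E M B"
      then have xB: "x \<notin> B" "insert x B \<in> M" using x by (auto simp: mclosure_def)
      have "card B1 < card (insert x B)" using xB B B1 matroid_finite_card[OF M B(1)] by simp
      then obtain y where "y \<in> insert x B - B1" "insert y B1 \<in> M"
        using matroid_augment[OF M B1(1) xB(2)] by auto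
      then show False using x B(3) by (auto simp: mclosure_def)
    qed
  qed
  moreover have "mclosure E M B \<subseteq> mclosure E M B1"
  proof
    fix x assume x: "x \<in> mclosure E M B"
    show "x \<in> mclosure E M B1"
    proof (rule ccontr)
      assume "x \<notin> mclosure E M B1"
      then have xB: "x \<notin> B1" "insert x B1 \<in> M" using x by (auto simp: mclosure_def)
      have "card B < card (insert x B1)" using xB B B1 matroid_finite_card[OF M B1(1)] by simp
      then obtain y where y: "y \<in> insert x B1 - B" "insert y B \<in> M"
        using matroid_augment[OF M B(1) xB(2)] by auto
      have "B1 \<subseteq> mclosure E M B1" using matroid_finite_card[OF M B1(1)] by (auto simp: mclosure_def)
      then have "y \<in> mclosure E M B" using y x sub by auto
      then show False using y by (auto simp: mclosure_def)
    qed
  qed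
  ultimately show ?thesis by blast
qed

lemma finE: "finite E" using M by (simp add: matroid_def)

lemma mclosure_sub: "mclosure E M B \<subseteq> E" by (auto simp: mclosure_def)

lemma generator:
  assumes B: "B \<in> M" "card B = k" and H: "H = mclosure E M B"
  shows "generator k M H \<subseteq> H" "all_indep k M (generator k M H)"
    "\<And>U'. U' \<subseteq> H \<Longrightarrow> all_indep k M U' \<Longrightarrow> card U' \<le> card (generator k M H)"
proof -
  have "finite H" using H finE mclosure_sub finite_subset by metis
  then have fin: "finite (card ` {U. U \<subseteq> H \<and> all_indep k M U})" by auto
  have "{} \<subseteq> H" "all_indep k M {}" using k by (auto simp: all_indep_def)
  then have ne: "card ` {U. U \<subseteq> H \<and> all_indep k M U} \<noteq> {}" by blast
  obtain U where "U \<subseteq> H \<and> all_indep k M U" "card U = Max (card ` {U. U \<subseteq> H \<and> all_indep k M U})"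
    using Max_in[OF fin ne] by auto
  then have "U \<subseteq> H \<and> all_indep k M U \<and> (\<forall>U'. U' \<subseteq> H \<and> all_indep k M U' \<longrightarrow> card U' \<le> card U)"
    using Max_ge[OF fin] by auto
  then have "generator k M H \<subseteq> H \<and> all_indep k M (generator k M H) \<and>
      (\<forall>U'. U' \<subseteq> H \<and> all_indep k M U' \<longrightarrow> card U' \<le> card (generator k M H))"
    unfolding generator_def by (rule someI)
  then show "generator k M H \<subseteq> H" "all_indep k M (generator k M H)"
    "\<And>U'. U' \<subseteq> H \<Longrightarrow> all_indep k M U' \<Longrightarrow> card U' \<le> card (generator k M H)" by auto
qed

lemma mclosure_sub_generator:
  assumes B1: "B1 \<in> M" "card B1 = k" and B: "B \<subseteq> generator k M (mclosure E M B1)" "card B = k"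
  shows "mclosure E M B = mclosure E M B1" "B \<in> M"
proof -
  show 1: "B \<in> M" using generator[OF B1 refl] B by (auto simp: all_indep_def)
  show "mclosure E M B = mclosure E M B1"
    by (rule mclosure_eq[OF B1 1 B(2)]) (use generator[OF B1 refl] B in auto)
qed

text \<open>If \<open>x\<close> depends on a \<open>(k-1)\<close>-subset \<open>Z\<close> of
  \<open>U\<close>, completing \<open>Z\<close> inside \<open>U\<close> to a \<open>k\<close>-set,
  which spans the same hyperplane, puts \<open>x\<close> into that hyperplane. Conversely, an
  element of the hyperplane that no such \<open>Z\<close> captures could be added to
  \<open>U\<close>, against its maximality.\<close>

lemma spanned_eq_mclosure:
  assumes B: "B \<in> M" "card B = k" and U: "U = generator k M (mclosure E M B)" and c: "k \<le> card U"
  shows "spanned E k (truncation k M) U = mclosure E M B"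
proof (rule equalityI; rule subsetI)
  have US: "U \<subseteq> mclosure E M B" "all_indep k M U" using generator[OF B refl] U by auto
  have fU: "finite U" using finite_subset[OF subset_trans[OF US(1) mclosure_sub] finE] .
  {
    fix x assume x: "x \<in> spanned E k (truncation k M) U"
    show "x \<in> mclosure E M B"
    proof (cases "x \<in> U")
      case True then show ?thesis using US by auto
    next
      case False
      then obtain Z where Z: "Z \<subseteq> U" "Suc (card Z) = k" "insert x Z \<notin> truncation k M" and xE: "x \<in> E"
        using x by (auto simp: spanned_def)
      have fZ: "finite Z" by (rule finite_subset[OF Z(1) fU])
      have "\<not> U \<subseteq> Z" using card_mono[OF fZ, of U] Z(2) c by linarith
      then obtain z where z: "z \<in> U" "z \<notin> Z" by blast
      have B': "insert z Z \<subseteq> U" "card (insert z Z) = k" using z Z(1,2) fZ by auto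
      have cl: "mclosure E M (insert z Z) = mclosure E M B" by (rule mclosure_sub_generator(1)[OF B]) (use B' U in auto)
      have "card (insert x Z) \<le> k" using fZ by (simp add: card_insert_if Z(2)[symmetric])
      then have "insert x Z \<notin> M" using Z(3) by (simp add: truncation_def)
      then have "insert x (insert z Z) \<notin> M" using matroid_mono[OF M, of "insert x (insert z Z)" "insert x Z"] by auto
      then have "x \<in> mclosure E M (insert z Z)" using xE by (auto simp: mclosure_def)
      then show ?thesis using cl by simp
    qed
  }
  {
    fix x assume x: "x \<in> mclosure E M B"
    show "x \<in> spanned E k (truncation k M) U"
    proof (rule ccontr)
      assume n: "x \<notin> spanned E k (truncation k M) U"
      then have xU: "x \<notin> U" and 1: "\<And>Z. Z \<subseteq> U \<Longrightarrow> Suc (card Z) = k \<Longrightarrow> insert x Z \<in> M"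
        using x mclosure_sub[of B] unfolding spanned_def truncation_def by blast+
      have "all_indep k M (insert x U)"
        unfolding all_indep_def
      proof (intro allI impI)
        fix C assume C: "C \<subseteq> insert x U" "card C = k"
        have fC: "finite C" by (rule finite_subset[OF C(1)]) (use fU in simp)
        show "C \<in> M"
        proof (cases "x \<in> C")
          case True
          have "C - {x} \<subseteq> U" "Suc (card (C - {x})) = k" using C True fC k by (auto simp: card_Diff_singleton)
          from 1[OF this] True show ?thesis by (simp add: insert_absorb)
        next
          case False then show ?thesis using C US by (auto simp: all_indep_def)
        qed
      qed
      moreover have "insert x U \<subseteq> mclosure E M B" using x US by auto
      ultimately have "card (insert x U) \<le> card U" using generator(3)[OF B refl] U by auto
      then show False using xU fU by auto
    qed
  }
qed

text \<open>A \<open>(k+1)\<close>-set with independent \<open>k\<close>-subsets is independent or a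
  circuit, and a circuit lies in the hyperplane spanned by any of its \<open>k\<close>-subsets. This
  makes the top level of \<open>M\<close> readable from the truncation and the generators.\<close>

lemma indep_iff:
  assumes R: "R \<subseteq> E" "card R = Suc k"
  shows "R \<in> M \<longleftrightarrow> (\<forall>B\<subseteq>R. card B = k \<longrightarrow> B \<in> truncation k M) \<and>
    (\<forall>U\<in>generators E k M. \<not> R \<subseteq> spanned E k (truncation k M) U)"
proof
  assume RM: "R \<in> M"
  have "\<not> R \<subseteq> spanned E k (truncation k M) U" if U: "U \<in> generators E k M" for U
  proof
    assume sub: "R \<subseteq> spanned E k (truncation k M) U"
    obtain B where B: "B \<in> M" "card B = k" "U = generator k M (mclosure E M B)" "Suc k \<le> card U"
      using U by (auto simp: generators_def)
    have sub: "R \<subseteq> mclosure E M B" using spanned_eq_mclosure[OF B(1-3)] B(4) sub by auto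
    obtain y where "y \<in> R - B" "insert y B \<in> M" using matroid_augment[OF M B(1) RM] B R by auto
    then show False using sub by (auto simp: mclosure_def)
  qed
  then show "(\<forall>B\<subseteq>R. card B = k \<longrightarrow> B \<in> truncation k M) \<and>
    (\<forall>U\<in>generators E k M. \<not> R \<subseteq> spanned E k (truncation k M) U)"
    using matroid_mono[OF M RM] by (auto simp: truncation_def)
next
  assume a: "(\<forall>B\<subseteq>R. card B = k \<longrightarrow> B \<in> truncation k M) \<and>
    (\<forall>U\<in>generators E k M. \<not> R \<subseteq> spanned E k (truncation k M) U)"
  show "R \<in> M"
  proof (rule ccontr)
    assume RM: "R \<notin> M"
    have fR: "finite R" using R finE finite_subset by auto
    obtain z where z: "z \<in> R" using R by fastforce
    define B where "B = R - {z}"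
    have B: "B \<in> M" "card B = k" using a z R fR by (auto simp: B_def truncation_def)
    have RH: "R \<subseteq> mclosure E M B"
    proof
      fix x assume "x \<in> R"
      then have "x \<in> B \<or> insert x B = R" using z by (auto simp: B_def)
      then show "x \<in> mclosure E M B" using RM \<open>x \<in> R\<close> R by (auto simp: mclosure_def)
    qed
    \<comment> \<open>The circuit \<open>R\<close> itself competes for the maximum, so the generator
      of this hyperplane passes the size filter.\<close>
    have "all_indep k M R" using a by (auto simp: all_indep_def truncation_def)
    then have c: "Suc k \<le> card (generator k M (mclosure E M B))" using generator(3)[OF B refl RH] R by auto
    then have "generator k M (mclosure E M B) \<in> generators E k M" using B by (auto simp: generators_def)
    then have "\<not> R \<subseteq> spanned E k (truncation k M) (generator k M (mclosure E M B))"
      by (rule bspec[OF conjunct2[OF a]])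
    moreover have "spanned E k (truncation k M) (generator k M (mclosure E M B)) = mclosure E M B"
      by (rule spanned_eq_mclosure[OF B refl]) (use c in simp)
    ultimately show False using RH by simp
  qed
qed

text \<open>A common \<open>k\<close>-subset is independent and spans both hyperplanes; these then
  coincide, and with them the chosen generators.\<close>

lemma generators_inter:
  assumes "U \<in> generators E k M" "U' \<in> generators E k M" "U \<noteq> U'"
  shows "card (U \<inter> U') < k"
proof (rule ccontr)
  assume "\<not> card (U \<inter> U') < k"
  then obtain C where C: "C \<subseteq> U \<inter> U'" "card C = k" by (meson not_less obtain_subset_with_card_n)
  obtain B B' where B: "B \<in> M" "card B = k" "U = generator k M (mclosure E M B)"
    and B': "B' \<in> M" "card B' = k" "U' = generator k M (mclosure E M B')"
    using assms by (auto simp: generators_def)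
  have "mclosure E M B = mclosure E M B'"
    using mclosure_sub_generator(1)[OF B(1,2), of C] mclosure_sub_generator(1)[OF B'(1,2), of C] C B(3) B'(3) by auto
  then show False using B B' assms by simp
qed

lemma generators_sub:
  assumes "U \<in> generators E k M"
  shows "U \<subseteq> E"
proof -
  obtain B where B: "B \<in> M" "card B = k" "U = generator k M (mclosure E M B)"
    using assms by (auto simp: generators_def)
  then show ?thesis using subset_trans[OF generator(1)[OF B(1,2) refl] mclosure_sub] by simp
qed

end

section \<open>Counting matroids by successive truncation\<close>

lemma num_matroids_Suc_le:
  assumes k: "k \<ge> 1"
  shows "num_matroids n (Suc k) \<le> num_matroids n k * card (packings n (Suc k))"
proof -
  let ?M = "\<lambda>r. {M. matroid {1..n} M \<and> matroid_rank M = r}"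
  have fin: "finite (?M r)" for r
    by (rule finite_subset[of _ "Pow (Pow {1..n})"]) (auto simp: matroid_def)
  let ?f = "\<lambda>M. (truncation k M, generators {1..n} k M)"
  have "inj_on ?f (?M (Suc k))"
  proof (rule inj_onI)
    fix M N assume M: "M \<in> ?M (Suc k)" and N: "N \<in> ?M (Suc k)" and eq: "?f M = ?f N"
    have "X \<in> M \<longleftrightarrow> X \<in> N" for X
    proof -
      consider "\<not> X \<subseteq> {1..n}" | "card X \<le> k" | "card X = Suc k" "X \<subseteq> {1..n}" | "card X > Suc k"
        by linarith
      then show ?thesis
      proof cases
        case 1 then show ?thesis using M N by (auto simp: matroid_def)
      next
        case 2 then show ?thesis using eq unfolding truncation_def by blast
      next
        case 3 then show ?thesis using indep_iff[of "{1..n}" M k X] indep_iff[of "{1..n}" N k X] M N k eq by auto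
      next
        case 4 then show ?thesis using matroid_rankD(1)[of "{1..n}" M "Suc k" X] matroid_rankD(1)[of "{1..n}" N "Suc k" X] M N by auto
      qed
    qed
    then show "M = N" by blast
  qed
  moreover have "?f ` ?M (Suc k) \<subseteq> ?M k \<times> packings n (Suc k)"
  proof
    fix x assume "x \<in> ?f ` ?M (Suc k)"
    then obtain M where M: "matroid {1..n} M" "matroid_rank M = Suc k" and x: "x = ?f M" by auto
    have "generators {1..n} k M \<in> packings n (Suc k)"
      using generators_inter[OF M k] generators_sub[OF M k]
      by (auto simp: packings_def) (auto simp: generators_def)
    then show "x \<in> ?M k \<times> packings n (Suc k)" using x truncation_matroid[OF M] by auto
  qed
  ultimately have "card (?M (Suc k)) \<le> card (?M k \<times> packings n (Suc k))"
    by (rule card_inj_on_le) (use fin finite_packings in auto)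
  then show ?thesis by (simp add: num_matroids_def card_cartesian_product)
qed

text \<open>A matroid of rank one is determined by its non-loops.\<close>

lemma num_matroids_1_le: "num_matroids n 1 \<le> 2 ^ n"
proof -
  let ?M = "{M. matroid {1..n} M \<and> matroid_rank M = 1}"
  let ?f = "\<lambda>M. {x. {x} \<in> M}"
  have "inj_on ?f ?M"
  proof (rule inj_onI)
    fix M N assume M: "M \<in> ?M" and N: "N \<in> ?M" and eq: "?f M = ?f N"
    have "X \<in> M \<longleftrightarrow> X \<in> N" for X
    proof -
      consider "X = {}" | x where "X = {x}" | "card X > 1" | "infinite X"
        by (metis One_nat_def Suc_lessI card_1_singletonE card_gt_0_iff)
      then show ?thesis
      proof cases
        case 1 then show ?thesis using M N by (auto simp: matroid_def)
      next
        case 2 then show ?thesis using eq by blast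
      next
        case 3 then show ?thesis using matroid_rankD(1)[of "{1..n}" M 1 X] matroid_rankD(1)[of "{1..n}" N 1 X] M N by auto
      next
        case 4 then show ?thesis using matroid_finite_card(1)[of "{1..n}" M X] matroid_finite_card(1)[of "{1..n}" N X] M N by auto
      qed
    qed
    then show "M = N" by blast
  qed
  moreover have "?f ` ?M \<subseteq> Pow {1..n}" by (auto simp: matroid_def)
  ultimately have "card ?M \<le> card (Pow {1..n})" by (rule card_inj_on_le) auto
  then show ?thesis by (simp add: num_matroids_def card_Pow)
qed

section \<open>Sparse paving matroids\<close>

lemma sparse_paving_matroid:
  assumes G: "G \<subseteq> {R. R \<subseteq> {1..n} \<and> card R = r}"
    and sep: "\<And>R R'. R \<in> G \<Longrightarrow> R' \<in> G \<Longrightarrow> R \<noteq> R' \<Longrightarrow> card (R \<inter> R') < r - 1"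
    and r: "r \<ge> 1" "r < n"
  defines "M \<equiv> {X. X \<subseteq> {1..n} \<and> card X \<le> r \<and> X \<notin> G}"
  shows "matroid {1..n} M" "matroid_rank M = r"
proof -
  show 1: "matroid {1..n} M"
    unfolding matroid_def
  proof (intro conjI allI impI)
    show "{} \<in> M" using G r by (auto simp: M_def)
  next
    fix X Y assume "Y \<in> M \<and> X \<subseteq> Y"
    then have Y: "Y \<in> M" "X \<subseteq> Y" by auto
    have f: "finite Y" using Y finite_subset by (auto simp: M_def)
    show "X \<in> M"
    proof (cases "X = Y")
      case False
      then have "card X < card Y" using Y f by (simp add: psubset_card_mono psubset_eq)
      then show ?thesis using Y G by (auto simp: M_def)
    qed (use Y in simp)
  next
    fix X Y assume a: "X \<in> M \<and> Y \<in> M \<and> card X < card Y"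
    then have f: "finite X" "finite Y" using finite_subset by (auto simp: M_def)
    \<comment> \<open>If exchange fails, every \<open>insert y X\<close> lies in \<open>G\<close>.
      Two of these would meet exactly in \<open>X\<close>, of size \<open>r - 1\<close>; so
      \<open>Y - X\<close> is a single element and \<open>Y\<close> itself lies in
      \<open>G\<close>.\<close>
    show "\<exists>y\<in>Y - X. insert y X \<in> M"
    proof (rule ccontr)
      assume n: "\<not> (\<exists>y\<in>Y - X. insert y X \<in> M)"
      have iG: "insert y X \<in> G" if "y \<in> Y - X" for y
      proof -
        have "insert y X \<subseteq> {1..n}" "card (insert y X) \<le> r" using a that f by (auto simp: M_def)
        then show ?thesis using n that by (auto simp: M_def)
      qed
      have ne: "Y - X \<noteq> {}" using a f by (metis Diff_eq_empty_iff card_mono leD)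
      then obtain y where y: "y \<in> Y - X" by blast
      have cX: "card X = r - 1" using iG[OF y] G y f by auto
      have uniq: "y' = y" if "y' \<in> Y - X" for y'
      proof (rule ccontr)
        assume "y' \<noteq> y"
        then have "insert y X \<inter> insert y' X = X" "insert y X \<noteq> insert y' X" using y that by auto
        then show False using sep[OF iG[OF y] iG[OF that]] cX by auto
      qed
      then have "Y \<subseteq> insert y X" by auto
      moreover have "card (insert y X) \<le> card Y" using a y f by auto
      ultimately have "Y = insert y X" using f by (simp add: card_seteq)
      then show False using iG[OF y] a by (auto simp: M_def)
    qed
  qed (auto simp: M_def)
  have "\<exists>B\<in>M. card B = r"
  proof (rule ccontr)
    assume n: "\<not> (\<exists>B\<in>M. card B = r)"
    \<comment> \<open>Two \<open>r\<close>-sets sharing \<open>r - 1\<close> elements cannot both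
      lie in \<open>G\<close>; the second one uses the element \<open>r + 1\<close>, available since
      \<open>r < n\<close>.\<close>
    let ?A = "{1..r}" and ?B = "insert (r+1) {1..<r}"
    have iG: "X \<in> G" if "X \<subseteq> {1..n}" "card X = r" for X
    proof (rule ccontr)
      assume "X \<notin> G"
      then have "X \<in> M" using that by (simp add: M_def)
      then show False using n that(2) by blast
    qed
    have A: "?A \<in> G" by (rule iG) (use r in auto)
    have B: "?B \<in> G" by (rule iG) (use r in auto)
    have "r + 1 \<in> ?B" "r + 1 \<notin> ?A" by auto
    then have ne: "?A \<noteq> ?B" by blast
    have "?A \<inter> ?B = {1..<r}" using r by auto
    then have "card (?A \<inter> ?B) = r - 1" by simp
    then show False using sep[OF A B ne] by simp
  qed
  then show "matroid_rank M = r" using matroid_rankI[OF 1, of r] by (auto simp: M_def)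
qed

lemma num_matroids_ge:
  assumes "r \<ge> 1" "r < n"
  shows "card {G. G \<subseteq> {R. R \<subseteq> {1..n} \<and> card R = r} \<and>
      (\<forall>R\<in>G. \<forall>R'\<in>G. R \<noteq> R' \<longrightarrow> card (R \<inter> R') < r - 1)} \<le> num_matroids n r"
proof -
  let ?f = "\<lambda>G. {X. X \<subseteq> {1..n} \<and> card X \<le> r \<and> X \<notin> G}"
  let ?S = "{G. G \<subseteq> {R. R \<subseteq> {1..n} \<and> card R = r} \<and>
      (\<forall>R\<in>G. \<forall>R'\<in>G. R \<noteq> R' \<longrightarrow> card (R \<inter> R') < r - 1)}"
  have "inj_on ?f ?S"
  proof (rule inj_onI)
    fix G G' assume G: "G \<in> ?S" and G': "G' \<in> ?S" and eq: "?f G = ?f G'"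
    have "X \<in> G \<longleftrightarrow> X \<in> G'" for X
    proof (cases "X \<subseteq> {1..n} \<and> card X = r")
      case True
      then have "X \<in> ?f G \<longleftrightarrow> X \<notin> G" "X \<in> ?f G' \<longleftrightarrow> X \<notin> G'" by auto
      then show ?thesis using eq by blast
    qed (use G G' in auto)
    then show "G = G'" by blast
  qed
  moreover have "?f ` ?S \<subseteq> {M. matroid {1..n} M \<and> matroid_rank M = r}"
  proof
    fix x assume "x \<in> ?f ` ?S"
    then obtain G where G: "G \<in> ?S" and x: "x = ?f G" by auto
    show "x \<in> {M. matroid {1..n} M \<and> matroid_rank M = r}"
      using sparse_paving_matroid[of G n r] G x assms by auto
  qed
  ultimately show ?thesis unfolding num_matroids_def
    by (rule card_inj_on_le) (rule finite_subset[of _ "Pow (Pow {1..n})"], auto simp: matroid_def)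
qed

section \<open>Matchings in linear hypergraphs\<close>

definition degree :: "'v set set \<Rightarrow> 'v \<Rightarrow> nat" where
  "degree E v = card {f \<in> E. v \<in> f}"

definition linear_hg :: "'v set set \<Rightarrow> bool" where
  "linear_hg E \<longleftrightarrow> (\<forall>e\<in>E. \<forall>f\<in>E. e \<noteq> f \<longrightarrow> card (e \<inter> f) \<le> 1)"

definition avoiding :: "'v set set \<Rightarrow> 'v set \<Rightarrow> 'v set set" where
  "avoiding E e = {f \<in> E. f \<inter> e = {}}"

definition matchings :: "'v set set \<Rightarrow> 'v set set set" where
  "matchings E = {T. T \<subseteq> E \<and> (\<forall>e\<in>T. \<forall>f\<in>T. e \<noteq> f \<longrightarrow> e \<inter> f = {})}"

lemma avoiding_subset: "avoiding E e \<subseteq> E" by (auto simp: avoiding_def)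

lemma finite_avoiding: "finite E \<Longrightarrow> finite (avoiding E e)" by (simp add: avoiding_def)

lemma finite_matchings: "finite E \<Longrightarrow> finite (matchings E)"
  by (rule finite_subset[of _ "Pow E"]) (auto simp: matchings_def)

lemma matching_finite: "finite E \<Longrightarrow> T \<in> matchings E \<Longrightarrow> finite T"
  by (simp add: matchings_def) (metis finite_subset)

lemma matchings_mono: "E \<subseteq> F \<Longrightarrow> matchings E \<subseteq> matchings F"
  by (auto simp: matchings_def)

lemma linear_hg_mono: "linear_hg F \<Longrightarrow> E \<subseteq> F \<Longrightarrow> linear_hg E"
  by (auto simp: linear_hg_def)

text \<open>Double counting of pairs of a matching and one of its edges. The predicate
  \<open>P\<close> lets one statement serve matchings of exact size, as in the upper bound, and of
  bounded size, as in the lower bound.\<close>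

lemma sum_matchings_remove:
  fixes F :: "'v set \<Rightarrow> 'v set set \<Rightarrow> real"
  assumes fin: "finite E" and ne: "{} \<notin> E"
  shows "(\<Sum>T\<in>{T \<in> matchings E. P (card T)}. \<Sum>e\<in>T. F e (T - {e}))
       = (\<Sum>e\<in>E. \<Sum>T\<in>{T \<in> matchings (avoiding E e). P (Suc (card T))}. F e T)"
proof -
  let ?A = "{T \<in> matchings E. P (card T)}"
  let ?B = "\<lambda>e. {T \<in> matchings (avoiding E e). P (Suc (card T))}"
  have fA: "finite ?A" using finite_matchings[OF fin] by simp
  have fB: "finite (?B e)" for e using finite_matchings[OF finite_avoiding[OF fin]] by simp
  note fT = matching_finite[OF fin]
  have "(\<Sum>T\<in>?A. \<Sum>e\<in>T. F e (T - {e})) = (\<Sum>(T, e)\<in>Sigma ?A (\<lambda>T. T). F e (T - {e}))"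
    by (rule sum.Sigma) (use fA fT in auto)
  also have "\<dots> = (\<Sum>(e, T)\<in>Sigma E ?B. F e T)"
  proof (rule sum.reindex_bij_witness[where i = "\<lambda>(e, T). (insert e T, e)" and j = "\<lambda>(T, e). (e, T - {e})"])
    fix a assume "a \<in> Sigma ?A (\<lambda>T. T)"
    then obtain T e where a: "a = (T, e)" "T \<in> matchings E" "P (card T)" "e \<in> T" by auto
    show "(case case a of (T, e) \<Rightarrow> (e, T - {e}) of (e, T) \<Rightarrow> (insert e T, e)) = a" using a by auto
    have "Suc (card (T - {e})) = card T" using a fT[OF a(2)] by (metis card_Suc_Diff1)
    then show "(case a of (T, e) \<Rightarrow> (e, T - {e})) \<in> Sigma E ?B"
      using a by (auto simp: matchings_def avoiding_def)
  next
    fix b assume "b \<in> Sigma E ?B"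
    then obtain e T where b: "b = (e, T)" "e \<in> E" "T \<in> matchings (avoiding E e)" "P (Suc (card T))" by auto
    have eT: "e \<notin> T" using b ne by (auto simp: matchings_def avoiding_def)
    have "T \<in> matchings E" using b(3) matchings_mono[OF avoiding_subset] by auto
    then have "finite T" using fT by auto
    then show "(case b of (e, T) \<Rightarrow> (insert e T, e)) \<in> Sigma ?A (\<lambda>T. T)"
      using b eT by (auto simp: matchings_def avoiding_def)
    show "(case case b of (e, T) \<Rightarrow> (insert e T, e) of (T, e) \<Rightarrow> (e, T - {e})) = b" using b eT by auto
  qed auto
  also have "\<dots> = (\<Sum>e\<in>E. \<Sum>T\<in>?B e. F e T)"
    by (rule sum.Sigma[symmetric]) (use fin fB in auto)
  finally show ?thesis .
qed

lemma sum_degree: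
  fixes g :: "'v \<Rightarrow> real"
  assumes "finite U" "finite E" "E \<subseteq> Pow U"
  shows "(\<Sum>v\<in>U. real (degree E v) * g v) = (\<Sum>f\<in>E. \<Sum>v\<in>f. g v)"
proof -
  have "(\<Sum>v\<in>U. real (degree E v) * g v) = (\<Sum>v\<in>U. \<Sum>f\<in>{f\<in>E. v \<in> f}. g v)"
    by (simp add: degree_def)
  also have "\<dots> = (\<Sum>f\<in>E. \<Sum>v\<in>{v\<in>U. v \<in> f}. g v)"
    by (rule sum.swap_restrict) (use assms in auto)
  also have "\<dots> = (\<Sum>f\<in>E. \<Sum>v\<in>f. g v)"
    by (rule sum.cong[OF refl], rule sum.cong) (use assms in auto)
  finally show ?thesis .
qed

lemma sum_degree_uniform:
  assumes "finite U" "finite E" "E \<subseteq> Pow U" "\<And>f. f \<in> E \<Longrightarrow> card f = r"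
  shows "(\<Sum>v\<in>U. real (degree E v)) = real r * real (card E)"
  using sum_degree[OF assms(1-3), of "\<lambda>_. 1"] assms(4) by simp

section \<open>Counting matchings from above\<close>

text \<open>Jensen's inequality for the convex function \<open>\<Prod>i\<in>I. 1 / y i\<close> of
  positive arguments, derived from its tangent plane at the averages: the linear part sums to zero
  over \<open>S\<close>.\<close>

lemma prod_inverse_avg_le:
  fixes y :: "'i \<Rightarrow> 'e \<Rightarrow> real"
  assumes S: "finite S" "S \<noteq> {}" and I: "finite I"
    and pos: "\<And>i e. i \<in> I \<Longrightarrow> e \<in> S \<Longrightarrow> y i e > 0"
  shows "(\<Prod>i\<in>I. 1 / ((\<Sum>e\<in>S. y i e) / card S)) \<le> (\<Sum>e\<in>S. \<Prod>i\<in>I. 1 / y i e) / card S"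
proof -
  define a where "a i = (\<Sum>e\<in>S. y i e) / card S" for i
  have cS: "real (card S) > 0" using S by (simp add: card_gt_0_iff)
  have a: "a i > 0" if "i \<in> I" for i
    unfolding a_def using cS S pos[OF that] by (intro divide_pos_pos sum_pos) auto
  define P where "P = (\<Prod>i\<in>I. 1 / a i)"
  have P: "P > 0" unfolding P_def using a by (intro prod_pos) auto
  have key: "P * (1 - (\<Sum>i\<in>I. y i e / a i - 1)) \<le> (\<Prod>i\<in>I. 1 / y i e)" if e: "e \<in> S" for e
  proof -
    have p: "y i e / a i > 0" if "i \<in> I" for i using a[OF that] pos[OF that e] by simp
    have "1 - (\<Sum>i\<in>I. y i e / a i - 1) \<le> 1 - (\<Sum>i\<in>I. ln (y i e / a i))"
      using sum_mono[of I "\<lambda>i. ln (y i e / a i)" "\<lambda>i. y i e / a i - 1"] ln_le_minus_one p by auto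
    also have "\<dots> \<le> exp (- (\<Sum>i\<in>I. ln (y i e / a i)))"
      using exp_ge_add_one_self[of "- (\<Sum>i\<in>I. ln (y i e / a i))"] by simp
    also have "\<dots> = (\<Prod>i\<in>I. exp (- ln (y i e / a i)))"
      by (simp add: exp_sum[OF I] sum_negf[symmetric])
    also have "\<dots> = (\<Prod>i\<in>I. a i / y i e)"
      by (rule prod.cong) (use p in \<open>auto simp: exp_minus\<close>)
    finally have 1: "1 - (\<Sum>i\<in>I. y i e / a i - 1) \<le> (\<Prod>i\<in>I. a i / y i e)" .
    have "P * (1 - (\<Sum>i\<in>I. y i e / a i - 1)) \<le> P * (\<Prod>i\<in>I. a i / y i e)"
      using 1 P by (intro mult_left_mono) auto
    also have "\<dots> = (\<Prod>i\<in>I. 1 / y i e)"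
      unfolding P_def prod.distrib[symmetric] by (rule prod.cong) (use a in \<open>force simp: less_le\<close>)+
    finally show ?thesis .
  qed
  have "(\<Sum>e\<in>S. (\<Sum>i\<in>I. y i e / a i - 1)) = (\<Sum>i\<in>I. \<Sum>e\<in>S. (y i e / a i - 1))"
    by (rule sum.swap)
  also have "\<dots> = (\<Sum>i\<in>I. 0)"
  proof (rule sum.cong[OF refl])
    fix i assume i: "i \<in> I"
    have "(\<Sum>e\<in>S. (y i e / a i - 1)) = (\<Sum>e\<in>S. y i e) / a i - card S"
      by (simp add: sum_subtractf sum_divide_distrib)
    also have "(\<Sum>e\<in>S. y i e) = a i * card S" using cS by (simp add: a_def)
    finally show "(\<Sum>e\<in>S. (y i e / a i - 1)) = 0" using a[OF i] by simp
  qed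
  finally have 0: "(\<Sum>e\<in>S. (\<Sum>i\<in>I. y i e / a i - 1)) = 0" by simp
  have "(\<Sum>e\<in>S. P * (1 - (\<Sum>i\<in>I. y i e / a i - 1))) = P * card S"
    by (simp only: sum_distrib_left[symmetric] sum_subtractf[where f="\<lambda>_. 1"] 0) simp
  moreover have "(\<Sum>e\<in>S. P * (1 - (\<Sum>i\<in>I. y i e / a i - 1))) \<le> (\<Sum>e\<in>S. \<Prod>i\<in>I. 1 / y i e)"
    by (rule sum_mono) (rule key)
  ultimately have "P * card S \<le> (\<Sum>e\<in>S. \<Prod>i\<in>I. 1 / y i e)" by simp
  then show ?thesis using cS unfolding P_def a_def by (simp add: pos_le_divide_eq)
qed

definition touching :: "'v set set \<Rightarrow> 'v set \<Rightarrow> nat" where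
  "touching T f = card {e \<in> T. e \<inter> f \<noteq> {}}"

text \<open>The expected number of edges still available when a random set of \<open>i\<close> of the \<open>k\<close> edges of
  the matching \<open>T\<close> remains to be placed.\<close>

definition avail :: "nat \<Rightarrow> nat \<Rightarrow> 'v set set \<Rightarrow> 'v set set \<Rightarrow> real" where
  "avail i k E T = (\<Sum>f\<in>E. real (i choose touching T f) / real (k choose touching T f))"

lemma touching_le: "finite T \<Longrightarrow> touching T f \<le> card T"
  unfolding touching_def by (rule card_mono) auto

lemma touching_member:
  assumes "T \<in> matchings E" "f \<in> T" "{} \<notin> E"
  shows "touching T f = 1"
proof -
  have "{e \<in> T. e \<inter> f \<noteq> {}} = {f}" using assms by (auto simp: matchings_def)
  then show ?thesis by (simp add: touching_def)
qed

lemma avail_pos: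
  assumes "finite E" "{} \<notin> E" "T \<in> matchings E" "T \<noteq> {}" "1 \<le> i" "card T = k"
  shows "avail i k E T > 0"
proof -
  obtain f where f: "f \<in> T" using assms by auto
  have "f \<in> E" using f assms by (auto simp: matchings_def)
  have "finite T" using matching_finite[OF assms(1,3)] .
  then have "k > 0" using assms(4,6) card_gt_0_iff[of T] by simp
  then have "real (i choose touching T f) / real (k choose touching T f) > 0"
    using touching_member[OF assms(3) f assms(2)] assms(5) by simp
  then show ?thesis unfolding avail_def using \<open>f \<in> E\<close> assms(1) by (intro sum_pos2[where i=f]) auto
qed

text \<open>\<open>(i choose j) / (k choose j)\<close> is the probability that \<open>j\<close>
  given edges all belong to a random \<open>i\<close>-subset of \<open>k\<close> edges. When the
  subset is drawn from \<open>Suc k\<close> edges in two stages, the edge discarded at first has to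
  avoid the \<open>j\<close> given ones, which has probability
  \<open>(Suc k - j) / Suc k\<close>.\<close>

lemma binomial_ratio_step:
  assumes "i \<le> k" "j \<le> Suc k"
  shows "real (Suc k - j) * (real (i choose j) / real (k choose j)) / real (Suc k)
       = real (i choose j) / real (Suc k choose j)"
proof (cases "j = Suc k")
  case True then show ?thesis using assms by simp
next
  case False
  then have j: "j \<le> k" using assms by simp
  have p: "real (k choose j) > 0" "real (Suc k choose j) > 0" using j by auto
  have "Suc k * (k choose j) = (Suc k choose j) * (Suc k - j)"
    using binomial_absorb_comp[of "Suc k" j] by (simp only: mult.commute diff_Suc_1)
  then have "real (Suc k) * real (k choose j) = real (Suc k choose j) * real (Suc k - j)"
    by (metis of_nat_mult)
  then have "real (Suc k - j) = real (Suc k) * real (k choose j) / real (Suc k choose j)"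
    using p by (simp add: eq_divide_eq mult.commute del: binomial_Suc_Suc of_nat_Suc)
  then show ?thesis using p by (simp del: binomial_Suc_Suc of_nat_Suc)
qed

text \<open>The law of total expectation, conditioning on the edge \<open>e\<close> of
  \<open>T\<close> that is placed first.\<close>

lemma avail_avg:
  assumes fin: "finite E" and ne: "{} \<notin> E" and T: "T \<in> matchings E" "card T = Suc k" and i: "i \<le> k"
  shows "(\<Sum>e\<in>T. avail i k (avoiding E e) (T - {e})) / card T = avail i (Suc k) E T"
proof -
  have fT: "finite T" using T card.infinite by fastforce
  let ?g = "\<lambda>f. real (i choose touching T f) / real (k choose touching T f)"
  have t: "touching (T - {e}) f = touching T f" if "f \<in> avoiding E e" for e f
    unfolding touching_def by (rule arg_cong[where f=card]) (use that in \<open>auto simp: avoiding_def\<close>)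
  have "(\<Sum>e\<in>T. avail i k (avoiding E e) (T - {e})) = (\<Sum>e\<in>T. \<Sum>f\<in>{f\<in>E. f \<inter> e = {}}. ?g f)"
    unfolding avail_def using t by (simp add: avoiding_def)
  also have "\<dots> = (\<Sum>f\<in>E. \<Sum>e\<in>{e\<in>T. f \<inter> e = {}}. ?g f)"
    by (rule sum.swap_restrict) (use fT fin in auto)
  also have "\<dots> = (\<Sum>f\<in>E. real (Suc k - touching T f) * ?g f)"
  proof (rule sum.cong[OF refl])
    fix f
    have "{e\<in>T. f \<inter> e = {}} = T - {e\<in>T. e \<inter> f \<noteq> {}}" by auto
    then have "card {e\<in>T. f \<inter> e = {}} = Suc k - touching T f"
      using fT T by (simp add: card_Diff_subset touching_def)
    then show "(\<Sum>e\<in>{e\<in>T. f \<inter> e = {}}. ?g f) = real (Suc k - touching T f) * ?g f" by simp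
  qed
  finally have "(\<Sum>e\<in>T. avail i k (avoiding E e) (T - {e})) / card T
      = (\<Sum>f\<in>E. real (Suc k - touching T f) * ?g f / real (Suc k))"
    by (simp only: T(2) sum_divide_distrib)
  also have "\<dots> = avail i (Suc k) E T"
    unfolding avail_def
    by (rule sum.cong[OF refl], rule binomial_ratio_step[OF i]) (use touching_le[OF fT] T(2) in simp)
  finally show ?thesis .
qed

text \<open>Let \<open>k\<close> edges be picked one by one, each uniformly among those disjoint
  from the earlier ones. The probability of ending with \<open>T\<close> is a sum over the
  \<open>k!\<close> orders of \<open>T\<close> of products of inverse numbers of choices; by Jensen
  it is at least the summand here. Such probabilities add up to at most one. The induction
  conditions on the first edge.\<close>

lemma matching_kraft:
  fixes E :: "'v set set"
  assumes "finite E" "{} \<notin> E"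
  shows "(\<Sum>T\<in>{T \<in> matchings E. card T = k}. fact k / (\<Prod>i=1..k. avail i k E T)) \<le> 1"
  using assms
proof (induction k arbitrary: E)
  case 0
  have "{T \<in> matchings E. card T = 0} = {{}}" (is "?L = _")
  proof
    show "?L \<subseteq> {{}}" using matching_finite[OF 0(1)] by auto
    show "{{}} \<subseteq> ?L" by (simp add: matchings_def)
  qed
  then show ?case by simp
next
  case (Suc k)
  let ?B = "\<lambda>k E T. fact k / (\<Prod>i=1..k. avail i k E T) :: real"
  have le: "?B (Suc k) E T \<le> (\<Sum>e\<in>T. ?B k (avoiding E e) (T - {e})) / card E"
    if T: "T \<in> matchings E" "card T = Suc k" for T
  proof -
    have fT: "finite T" using T card.infinite by fastforce
    have Tne: "T \<noteq> {}" using T by auto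
    have TE: "T \<subseteq> E" using T by (auto simp: matchings_def)
    have "E \<noteq> {}" using TE Tne by auto
    then have cE: "real (card E) > 0" using Suc by (simp add: card_gt_0_iff)
    \<comment> \<open>With all edges of \<open>T\<close> still to be placed every edge is available,
      so the first choice has exactly \<open>card E\<close> possibilities.\<close>
    have top: "avail (Suc k) (Suc k) E T = card E"
    proof -
      have "real (Suc k choose touching T f) / real (Suc k choose touching T f) = 1" for f
        using touching_le[OF fT, of f] T(2) by (simp del: binomial_Suc_Suc)
      then show ?thesis by (simp add: avail_def)
    qed
    have pos: "avail i k (avoiding E e) (T - {e}) > 0" if "i \<in> {1..k}" "e \<in> T" for i e
    proof (rule avail_pos)
      show "finite (avoiding E e)" using Suc finite_avoiding by auto
      show "{} \<notin> avoiding E e" using Suc by (auto simp: avoiding_def)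
      show "T - {e} \<in> matchings (avoiding E e)" using T that by (auto simp: matchings_def avoiding_def)
      show c: "card (T - {e}) = k" using T that fT by simp
      show "T - {e} \<noteq> {}"
      proof
        assume "T - {e} = {}"
        then have "card (T - {e}) = 0" by (simp only: card.empty)
        then show False using c that by simp
      qed
    qed (use that in auto)
    have 1: "(\<Prod>i=1..k. 1 / avail i (Suc k) E T) \<le> (\<Sum>e\<in>T. \<Prod>i=1..k. 1 / avail i k (avoiding E e) (T - {e})) / card T"
      using prod_inverse_avg_le[of T "{1..k}" "\<lambda>i e. avail i k (avoiding E e) (T - {e})", OF fT Tne _ pos]
        avail_avg[OF Suc.prems T] by simp
    have "?B (Suc k) E T = fact (Suc k) / card E * (\<Prod>i=1..k. 1 / avail i (Suc k) E T)"
      by (simp add: prod.nat_ivl_Suc' top prod_dividef del: fact_Suc)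
    also have "\<dots> \<le> fact (Suc k) / card E * ((\<Sum>e\<in>T. \<Prod>i=1..k. 1 / avail i k (avoiding E e) (T - {e})) / card T)"
      by (rule mult_left_mono[OF 1]) simp
    also have "\<dots> = (\<Sum>e\<in>T. ?B k (avoiding E e) (T - {e})) / card E"
    proof -
      have "(\<Sum>e\<in>T. ?B k (avoiding E e) (T - {e})) = fact k * (\<Sum>e\<in>T. \<Prod>i=1..k. 1 / avail i k (avoiding E e) (T - {e}))"
        by (simp add: sum_distrib_left prod_dividef)
      then show ?thesis unfolding T(2) fact_Suc by (simp del: of_nat_Suc)
    qed
    finally show ?thesis .
  qed
  show ?case
  proof (cases "E = {}")
    case True
    then have emp: "{T \<in> matchings E. card T = Suc k} = {}" by (auto simp: matchings_def)
    show ?thesis by (simp only: emp sum.empty zero_le_one)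
  next
    case False
    then have cE: "real (card E) > 0" using Suc by (simp add: card_gt_0_iff)
    have "(\<Sum>T\<in>{T \<in> matchings E. card T = Suc k}. ?B (Suc k) E T)
        \<le> (\<Sum>T\<in>{T \<in> matchings E. card T = Suc k}. (\<Sum>e\<in>T. ?B k (avoiding E e) (T - {e})) / card E)"
      by (rule sum_mono) (use le in auto)
    also have "\<dots> = (\<Sum>e\<in>E. \<Sum>T\<in>{T \<in> matchings (avoiding E e). Suc (card T) = Suc k}. ?B k (avoiding E e) T) / card E"
      unfolding sum_divide_distrib[symmetric]
      by (simp only: sum_matchings_remove[OF Suc.prems, where P="\<lambda>c. c = Suc k" and F="\<lambda>e T. ?B k (avoiding E e) T"])
    also have "\<dots> \<le> (\<Sum>e\<in>E. 1) / card E"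
    proof (rule divide_right_mono[OF sum_mono])
      fix e assume "e \<in> E"
      show "(\<Sum>T\<in>{T \<in> matchings (avoiding E e). Suc (card T) = Suc k}. ?B k (avoiding E e) T) \<le> 1"
        using Suc.IH[OF finite_avoiding[OF Suc.prems(1)], of e] Suc.prems(2) avoiding_subset[of E e]
        by (simp only: nat.inject) blast
    qed simp
    also have "\<dots> = 1" using cE by simp
    finally show ?thesis .
  qed
qed

lemma binomial_ratio_le_power:
  assumes "i \<le> m" "j \<le> m"
  shows "real (i choose j) / real (m choose j) \<le> (real i / real m) ^ j"
  using assms(2)
proof (induction j)
  case 0 then show ?case by simp
next
  case (Suc j)
  show ?case
  proof (cases "i \<le> j")
    case True then show ?thesis by (simp add: binomial_eq_0 le_imp_less_Suc)
  next
    case False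
    have e: "real (n choose Suc j) = real (n choose j) * (real n - real j) / real (Suc j)" if "j \<le> n" for n
    proof -
      have "Suc j * (n choose Suc j) = (n - j) * (n choose j)"
        by (rule trans[OF binomial_absorption binomial_absorb_comp[symmetric]])
      then have "real (Suc j) * real (n choose Suc j) = (real n - real j) * real (n choose j)"
        using that by (metis of_nat_diff of_nat_mult)
      then show ?thesis by (simp add: field_simps del: of_nat_Suc)
    qed
    have m: "real m > real j" "real i > real j" using Suc False by auto
    have "real (i choose Suc j) / real (m choose Suc j)
        = (real (i choose j) / real (m choose j)) * ((real i - real j) / (real m - real j))"
    proof -
      have 1: "real (i choose Suc j) = real (i choose j) * (real i - real j) / real (Suc j)"
        using e False by simp
      have 2: "real (m choose Suc j) = real (m choose j) * (real m - real j) / real (Suc j)"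
        using e Suc by simp
      show ?thesis unfolding 1 2 by (simp del: of_nat_Suc)
    qed
    also have "\<dots> \<le> (real i / real m) ^ j * (real i / real m)"
    proof (rule mult_mono)
      show "(real i - real j) / (real m - real j) \<le> real i / real m"
      proof -
        have "real i * real j \<le> real m * real j" using assms(1) by (simp add: mult_right_mono)
        then show ?thesis using m by (simp add: divide_simps algebra_simps)
      qed
    qed (use Suc m in auto)
    finally show ?thesis by (simp add: mult.commute)
  qed
qed

lemma matching_card_Union:
  assumes "finite E" "T \<in> matchings E" "\<And>f. f \<in> E \<Longrightarrow> card f = r" "r \<ge> 1"
  shows "card (\<Union>T) = r * card T"
proof -
  have T: "T \<subseteq> E" "finite T" using assms(1,2) finite_subset by (auto simp: matchings_def)
  have "card (\<Union>T) = sum card T"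
  proof (rule card_Union_disjoint)
    show "pairwise disjnt T" using assms(2) by (simp add: matchings_def pairwise_def disjnt_def)
    fix f assume "f \<in> T"
    then have "card f = r" using T assms(3) by auto
    then show "finite f" using assms(4) by (simp add: card_ge_0_finite)
  qed
  also have "\<dots> = r * card T" using assms(3) T by (simp add: subset_iff)
  finally show ?thesis .
qed

text \<open>The summands belong to three kinds of edges: members of \<open>T\<close>; edges inside
  the covered set, which survive only if \<open>r\<close> different edges of \<open>T\<close> are
  all still to be placed; and edges at uncovered vertices, at most \<open>D\<close> for
  each.\<close>

lemma avail_le:
  assumes fU: "finite U" and EU: "E \<subseteq> Pow U" and unif: "\<And>f. f \<in> E \<Longrightarrow> card f = r" and r: "r \<ge> 1"
    and lin: "linear_hg E" and deg: "\<And>v. v \<in> U \<Longrightarrow> degree E v \<le> D"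
    and T: "T \<in> matchings E" "card T = m" and i: "1 \<le> i" "i \<le> m"
  shows "avail i m E T \<le> real m + real (card E) * (real i / real m) ^ r + real D * (real (card U) - real r * real m)"
proof -
  have fE: "finite E" by (rule finite_subset[OF EU]) (use fU in simp)
  have TE: "T \<subseteq> E" using T by (auto simp: matchings_def)
  note fT = finite_subset[OF TE fE]
  have ne: "{} \<notin> E" using unif r by fastforce
  let ?h = "\<lambda>f. real (i choose touching T f) / real (m choose touching T f)"
  have h1: "?h f \<le> 1" and h0: "0 \<le> ?h f" for f
  proof -
    have "touching T f \<le> m" using touching_le[OF fT] T by auto
    then have "?h f \<le> (real i / real m) ^ touching T f" using binomial_ratio_le_power[OF i(2)] by auto
    also have "\<dots> \<le> 1" using i by (intro power_le_one) auto
    finally show "?h f \<le> 1" .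
  qed simp
  \<comment> \<open>By linearity an edge of \<open>T\<close> meets \<open>f\<close> in at most one
    vertex, so the \<open>r\<close> covered vertices of \<open>f\<close> belong to \<open>r\<close>
    different edges of \<open>T\<close>.\<close>
  have full: "touching T f = r" if f: "f \<in> E - T" "f \<subseteq> \<Union>T" for f
  proof -
    have c: "card (e \<inter> f) = (if e \<inter> f \<noteq> {} then 1 else 0)" if "e \<in> T" for e
    proof -
      have "card (e \<inter> f) \<le> 1" using lin f(1) that subsetD[OF TE that] unfolding linear_hg_def by (metis DiffD1 DiffD2)
      moreover have "finite (e \<inter> f)" using finite_subset[OF _ fU, of f] f EU by auto
      ultimately show ?thesis by (auto simp: le_Suc_eq)
    qed
    have "r = card f" using unif f by auto
    also have "f = (\<Union>e\<in>T. e \<inter> f)" using f by auto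
    also have "card \<dots> = (\<Sum>e\<in>T. card (e \<inter> f))"
    proof (rule card_UN_disjoint[OF fT])
      show "\<forall>e\<in>T. finite (e \<inter> f)" using finite_subset[OF _ fU, of f] f EU by auto
      show "\<forall>e\<in>T. \<forall>e'\<in>T. e \<noteq> e' \<longrightarrow> e \<inter> f \<inter> (e' \<inter> f) = {}" using T by (auto simp: matchings_def)
    qed
    also have "\<dots> = (\<Sum>e\<in>T. if e \<inter> f \<noteq> {} then 1 else 0)" by (rule sum.cong) (use c in auto)
    also have "\<dots> = touching T f" using fT by (simp add: touching_def sum.If_cases Int_def)
    finally show ?thesis by simp
  qed
  let ?A = "{f \<in> E - T. f \<subseteq> \<Union>T}" and ?N = "{f \<in> E - T. \<not> f \<subseteq> \<Union>T}"
  have split: "E = T \<union> (?A \<union> ?N)" using TE by auto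
  have "avail i m E T = sum ?h (T \<union> (?A \<union> ?N))" unfolding avail_def using split by simp
  also have "\<dots> = sum ?h T + sum ?h (?A \<union> ?N)"
    by (rule sum.union_disjoint) (use fE fT in auto)
  also have "sum ?h (?A \<union> ?N) = sum ?h ?A + sum ?h ?N"
    by (rule sum.union_disjoint) (use fE fT in auto)
  also have "sum ?h T \<le> m" using sum_bounded_above[of T ?h 1] h1 T by auto
  also have "sum ?h ?A \<le> (real i / real m) ^ r * card E"
  proof -
    have "sum ?h ?A \<le> (\<Sum>f\<in>?A. (real i / real m) ^ r)"
    proof (rule sum_mono)
      fix f assume "f \<in> ?A"
      then have "touching T f = r" using full by auto
      moreover have "touching T f \<le> m" using touching_le[OF fT] T by auto
      ultimately show "?h f \<le> (real i / real m) ^ r" using binomial_ratio_le_power[OF i(2)] by auto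
    qed
    also have "\<dots> \<le> (real i / real m) ^ r * card E"
    proof -
      have "card ?A \<le> card E" by (rule card_mono[OF fE]) auto
      then have "(real i / real m) ^ r * card ?A \<le> (real i / real m) ^ r * card E"
        by (intro mult_left_mono) auto
      then show ?thesis by (simp add: mult.commute)
    qed
    finally show ?thesis .
  qed
  also have "sum ?h ?N \<le> real D * (real (card U) - real r * real m)"
  proof -
    have TU: "\<Union>T \<subseteq> U" using TE EU by auto
    have cU: "card (\<Union>T) = r * m" using matching_card_Union[OF fE T(1) unif r] T by auto
    have "sum ?h ?N \<le> (\<Sum>f\<in>?N. 1)" by (rule sum_mono) (rule h1)
    also have "\<dots> = card ?N" by simp
    also have "card ?N \<le> card (\<Union>v\<in>U - \<Union>T. {f\<in>E. v \<in> f})"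
      by (rule card_mono) (use fU fE EU in auto)
    also have "\<dots> \<le> (\<Sum>v\<in>U - \<Union>T. card {f\<in>E. v \<in> f})" by (rule card_UN_le) (use fU in auto)
    also have "\<dots> \<le> (\<Sum>v\<in>U - \<Union>T. D)" by (rule sum_mono) (use deg in \<open>auto simp: degree_def\<close>)
    also have "\<dots> = D * (card U - r * m)"
      using TU cU fU by (simp add: card_Diff_subset finite_subset)
    finally have "sum ?h ?N \<le> real (D * (card U - r * m))" by simp
    moreover have "r * m \<le> card U" using card_mono[OF fU TU] cU by simp
    ultimately show ?thesis by (simp add: of_nat_diff)
  qed
  finally show ?thesis by (simp add: mult.commute)
qed

section \<open>The random greedy matching\<close>

definition deviation :: "'v set set \<Rightarrow> 'v set \<Rightarrow> real \<Rightarrow> real" where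
  "deviation E U d = (\<Sum>v\<in>U. (real (degree E v) - d)\<^sup>2)"

lemma deviation_nonneg: "deviation E U d \<ge> 0"
  by (simp add: deviation_def sum_nonneg)

lemma degree_remove:
  assumes "finite E" "f \<in> E"
  shows "real (degree E v) = real (degree (E - {f}) v) + (if v \<in> f then 1 else 0)"
proof (cases "v \<in> f")
  case True
  have "{g \<in> E. v \<in> g} = insert f {g \<in> E - {f}. v \<in> g}" using assms True by auto
  then have "degree E v = card (insert f {g \<in> E - {f}. v \<in> g})" by (simp add: degree_def)
  also have "\<dots> = Suc (degree (E - {f}) v)" using assms by (simp add: degree_def)
  finally show ?thesis using True by simp
next
  case False
  then have "{g \<in> E. v \<in> g} = {g \<in> E - {f}. v \<in> g}" by auto
  then show ?thesis using False by (simp add: degree_def)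
qed

text \<open>The vertex \<open>v\<close> alone lowers the deviation by more than
  \<open>2 * r * d - 1\<close>, while each of the other \<open>r - 1\<close> vertices of
  \<open>f\<close> raises it by at most \<open>1 + 2 * d\<close>, even if its degree is already
  below the target.\<close>

lemma deviation_remove_le:
  assumes fU: "finite U" and fE: "finite E" and f: "f \<in> E" "f \<subseteq> U" "card f = r"
    and v: "v \<in> f" "real (degree E v) > (real r + 1) * d" and d: "d \<ge> real r / 2"
  shows "deviation (E - {f}) U d \<le> deviation E U d"
proof -
  have ff: "finite f" using finite_subset[OF f(2) fU] .
  let ?x = "\<lambda>w. real (degree E w) - d"
  have "deviation (E - {f}) U d - deviation E U d = (\<Sum>w\<in>U. if w \<in> f then 1 - 2 * ?x w else 0)"
    unfolding deviation_def sum_subtractf[symmetric]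
    by (rule sum.cong[OF refl]) (use degree_remove[OF fE f(1)] in \<open>simp add: power2_eq_square algebra_simps\<close>)
  also have "\<dots> = (\<Sum>w\<in>f. 1 - 2 * ?x w)"
    using f(2) fU by (simp add: sum.If_cases Int_absorb1)
  also have "\<dots> = (1 - 2 * ?x v) + (\<Sum>w\<in>f - {v}. 1 - 2 * ?x w)" by (rule sum.remove[OF ff v(1)])
  also have "(\<Sum>w\<in>f - {v}. 1 - 2 * ?x w) \<le> (\<Sum>w\<in>f - {v}. 1 + 2 * d)"
    by (rule sum_mono) simp
  also have "\<dots> = (real r - 1) * (1 + 2 * d)"
  proof -
    have "Suc (card (f - {v})) = r" using card_Suc_Diff1[OF ff v(1)] f(3) by simp
    then have "real (card (f - {v})) = real r - 1" by linarith
    then show ?thesis by simp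
  qed
  finally have "deviation (E - {f}) U d - deviation E U d \<le> 1 - 2 * ?x v + (real r - 1) * (1 + 2 * d)" by simp
  moreover have "?x v > real r * d" using v(2) by (simp add: algebra_simps)
  then have "1 - 2 * ?x v + (real r - 1) * (1 + 2 * d) < 1 - 2 * (real r * d) + (real r - 1) * (1 + 2 * d)" by simp
  moreover have "\<dots> = real r - 2 * d" by (simp add: algebra_simps)
  ultimately show ?thesis using d by linarith
qed

text \<open>Deleting an edge at a vertex of too large degree never increases the deviation, so in a
  lower bound for the number of matchings the maximum degree may be assumed to be of the order of
  the target degree.\<close>

lemma bounded_degree_subgraph:
  assumes fU: "finite U" and EU: "E \<subseteq> Pow U" and unif: "\<And>f. f \<in> E \<Longrightarrow> card f = r" and d: "d \<ge> real r / 2"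
  shows "\<exists>F\<subseteq>E. (\<forall>v\<in>U. real (degree F v) \<le> (real r + 1) * d) \<and> deviation F U d \<le> deviation E U d"
  using EU unif
proof (induction "card E" arbitrary: E)
  case 0
  have "finite E" by (rule finite_subset[OF 0(2)]) (use fU in simp)
  then have "E = {}" using 0 by simp
  then have "\<forall>v\<in>U. real (degree E v) \<le> (real r + 1) * d" using d by (simp add: degree_def)
  then show ?case by auto
next
  case (Suc n)
  have fE: "finite E" by (rule finite_subset[OF Suc(3)]) (use fU in simp)
  show ?case
  proof (cases "\<forall>v\<in>U. real (degree E v) \<le> (real r + 1) * d")
    case True then show ?thesis by auto
  next
    case False
    then obtain v where v: "v \<in> U" "real (degree E v) > (real r + 1) * d" by force
    have "(real r + 1) * d \<ge> 0" using d by simp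
    then have "degree E v > 0" using v(2) by linarith
    then have "{f\<in>E. v \<in> f} \<noteq> {}" unfolding degree_def by (metis card.empty less_numeral_extra(3))
    then obtain f where f: "f \<in> E" "v \<in> f" by auto
    have "n = card (E - {f})" using Suc(2) f fE by simp
    then obtain F where "F \<subseteq> E - {f}" "\<forall>v\<in>U. real (degree F v) \<le> (real r + 1) * d"
      "deviation F U d \<le> deviation (E - {f}) U d"
      using Suc(1)[of "E - {f}"] Suc(3,4) by auto
    moreover have "deviation (E - {f}) U d \<le> deviation E U d"
      by (rule deviation_remove_le[OF fU fE f(1) _ _ f(2) v(2) d]) (use Suc(3,4) f in auto)
    ultimately show ?thesis by (meson Diff_subset order_trans)
  qed
qed

section \<open>Change of the degree deviation in one step\<close>

lemma square_sum_le:
  fixes x :: "'v \<Rightarrow> real"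
  assumes "finite U"
  shows "(\<Sum>v\<in>U. x v)\<^sup>2 \<le> real (card U) * (\<Sum>v\<in>U. (x v)\<^sup>2)"
proof (cases "U = {}")
  case False
  define u where "u = real (card U)"
  define X where "X = (\<Sum>v\<in>U. x v)"
  have u: "u > 0" using False assms by (simp add: u_def card_gt_0_iff)
  have "0 \<le> (\<Sum>v\<in>U. (x v - X / u)\<^sup>2)" by (simp add: sum_nonneg)
  also have "\<dots> = (\<Sum>v\<in>U. (x v)\<^sup>2 - 2 * (X / u) * x v + (X / u)\<^sup>2)"
    by (rule sum.cong[OF refl]) (simp add: power2_diff)
  also have "\<dots> = (\<Sum>v\<in>U. (x v)\<^sup>2) - 2 * (X / u) * X + u * (X / u)\<^sup>2"
    by (simp only: sum.distrib sum_subtractf sum_distrib_left[symmetric] X_def sum_constant u_def)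
  also have "\<dots> = (\<Sum>v\<in>U. (x v)\<^sup>2) - X\<^sup>2 / u" using u by (simp add: power2_eq_square field_simps)
  finally show ?thesis using u by (simp add: pos_divide_le_eq mult.commute X_def u_def)
qed simp

text \<open>The coefficient of \<open>d\<close> in \<open>sum_deviation_step\<close>, for
  \<open>q = r\<close> and maximum degree \<open>(q + 1) * d\<close>. The first two summands bound
  the squared changes of the deviations; the last one collects cross terms of lower order, its
  factor \<open>2 * q\<close> coming from \<open>u * d \<le> 2 * q * A\<close>.\<close>

definition step_noise :: "real \<Rightarrow> real" where
  "step_noise q = (q * (q - 1))\<^sup>2 + q^3 * (q + 1)
     + 2 * q * (2 * (q * (q - 1))\<^sup>2 * (q + 1) + 2 * (q * (q - 1)) * (q + 1) + 2 * (q - 1) * (q + 1)\<^sup>2)"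

lemma step_noise_nonneg: "q \<ge> 1 \<Longrightarrow> step_noise q \<ge> 0"
  unfolding step_noise_def by (intro add_nonneg_nonneg mult_nonneg_nonneg zero_le_power) auto

context
  fixes U :: "'v set" and E :: "'v set set" and r :: nat
  assumes fU: "finite U" and EU: "E \<subseteq> Pow U" and unif: "\<And>f. f \<in> E \<Longrightarrow> card f = r" and r: "r \<ge> 2"
    and lin: "linear_hg E"
begin

lemma fE: "finite E" by (rule finite_subset[OF EU]) (use fU in simp)

lemma fe: "f \<in> E \<Longrightarrow> finite f" using EU fU finite_subset by (metis PowD subsetD)

definition hit :: "'v set \<Rightarrow> 'v \<Rightarrow> real" where
  "hit e v = real (card {f \<in> E. v \<in> f \<and> f \<inter> e \<noteq> {}})"

lemma degree_avoiding: "real (degree (avoiding E e) v) = real (degree E v) - hit e v"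
proof -
  have "{f \<in> E. v \<in> f} = {f \<in> avoiding E e. v \<in> f} \<union> {f \<in> E. v \<in> f \<and> f \<inter> e \<noteq> {}}"
    by (auto simp: avoiding_def)
  then have "card {f \<in> E. v \<in> f} = card {f \<in> avoiding E e. v \<in> f} + card {f \<in> E. v \<in> f \<and> f \<inter> e \<noteq> {}}"
    using fE by (simp, subst card_Un_disjoint[symmetric]) (auto simp: avoiding_def)
  then show ?thesis by (simp add: degree_def hit_def)
qed

text \<open>Two vertices lie in at most one common edge, so each vertex of \<open>e\<close> accounts
  for at most one lost edge at \<open>v\<close>.\<close>

lemma hit_le:
  assumes e: "e \<in> E" and v: "v \<notin> e"
  shows "hit e v \<le> real r"
proof -
  have "card {f \<in> E. v \<in> f \<and> f \<inter> e \<noteq> {}} \<le> card (\<Union>w\<in>e. {f \<in> E. v \<in> f \<and> w \<in> f})"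
    by (rule card_mono) (use fE fe[OF e] in auto)
  also have "\<dots> \<le> (\<Sum>w\<in>e. card {f \<in> E. v \<in> f \<and> w \<in> f})" by (rule card_UN_le[OF fe[OF e]])
  also have "\<dots> \<le> (\<Sum>w\<in>e. 1)"
  proof (rule sum_mono)
    fix w assume w: "w \<in> e"
    have "f = g" if fg: "f \<in> E" "v \<in> f" "w \<in> f" "g \<in> E" "v \<in> g" "w \<in> g" for f g
    proof (rule ccontr)
      assume "f \<noteq> g"
      then have c: "card (f \<inter> g) \<le> 1" using lin fg by (auto simp: linear_hg_def)
      have "card {v, w} \<le> card (f \<inter> g)" by (rule card_mono) (use fg fe in auto)
      then show False using c v w by (cases "v = w") auto
    qed
    then show "card {f \<in> E. v \<in> f \<and> w \<in> f} \<le> 1"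
      using card_le_Suc0_iff_eq[of "{f \<in> E. v \<in> f \<and> w \<in> f}"] fE by auto
  qed
  also have "\<dots> = r" using unif e by simp
  finally show ?thesis by (simp add: hit_def)
qed

lemma sum_hit_le:
  assumes e: "e \<in> E" and deg: "\<And>v. v \<in> U \<Longrightarrow> real (degree E v) \<le> k"
  shows "(\<Sum>v\<in>U - e. hit e v) \<le> real r * real r * k"
proof -
  have fin: "finite (U - e)" using fU by simp
  have "(\<Sum>v\<in>U - e. hit e v) = (\<Sum>v\<in>U - e. \<Sum>f\<in>{f \<in> {f\<in>E. f \<inter> e \<noteq> {}}. v \<in> f}. 1)"
    by (rule sum.cong[OF refl]) (auto simp: hit_def intro!: arg_cong[where f=card])
  also have "\<dots> = (\<Sum>f\<in>{f\<in>E. f \<inter> e \<noteq> {}}. \<Sum>v\<in>{v \<in> U - e. v \<in> f}. 1)"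
    by (rule sum.swap_restrict[OF fin]) (use fE in simp)
  also have "\<dots> \<le> (\<Sum>f\<in>{f\<in>E. f \<inter> e \<noteq> {}}. real r)"
  proof (rule sum_mono)
    fix f assume f: "f \<in> {f\<in>E. f \<inter> e \<noteq> {}}"
    have "card {v \<in> U - e. v \<in> f} \<le> card f" by (rule card_mono) (use f fe in auto)
    then show "(\<Sum>v\<in>{v \<in> U - e. v \<in> f}. 1) \<le> real r" using unif f by simp
  qed
  also have "\<dots> = real r * real (card {f\<in>E. f \<inter> e \<noteq> {}})" by simp
  also have "real (card {f\<in>E. f \<inter> e \<noteq> {}}) \<le> real r * k"
  proof -
    have "card {f\<in>E. f \<inter> e \<noteq> {}} \<le> card (\<Union>w\<in>e. {f\<in>E. w \<in> f})"
      by (rule card_mono) (use fE fe[OF e] in auto)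
    also have "\<dots> \<le> (\<Sum>w\<in>e. card {f \<in> E. w \<in> f})" by (rule card_UN_le[OF fe[OF e]])
    finally have "real (card {f\<in>E. f \<inter> e \<noteq> {}}) \<le> (\<Sum>w\<in>e. real (degree E w))"
      unfolding degree_def of_nat_sum[symmetric] of_nat_le_iff .
    also have "\<dots> \<le> (\<Sum>w\<in>e. k)" by (rule sum_mono) (use deg e EU in auto)
    finally show ?thesis using unif e by simp
  qed
  finally show ?thesis by (simp add: mult_left_mono mult.assoc)
qed

text \<open>Pairs of meeting edges \<open>e\<close> and \<open>f\<close> with \<open>v\<close> in
  \<open>f\<close> only, counted by their unique common vertex \<open>w\<close>; the
  \<open>- 1\<close> discounts \<open>f\<close> itself.\<close>

lemma sum_hit_edges:
  "(\<Sum>e\<in>{e\<in>E. v \<notin> e}. hit e v) = (\<Sum>f\<in>{f\<in>E. v \<in> f}. \<Sum>w\<in>f - {v}. real (degree E w) - 1)"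
proof -
  have "(\<Sum>e\<in>{e\<in>E. v \<notin> e}. hit e v) = (\<Sum>e\<in>{e\<in>E. v \<notin> e}. \<Sum>f\<in>{f \<in> {f\<in>E. v \<in> f}. f \<inter> e \<noteq> {}}. 1)"
    by (rule sum.cong[OF refl]) (simp add: hit_def)
  also have "\<dots> = (\<Sum>f\<in>{f\<in>E. v \<in> f}. \<Sum>e\<in>{e \<in> {e\<in>E. v \<notin> e}. f \<inter> e \<noteq> {}}. 1)"
    by (rule sum.swap_restrict) (use fE in auto)
  also have "\<dots> = (\<Sum>f\<in>{f\<in>E. v \<in> f}. \<Sum>w\<in>f - {v}. real (degree E w) - 1)"
  proof (rule sum.cong[OF refl])
    fix f assume f: "f \<in> {f\<in>E. v \<in> f}"
    have ff: "finite f" using f fe by auto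
    have uniq: "w = w'" if "e \<in> E" "e \<noteq> f" "w \<in> e" "w \<in> f" "w' \<in> e" "w' \<in> f" for e w w'
    proof (rule ccontr)
      assume "w \<noteq> w'"
      then have "card {w, w'} = 2" by simp
      moreover have "card {w, w'} \<le> card (e \<inter> f)" by (rule card_mono) (use that ff in auto)
      moreover have "card (e \<inter> f) \<le> 1" using lin that f by (auto simp: linear_hg_def)
      ultimately show False by simp
    qed
    have "{e \<in> {e\<in>E. v \<notin> e}. f \<inter> e \<noteq> {}} = (\<Union>w\<in>f - {v}. {e\<in>E. w \<in> e} - {f})"
    proof (rule equalityI; rule subsetI)
      fix e assume "e \<in> (\<Union>w\<in>f - {v}. {e\<in>E. w \<in> e} - {f})"
      then obtain w where w: "w \<in> f" "w \<noteq> v" "e \<in> E" "w \<in> e" "e \<noteq> f" by auto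
      then have "v \<notin> e" using uniq[of e w v] f by auto
      then show "e \<in> {e \<in> {e\<in>E. v \<notin> e}. f \<inter> e \<noteq> {}}" using w by auto
    qed (use f in auto)
    moreover have "card (\<Union>w\<in>f - {v}. {e\<in>E. w \<in> e} - {f}) = (\<Sum>w\<in>f - {v}. card ({e\<in>E. w \<in> e} - {f}))"
    proof (rule card_UN_disjoint)
      show "\<forall>w\<in>f - {v}. \<forall>w'\<in>f - {v}. w \<noteq> w' \<longrightarrow> ({e\<in>E. w \<in> e} - {f}) \<inter> ({e\<in>E. w' \<in> e} - {f}) = {}"
        using uniq by blast
    qed (use ff fE in auto)
    ultimately have "(\<Sum>e\<in>{e \<in> {e\<in>E. v \<notin> e}. f \<inter> e \<noteq> {}}. 1 :: real) = (\<Sum>w\<in>f - {v}. real (card ({e\<in>E. w \<in> e} - {f})))"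
      by simp
    also have "\<dots> = (\<Sum>w\<in>f - {v}. real (degree E w) - 1)"
    proof (rule sum.cong[OF refl])
      fix w assume "w \<in> f - {v}"
      then have "f \<in> {e\<in>E. w \<in> e}" using f by auto
      then have "Suc (card ({e\<in>E. w \<in> e} - {f})) = card {e\<in>E. w \<in> e}"
        using fE card_Suc_Diff1[of "{e\<in>E. w \<in> e}" f] by simp
      then show "real (card ({e\<in>E. w \<in> e} - {f})) = real (degree E w) - 1" unfolding degree_def by linarith
    qed
    finally show "(\<Sum>e\<in>{e \<in> {e\<in>E. v \<notin> e}. f \<inter> e \<noteq> {}}. 1 :: real) = (\<Sum>w\<in>f - {v}. real (degree E w) - 1)" .
  qed
  finally show ?thesis .
qed

text \<open>The quadratic form of the adjacency matrix is bounded below by minus that of the degrees, since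
  their sum is a sum of squares over the edges.\<close>

lemma sum_dev_hit_ge:
  fixes d :: real
  defines "x \<equiv> \<lambda>v. real (degree E v) - d"
  shows "(\<Sum>v\<in>U. x v * (\<Sum>e\<in>{e\<in>E. v \<notin> e}. hit e v))
     \<ge> (real r - 1) * (d - 1) * (\<Sum>v\<in>U. real (degree E v) * x v) - (\<Sum>v\<in>U. real (degree E v) * (x v)\<^sup>2)"
proof -
  define S where "S f = (\<Sum>w\<in>f. x w)" for f
  have inner: "(\<Sum>w\<in>f - {v}. real (degree E w) - 1) = (real r - 1) * (d - 1) + S f - x v"
    if f: "f \<in> E" "v \<in> f" for f v
  proof -
    have c: "Suc (card (f - {v})) = r" using card_Suc_Diff1[OF fe[OF f(1)] f(2)] unif[OF f(1)] by simp
    have "(\<Sum>w\<in>f - {v}. real (degree E w) - 1) = (\<Sum>w\<in>f - {v}. (d - 1) + x w)" by (simp add: x_def)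
    also have "\<dots> = real (card (f - {v})) * (d - 1) + (\<Sum>w\<in>f - {v}. x w)" by (simp add: sum.distrib)
    also have "(\<Sum>w\<in>f - {v}. x w) = S f - x v" unfolding S_def using sum.remove[OF fe[OF f(1)] f(2), of x] by simp
    also have "real (card (f - {v})) = real r - 1" using c by linarith
    finally show ?thesis by simp
  qed
  have C: "(\<Sum>e\<in>{e\<in>E. v \<notin> e}. hit e v)
      = real (degree E v) * ((real r - 1) * (d - 1) - x v) + (\<Sum>f\<in>{f\<in>E. v \<in> f}. S f)" for v
  proof -
    have "(\<Sum>e\<in>{e\<in>E. v \<notin> e}. hit e v) = (\<Sum>f\<in>{f\<in>E. v \<in> f}. ((real r - 1) * (d - 1) - x v) + S f)"
      unfolding sum_hit_edges by (rule sum.cong[OF refl]) (use inner in auto)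
    also have "\<dots> = real (degree E v) * ((real r - 1) * (d - 1) - x v) + (\<Sum>f\<in>{f\<in>E. v \<in> f}. S f)"
      by (simp add: sum.distrib degree_def)
    finally show ?thesis .
  qed
  have "(\<Sum>v\<in>U. x v * (\<Sum>f\<in>{f\<in>E. v \<in> f}. S f)) = (\<Sum>v\<in>U. \<Sum>f\<in>{f\<in>E. v \<in> f}. x v * S f)"
    by (simp add: sum_distrib_left)
  also have "\<dots> = (\<Sum>f\<in>E. \<Sum>v\<in>{v\<in>U. v \<in> f}. x v * S f)"
    by (rule sum.swap_restrict[OF fU fE])
  also have "\<dots> = (\<Sum>f\<in>E. (S f)\<^sup>2)"
  proof (rule sum.cong[OF refl])
    fix f assume "f \<in> E"
    then have "{v\<in>U. v \<in> f} = f" using EU by auto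
    then show "(\<Sum>v\<in>{v\<in>U. v \<in> f}. x v * S f) = (S f)\<^sup>2"
      by (simp add: sum_distrib_right[symmetric] S_def power2_eq_square)
  qed
  finally have Q: "(\<Sum>v\<in>U. x v * (\<Sum>f\<in>{f\<in>E. v \<in> f}. S f)) = (\<Sum>f\<in>E. (S f)\<^sup>2)" .
  have "(\<Sum>v\<in>U. x v * (\<Sum>e\<in>{e\<in>E. v \<notin> e}. hit e v))
      = (\<Sum>v\<in>U. ((real r - 1) * (d - 1) * (real (degree E v) * x v) - real (degree E v) * (x v)\<^sup>2)
          + x v * (\<Sum>f\<in>{f\<in>E. v \<in> f}. S f))"
    unfolding C by (rule sum.cong[OF refl]) (simp add: algebra_simps power2_eq_square)
  also have "\<dots> = (real r - 1) * (d - 1) * (\<Sum>v\<in>U. real (degree E v) * x v)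
      - (\<Sum>v\<in>U. real (degree E v) * (x v)\<^sup>2) + (\<Sum>f\<in>E. (S f)\<^sup>2)"
    by (simp only: sum.distrib sum_subtractf sum_distrib_left[symmetric] Q)
  moreover have "(\<Sum>f\<in>E. (S f)\<^sup>2) \<ge> 0" by (simp add: sum_nonneg)
  ultimately show ?thesis by linarith
qed

text \<open>At a surviving vertex the deviation changes from \<open>x v\<close> to
  \<open>x v + (\<delta> - hit e v)\<close>. The cross terms are kept exactly, since their leading
  parts have to cancel later; the squares of the changes are estimated by means of
  \<open>hit e v \<le> r\<close>.\<close>

lemma sum_deviation_expand:
  fixes d \<delta> :: real
  defines "x \<equiv> \<lambda>v. real (degree E v) - d"
  assumes deg: "\<And>v. v \<in> U \<Longrightarrow> real (degree E v) \<le> k" and \<delta>: "\<delta> \<ge> 0"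
  shows "(\<Sum>e\<in>E. deviation (avoiding E e) (U - e) (d - \<delta>))
    \<le> real (card E) * deviation E U d + 2 * \<delta> * real (card E) * (\<Sum>v\<in>U. x v)
      - 2 * \<delta> * (\<Sum>v\<in>U. real (degree E v) * x v)
      - 2 * (\<Sum>v\<in>U. x v * (\<Sum>e\<in>{e\<in>E. v \<notin> e}. hit e v))
      + real (card E) * (real (card U) * \<delta>\<^sup>2 + real r^3 * k)"
proof -
  let ?A = "real (card E)"
  have nh: "card {e\<in>E. v \<notin> e} + degree E v = card E" for v
  proof -
    have "{e\<in>E. v \<notin> e} \<union> {e\<in>E. v \<in> e} = E" by auto
    moreover have "card ({e\<in>E. v \<notin> e} \<union> {e\<in>E. v \<in> e}) = card {e\<in>E. v \<notin> e} + card {e\<in>E. v \<in> e}"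
      by (rule card_Un_disjoint) (use fE in auto)
    ultimately show ?thesis by (simp add: degree_def)
  qed
  have "(\<Sum>e\<in>E. deviation (avoiding E e) (U - e) (d - \<delta>))
      \<le> (\<Sum>e\<in>E. (\<Sum>v\<in>U - e. (x v)\<^sup>2 + 2 * x v * (\<delta> - hit e v)) + (real (card U) * \<delta>\<^sup>2 + real r^3 * k))"
  proof (rule sum_mono)
    fix e assume e: "e \<in> E"
    have h0: "hit e v \<ge> 0" for v by (simp add: hit_def)
    have "deviation (avoiding E e) (U - e) (d - \<delta>) = (\<Sum>v\<in>U - e. (x v + (\<delta> - hit e v))\<^sup>2)"
      unfolding deviation_def x_def degree_avoiding by (simp add: algebra_simps)
    also have "\<dots> \<le> (\<Sum>v\<in>U - e. ((x v)\<^sup>2 + 2 * x v * (\<delta> - hit e v)) + (\<delta>\<^sup>2 + real r * hit e v))"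
    proof (rule sum_mono)
      fix v assume v: "v \<in> U - e"
      have "hit e v * hit e v \<le> real r * hit e v" using hit_le[OF e, of v] v h0[of v] by (intro mult_right_mono) auto
      moreover have "(\<delta> - hit e v)\<^sup>2 \<le> \<delta>\<^sup>2 + hit e v * hit e v"
        using mult_nonneg_nonneg[OF \<delta> h0[of v]] by (simp add: power2_eq_square algebra_simps)
      ultimately show "(x v + (\<delta> - hit e v))\<^sup>2 \<le> ((x v)\<^sup>2 + 2 * x v * (\<delta> - hit e v)) + (\<delta>\<^sup>2 + real r * hit e v)"
        by (simp add: power2_sum)
    qed
    also have "\<dots> = (\<Sum>v\<in>U - e. (x v)\<^sup>2 + 2 * x v * (\<delta> - hit e v)) + (real (card (U - e)) * \<delta>\<^sup>2 + real r * (\<Sum>v\<in>U - e. hit e v))"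
      by (simp add: sum.distrib sum_distrib_left)
    also have "\<dots> \<le> (\<Sum>v\<in>U - e. (x v)\<^sup>2 + 2 * x v * (\<delta> - hit e v)) + (real (card U) * \<delta>\<^sup>2 + real r^3 * k)"
    proof -
      have "real (card (U - e)) * \<delta>\<^sup>2 \<le> real (card U) * \<delta>\<^sup>2"
        by (intro mult_right_mono) (auto intro: card_mono fU)
      moreover have "real r * (\<Sum>v\<in>U - e. hit e v) \<le> real r * (real r * real r * k)"
        by (rule mult_left_mono[OF sum_hit_le[OF e deg]]) auto
      ultimately show ?thesis by (simp add: power3_eq_cube mult.assoc)
    qed
    finally show "deviation (avoiding E e) (U - e) (d - \<delta>)
       \<le> (\<Sum>v\<in>U - e. (x v)\<^sup>2 + 2 * x v * (\<delta> - hit e v)) + (real (card U) * \<delta>\<^sup>2 + real r^3 * k)" .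
  qed
  also have "\<dots> = (\<Sum>e\<in>E. \<Sum>v\<in>{v\<in>U. v \<notin> e}. (x v)\<^sup>2 + 2 * x v * (\<delta> - hit e v)) + ?A * (real (card U) * \<delta>\<^sup>2 + real r^3 * k)"
    by (simp add: sum.distrib set_diff_eq)
  also have "(\<Sum>e\<in>E. \<Sum>v\<in>{v\<in>U. v \<notin> e}. (x v)\<^sup>2 + 2 * x v * (\<delta> - hit e v))
      = (\<Sum>v\<in>U. \<Sum>e\<in>{e\<in>E. v \<notin> e}. (x v)\<^sup>2 + 2 * x v * (\<delta> - hit e v))"
    by (rule sum.swap_restrict[OF fE fU])
  also have "\<dots> \<le> (\<Sum>v\<in>U. ?A * (x v)\<^sup>2 + (2 * \<delta> * ?A * x v - 2 * \<delta> * (real (degree E v) * x v)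
      - 2 * (x v * (\<Sum>e\<in>{e\<in>E. v \<notin> e}. hit e v))))"
  proof (rule sum_mono)
    fix v
    have c: "real (card {e\<in>E. v \<notin> e}) = ?A - real (degree E v)" using nh[of v] by linarith
    have "(\<Sum>e\<in>{e\<in>E. v \<notin> e}. (x v)\<^sup>2 + 2 * x v * (\<delta> - hit e v))
        = (\<Sum>e\<in>{e\<in>E. v \<notin> e}. ((x v)\<^sup>2 + 2 * x v * \<delta>) - 2 * x v * hit e v)" by (simp add: algebra_simps)
    also have "\<dots> = (?A - real (degree E v)) * ((x v)\<^sup>2 + 2 * x v * \<delta>) - 2 * x v * (\<Sum>e\<in>{e\<in>E. v \<notin> e}. hit e v)"
      by (simp only: sum_subtractf sum_constant c sum_distrib_left[symmetric])
    also have "\<dots> = ?A * (x v)\<^sup>2 - real (degree E v) * (x v)\<^sup>2 + (2 * \<delta> * ?A * x v - 2 * \<delta> * (real (degree E v) * x v)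
      - 2 * (x v * (\<Sum>e\<in>{e\<in>E. v \<notin> e}. hit e v)))" by (simp add: algebra_simps)
    \<comment> \<open>The squares that disappear together with the vertices of the chosen edges,
      \<open>degree E v * (x v)\<^sup>2\<close> for each \<open>v\<close>, are a gain and are
      dropped.\<close>
    finally show "(\<Sum>e\<in>{e\<in>E. v \<notin> e}. (x v)\<^sup>2 + 2 * x v * (\<delta> - hit e v))
      \<le> ?A * (x v)\<^sup>2 + (2 * \<delta> * ?A * x v - 2 * \<delta> * (real (degree E v) * x v)
      - 2 * (x v * (\<Sum>e\<in>{e\<in>E. v \<notin> e}. hit e v)))" by simp
  qed
  also have "\<dots> = ?A * deviation E U d + (2 * \<delta> * ?A * (\<Sum>v\<in>U. x v)
      - 2 * \<delta> * (\<Sum>v\<in>U. real (degree E v) * x v)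
      - 2 * (\<Sum>v\<in>U. x v * (\<Sum>e\<in>{e\<in>E. v \<notin> e}. hit e v)))"
    by (simp only: sum.distrib sum_subtractf sum_distrib_left[symmetric] deviation_def x_def)
  finally show ?thesis by simp
qed

text \<open>Two terms of leading order cancel: \<open>2 * \<delta> * A * X\<close>, from lowering
  the target degree, and \<open>- 2 * R * d * P\<close>, from the edges that disappear. Since
  \<open>r * A = u * d + X\<close> and \<open>\<delta> * u\<close> is nearly \<open>s * d\<close>,
  the former is \<open>2 * R * d * Y\<close> up to a small error, and \<open>Y \<le> P\<close> by
  Cauchy-Schwarz. What remains is of order \<open>d\<close>, or of order \<open>1 / u\<close>
  relative to the deviation.\<close>

lemma sum_deviation_step:
  fixes d \<delta> u s A :: real
  defines "u \<equiv> real (card U)" and "s \<equiv> real r * (real r - 1)" and "A \<equiv> real (card E)"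
  assumes deg: "\<And>v. v \<in> U \<Longrightarrow> real (degree E v) \<le> (real r + 1) * d"
    and d: "0 < d" "d \<le> u" and \<delta>: "\<delta> \<ge> 0" "\<delta> * u \<le> s * d" "s * d \<le> \<delta> * (u + s)"
    and A: "u * d \<le> 2 * real r * A"
  shows "(\<Sum>e\<in>E. deviation (avoiding E e) (U - e) (d - \<delta>))
    \<le> A * ((1 + 4 * real r * (real r + 1) / u) * deviation E U d + step_noise (real r) * d)"
proof -
  define x where "x = (\<lambda>v. real (degree E v) - d)"
  define K where "K = real r + 1"
  define R where "R = real r - 1"
  define W where "W = deviation E U d"
  define X where "X = (\<Sum>v\<in>U. x v)"
  define P where "P = (\<Sum>v\<in>U. real (degree E v) * x v)"
  define Q where "Q = (\<Sum>v\<in>U. real (degree E v) * (x v)\<^sup>2)"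
  have u: "u > 0" using d by simp
  have r0: "real r > 0" and R: "R > 0" and K: "K > 0" and s: "s = real r * R" "s > 0"
    using r by (auto simp: R_def K_def s_def)
  have W: "W = (\<Sum>v\<in>U. (x v)\<^sup>2)" "W \<ge> 0" by (auto simp: W_def deviation_def x_def intro: sum_nonneg)
  have xb: "x v \<le> K * d" "x v \<ge> - (K * d)" if "v \<in> U" for v
    using deg[OF that] d r by (auto simp: x_def K_def algebra_simps) (smt (verit) mult_nonneg_nonneg of_nat_0_le_iff)
  have "X \<ge> (\<Sum>v\<in>U. - (K * d))" unfolding X_def by (rule sum_mono) (use xb in auto)
  then have Xlow: "- X \<le> u * (K * d)" by (simp add: u_def)
  have rA: "real r * A = u * d + X"
    using sum_degree_uniform[OF fU fE EU unif] by (simp add: A_def u_def X_def x_def sum_subtractf)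
  have P: "P = d * X + W"
    unfolding P_def X_def W(1) sum_distrib_left sum.distrib[symmetric]
    by (rule sum.cong[OF refl]) (simp add: x_def power2_eq_square algebra_simps)
  have Pup: "P \<le> u * (K * d)\<^sup>2"
  proof -
    have "P \<le> (\<Sum>v\<in>U. (K * d)\<^sup>2)" unfolding P_def
    proof (rule sum_mono)
      fix v assume v: "v \<in> U"
      have "real (degree E v) * x v \<le> real (degree E v) * (K * d)" using xb[OF v] by (intro mult_left_mono) auto
      also have "\<dots> \<le> (K * d) * (K * d)" using deg[OF v] K d by (intro mult_right_mono) (auto simp: K_def)
      finally show "real (degree E v) * x v \<le> (K * d)\<^sup>2" by (simp add: power2_eq_square)
    qed
    then show ?thesis by (simp add: u_def)
  qed
  have Q: "Q \<le> K * d * W"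
    unfolding Q_def W(1) sum_distrib_left by (intro sum_mono mult_right_mono) (use deg in \<open>auto simp: K_def\<close>)
  have CS: "X\<^sup>2 \<le> u * W"
    unfolding X_def W(1) u_def by (rule square_sum_le[OF fU])
  define Y where "Y = d * X + X\<^sup>2 / u"
  have YP: "Y \<le> P" using CS u by (simp add: Y_def P pos_divide_le_eq mult.commute)
  \<comment> \<open>The defect in the approximation of \<open>s * d\<close> by
    \<open>\<delta> * u\<close>; the two-sided hypothesis on \<open>\<delta>\<close> confines it to
    the interval from \<open>0\<close> to \<open>\<delta> * s\<close>.\<close>
  define \<rho> where "\<rho> = s * d - \<delta> * u"
  have \<rho>: "0 \<le> \<rho>" "\<rho> \<le> \<delta> * s" using \<delta> by (auto simp: \<rho>_def algebra_simps)
  have \<delta>s: "\<delta> \<le> s"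
  proof -
    have "\<delta> * u \<le> s * u" using \<delta>(2) d(2) s(2) mult_left_mono[of d u s] by linarith
    then show ?thesis using u by simp
  qed
  have main: "2 * \<delta> * A * X = 2 * R * d * Y - 2 * (\<rho> / real r) * Y"
  proof -
    have "real r * (2 * \<delta> * A * X) = 2 * \<delta> * (real r * A) * X" by simp
    also have "\<dots> = 2 * (\<delta> * u) * Y" unfolding rA Y_def using u by (simp add: field_simps power2_eq_square)
    also have "\<dots> = 2 * (real r * R * d - \<rho>) * Y" by (simp add: \<rho>_def s(1))
    also have "\<dots> = real r * (2 * R * d * Y - 2 * (\<rho> / real r) * Y)" using r0 by (simp add: field_simps)
    finally show ?thesis using r0 by simp
  qed
  have b1: "2 * R * d * Y \<le> 2 * R * d * P" using YP R d by (intro mult_left_mono) auto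
  have Ylow: "- Y \<le> u * (K * d) * d"
  proof -
    have "- Y \<le> d * (- X)" using u by (simp add: Y_def)
    also have "\<dots> \<le> d * (u * (K * d))" using Xlow d by (intro mult_left_mono) auto
    finally show ?thesis by (simp add: mult_ac)
  qed
  have dd: "d * d * d \<le> u * d * d" using d by (intro mult_right_mono) auto
  have b2: "- (2 * (\<rho> / real r) * Y) \<le> 2 * s\<^sup>2 * K * (u * d * d)"
  proof -
    have rr: "\<rho> / real r \<le> \<rho>" using \<rho>(1) r by (simp add: divide_le_eq mult_left_mono[of 1 "real r" \<rho>, simplified])
    have "2 * (\<rho> / real r) * (- Y) \<le> 2 * (\<rho> / real r) * (u * (K * d) * d)"
      using Ylow \<rho>(1) r0 by (intro mult_left_mono) auto
    also have "\<dots> \<le> 2 * \<rho> * (u * (K * d) * d)" using rr u K d by (intro mult_right_mono) auto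
    also have "\<dots> \<le> 2 * (\<delta> * s) * (u * (K * d) * d)" using \<rho>(2) u K d by (intro mult_right_mono) auto
    also have "\<dots> = 2 * (\<delta> * u) * (s * K * d * d)" by (simp add: mult_ac)
    also have "\<dots> \<le> 2 * (s * d) * (s * K * d * d)" using \<delta>(2) s K d by (intro mult_right_mono) auto
    also have "\<dots> = 2 * s\<^sup>2 * K * (d * d * d)" by (simp add: power2_eq_square mult_ac)
    also have "\<dots> \<le> 2 * s\<^sup>2 * K * (u * d * d)" using dd K by (intro mult_left_mono) auto
    finally show ?thesis by simp
  qed
  have b3: "- (2 * \<delta> * P) \<le> 2 * s * K * (u * d * d)"
  proof -
    have "d * (- X) \<le> d * (u * (K * d))" using Xlow d by (intro mult_left_mono) auto
    then have "- P \<le> d * (u * (K * d))" using W(2) by (simp add: P)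
    then have "2 * \<delta> * (- P) \<le> 2 * \<delta> * (d * (u * (K * d)))" using \<delta>(1) by (intro mult_left_mono) auto
    also have "\<dots> = 2 * (\<delta> * u) * (K * d * d)" by (simp add: mult_ac)
    also have "\<dots> \<le> 2 * (s * d) * (K * d * d)" using \<delta>(2) K d by (intro mult_right_mono) auto
    also have "\<dots> = 2 * s * K * (d * d * d)" by (simp add: mult_ac)
    also have "\<dots> \<le> 2 * s * K * (u * d * d)" using dd K s by (intro mult_left_mono) auto
    finally show ?thesis by simp
  qed
  have b4: "2 * R * P \<le> 2 * R * K\<^sup>2 * (u * d * d)"
    using mult_left_mono[OF Pup, of "2 * R"] R by (simp add: power2_eq_square mult_ac)
  \<comment> \<open>The only error proportional to the deviation. The bound on the degrees gives it
    relative size \<open>4 * r * K / u\<close>, so over many steps the deviation is amplified only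
    by a power of the ratio between the initial and the final \<open>u\<close>.\<close>
  have b5: "2 * Q \<le> A * (4 * real r * K / u) * W"
  proof -
    have "d \<le> 2 * real r * A / u" using A u by (simp add: pos_le_divide_eq mult.commute)
    then have "2 * K * W * d \<le> 2 * K * W * (2 * real r * A / u)" using K W(2) by (intro mult_left_mono) auto
    then show ?thesis using Q by (simp add: mult_ac)
  qed
  have b6: "u * \<delta>\<^sup>2 + real r^3 * (K * d) \<le> (s\<^sup>2 + real r^3 * K) * d"
  proof -
    have "u * \<delta>\<^sup>2 = (\<delta> * u) * \<delta>" by (simp add: power2_eq_square)
    also have "\<dots> \<le> (s * d) * s" by (rule mult_mono[OF \<delta>(2) \<delta>s]) (use \<delta>(1) s(2) d(1) in auto)
    finally show ?thesis by (simp add: power2_eq_square algebra_simps)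
  qed
  have bA: "C * (u * d * d) \<le> A * (2 * real r * C * d)" if "C \<ge> 0" for C
  proof -
    have "C * d * (u * d) \<le> C * d * (2 * real r * A)" using A that d by (intro mult_left_mono) auto
    then show ?thesis by (simp add: mult_ac)
  qed
  have "(\<Sum>e\<in>E. deviation (avoiding E e) (U - e) (d - \<delta>))
    \<le> A * W + 2 * \<delta> * A * X - 2 * \<delta> * P - 2 * (\<Sum>v\<in>U. x v * (\<Sum>e\<in>{e\<in>E. v \<notin> e}. hit e v))
      + A * (u * \<delta>\<^sup>2 + real r^3 * (K * d))"
    using sum_deviation_expand[OF deg \<delta>(1), of d] unfolding x_def P_def X_def A_def W_def K_def u_def by simp
  also have "\<dots> \<le> A * W + 2 * \<delta> * A * X - 2 * \<delta> * P - 2 * (R * (d - 1) * P - Q)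
      + A * ((s\<^sup>2 + real r^3 * K) * d)"
  proof -
    have "(\<Sum>v\<in>U. x v * (\<Sum>e\<in>{e\<in>E. v \<notin> e}. hit e v)) \<ge> R * (d - 1) * P - Q"
      using sum_dev_hit_ge[of d] unfolding x_def P_def Q_def R_def .
    moreover have "A * (u * \<delta>\<^sup>2 + real r^3 * (K * d)) \<le> A * ((s\<^sup>2 + real r^3 * K) * d)"
      using b6 by (intro mult_left_mono) (auto simp: A_def)
    moreover have "c - 2 * Z + a \<le> c - 2 * z + b" if "z \<le> Z" "a \<le> b" for a b c z Z :: real
      using that by simp
    ultimately show ?thesis by blast
  qed
  also have "\<dots> = A * W + (2 * R * d * Y - 2 * R * d * P) + (- (2 * (\<rho> / real r) * Y)) + (- (2 * \<delta> * P)) + 2 * R * P + 2 * Q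
      + A * ((s\<^sup>2 + real r^3 * K) * d)"
    unfolding main by (simp add: algebra_simps)
  also have "\<dots> \<le> A * W + 0 + 2 * s\<^sup>2 * K * (u * d * d) + 2 * s * K * (u * d * d) + 2 * R * K\<^sup>2 * (u * d * d)
      + A * (4 * real r * K / u) * W + A * ((s\<^sup>2 + real r^3 * K) * d)"
    using b1 b2 b3 b4 b5 by linarith
  also have "\<dots> = A * W + (2 * s\<^sup>2 * K + 2 * s * K + 2 * R * K\<^sup>2) * (u * d * d)
      + A * (4 * real r * K / u) * W + A * ((s\<^sup>2 + real r^3 * K) * d)"
    by (simp add: algebra_simps)
  also have "\<dots> \<le> A * W + A * (2 * real r * (2 * s\<^sup>2 * K + 2 * s * K + 2 * R * K\<^sup>2) * d)
      + A * (4 * real r * K / u) * W + A * ((s\<^sup>2 + real r^3 * K) * d)"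
    using bA[of "2 * s\<^sup>2 * K + 2 * s * K + 2 * R * K\<^sup>2"] s K R by simp
  also have "\<dots> = A * ((1 + 4 * real r * K / u) * W + step_noise (real r) * d)"
    unfolding step_noise_def s_def R_def[symmetric] K_def[symmetric] by (simp add: algebra_simps)
  finally show ?thesis by (simp add: W_def K_def)
qed

end

section \<open>Induction along the greedy trajectory\<close>

lemma sum_exp_ge:
  fixes y :: "'e \<Rightarrow> real"
  assumes "finite S" "S \<noteq> {}"
  shows "real (card S) * exp ((\<Sum>e\<in>S. y e) / card S) \<le> (\<Sum>e\<in>S. exp (y e))"
proof -
  define m where "m = (\<Sum>e\<in>S. y e) / card S"
  have c: "real (card S) > 0" using assms by (simp add: card_gt_0_iff)
  have "(\<Sum>e\<in>S. exp m * (1 + (y e - m))) = exp m * (\<Sum>e\<in>S. (1 - m) + y e)"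
    by (simp add: sum_distrib_left algebra_simps)
  also have "(\<Sum>e\<in>S. (1 - m) + y e) = real (card S) * (1 - m) + (\<Sum>e\<in>S. y e)" by (simp only: sum.distrib sum_constant)
  also have "(\<Sum>e\<in>S. y e) = real (card S) * m" using c by (simp add: m_def)
  finally have "(\<Sum>e\<in>S. exp m * (1 + (y e - m))) = real (card S) * exp m" by (simp add: algebra_simps)
  moreover have "(\<Sum>e\<in>S. exp m * (1 + (y e - m))) \<le> (\<Sum>e\<in>S. exp (y e))"
  proof (rule sum_mono)
    fix e
    have "exp m * (1 + (y e - m)) \<le> exp m * exp (y e - m)"
      by (rule mult_left_mono[OF exp_ge_add_one_self]) simp
    then show "exp m * (1 + (y e - m)) \<le> exp (y e)" by (simp add: exp_add[symmetric])
  qed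
  ultimately show ?thesis by (simp add: m_def)
qed

text \<open>Bernoulli's inequality twice: for \<open>(1 - z) ^ R\<close>, and for
  \<open>(1 + z) ^ R\<close> combined with \<open>(1 - z\<^sup>2) ^ R \<le> 1\<close>, where
  \<open>z = y / u\<close>. With \<open>y = r\<close> it supplies the two-sided hypothesis on
  \<open>\<delta>\<close> for the ideal degree \<open>c * u ^ R\<close>.\<close>

lemma power_shift_bounds:
  fixes c u y :: real and R :: nat
  assumes "c \<ge> 0" "y \<ge> 0" "y \<le> u" "u > 0"
  defines "\<delta> \<equiv> c * u ^ R - c * (u - y) ^ R"
  shows "0 \<le> \<delta>" "\<delta> * u \<le> y * real R * (c * u ^ R)" "y * real R * (c * u ^ R) \<le> \<delta> * (u + y * real R)"
proof -
  define z where "z = y / u"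
  have z: "0 \<le> z" "z \<le> 1" using assms by (auto simp: z_def)
  have yz: "y = u * z" using assms by (simp add: z_def)
  define d where "d = c * u ^ R"
  have d: "d \<ge> 0" using assms by (simp add: d_def)
  have uy: "u - y = u * (1 - z)" using yz by (simp add: algebra_simps)
  have \<delta>: "\<delta> = d * (1 - (1 - z) ^ R)"
    unfolding \<delta>_def d_def uy power_mult_distrib by (simp add: algebra_simps)
  have le1: "(1 - z) ^ R \<le> 1" using z by (intro power_le_one) auto
  then show "0 \<le> \<delta>" using \<delta> d by simp
  have "1 + real R * (- z) \<le> (1 + - z) ^ R" by (rule Bernoulli_inequality) (use z in simp)
  then have "1 - (1 - z) ^ R \<le> real R * z" by simp
  then have "d * (1 - (1 - z) ^ R) \<le> d * (real R * z)" using d by (rule mult_left_mono)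
  then have "\<delta> * u \<le> d * (real R * z) * u" unfolding \<delta> using assms by (intro mult_right_mono) auto
  then show "\<delta> * u \<le> y * real R * (c * u ^ R)" by (simp add: yz d_def mult_ac)
  have "1 + real R * z \<le> (1 + z) ^ R" by (rule Bernoulli_inequality) (use z in simp)
  then have "(1 - z) ^ R * (1 + real R * z) \<le> (1 - z) ^ R * (1 + z) ^ R" using z by (intro mult_left_mono) auto
  also have "\<dots> = (1 - z\<^sup>2) ^ R" by (simp add: power_mult_distrib[symmetric] power2_eq_square algebra_simps)
  also have "\<dots> \<le> 1" using z by (intro power_le_one) (auto simp: power_le_one)
  finally have "real R * z \<le> (1 - (1 - z) ^ R) * (1 + real R * z)" by (simp add: algebra_simps)
  then have "d * u * (real R * z) \<le> d * u * ((1 - (1 - z) ^ R) * (1 + real R * z))"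
    using d assms by (intro mult_left_mono) auto
  then show "y * real R * (c * u ^ R) \<le> \<delta> * (u + y * real R)"
    unfolding \<delta> yz by (simp add: d_def algebra_simps)
qed

text \<open>The logarithm of the product of the \<open>k\<close> values \<open>a u\<close>,
  \<open>a (u - r)\<close> and so on, divided by \<open>k!\<close>: the ideal count of
  \<open>k\<close>-edge matchings if \<open>a u\<close> edges are available while \<open>u\<close>
  vertices are uncovered.\<close>

primrec growth :: "nat \<Rightarrow> (nat \<Rightarrow> real) \<Rightarrow> nat \<Rightarrow> nat \<Rightarrow> real" where
  "growth r a 0 u = 0"
| "growth r a (Suc k) u = ln (a u / real (Suc k)) + growth r a k (u - r)"

text \<open>Rests on \<open>2 * \<bar>y\<bar> \<le> \<eta> + y\<^sup>2 / \<eta>\<close>. A loss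
  linear in \<open>w\<close> is what the induction needs, because only averages of the deviation are
  controlled.\<close>

lemma ln_ge_of_relative_error:
  fixes A a X y \<eta> w :: real
  assumes a: "a > 0" and A: "A \<ge> a / 2" and eq: "A = a * (1 + y)" and y: "y\<^sup>2 \<le> w" and \<eta>: "\<eta> > 0"
  shows "ln A \<ge> ln a - \<eta> - w / \<eta>"
proof -
  have y1: "1 + y \<ge> 1 / 2" using A a unfolding eq by simp
  have "ln A = ln a + ln (1 + y)" unfolding eq using a y1 by (intro ln_mult_pos) auto
  moreover have "ln (1 + y) \<ge> - 2 * \<bar>y\<bar>"
  proof (cases "y \<ge> 0")
    case True
    then have "0 \<le> ln (1 + y)" by simp
    then show ?thesis using True by linarith
  next
    case False
    have "- (- y) - 2 * (- y)\<^sup>2 \<le> ln (1 - (- y))" by (rule ln_one_minus_pos_lower_bound) (use False y1 in auto)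
    moreover have "(- y)\<^sup>2 \<le> - y / 2" using False y1 mult_right_mono[of "-y" "1/2" "-y"] by (simp add: power2_eq_square)
    ultimately show ?thesis using False by simp
  qed
  moreover have "2 * \<bar>y\<bar> \<le> \<eta> + w / \<eta>"
  proof -
    have "0 \<le> (\<eta> - \<bar>y\<bar>)\<^sup>2" by simp
    then have "2 * \<bar>y\<bar> * \<eta> \<le> \<eta> * \<eta> + y\<^sup>2" by (simp add: power2_eq_square algebra_simps)
    then have "2 * \<bar>y\<bar> * \<eta> \<le> (\<eta> + w / \<eta>) * \<eta>" using y \<eta> by (simp add: algebra_simps)
    then show ?thesis using \<eta> by (metis mult_le_cancel_right_pos)
  qed
  ultimately show ?thesis by linarith
qed

lemma small_matchings_Suc:
  assumes fin: "finite E" and ne: "{} \<notin> E"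
  shows "(\<Sum>e\<in>E. real (card {T \<in> matchings (avoiding E e). card T \<le> k}))
    \<le> real (Suc k) * real (card {T \<in> matchings E. card T \<le> Suc k})"
proof -
  have "(\<Sum>e\<in>E. real (card {T \<in> matchings (avoiding E e). card T \<le> k}))
      = (\<Sum>e\<in>E. \<Sum>T\<in>{T \<in> matchings (avoiding E e). Suc (card T) \<le> Suc k}. 1)" by simp
  also have "\<dots> = (\<Sum>T\<in>{T \<in> matchings E. card T \<le> Suc k}. \<Sum>e\<in>T. 1)"
    by (rule sum_matchings_remove[OF fin ne, symmetric])
  also have "\<dots> \<le> (\<Sum>T\<in>{T \<in> matchings E. card T \<le> Suc k}. real (Suc k))" by (rule sum_mono) simp
  finally show ?thesis by (simp add: mult.commute)
qed

text \<open>Counting matchings of size at most \<open>k\<close>, not exactly \<open>k\<close>, keeps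
  the logarithm of the count nonnegative even where the greedy process gets stuck.\<close>

lemma small_matchings_pos:
  assumes "finite E"
  shows "card {T \<in> matchings E. card T \<le> k} \<ge> 1"
proof -
  have "{} \<in> {T \<in> matchings E. card T \<le> k}" by (simp add: matchings_def)
  then show ?thesis using finite_matchings[OF assms] by (metis (no_types, lifting) One_nat_def Suc_leI card_gt_0_iff empty_iff finite_subset mem_Collect_eq subsetI)
qed

text \<open>A potential argument in which \<open>\<theta> u\<close> is the price of a unit of
  deviation while \<open>u\<close> vertices are uncovered. Hypothesis \<open>\<theta>\<close> lets
  the price drop in each step by enough to cover the amplification of the deviation and its effect
  on the logarithm of the edge count. By \<open>noise\<close>, the deviation newly created costs at
  most \<open>\<nu>\<close> per step. By \<open>bad\<close>, the claim is trivial once the deviation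
  is so large that half of the edges may be missing.\<close>

lemma ln_small_matchings_ge:
  fixes c \<eta> \<nu> \<Theta> :: real and r p lo n :: nat
  defines "d \<equiv> \<lambda>u. c * real u ^ (r - 1)" and "\<theta> \<equiv> \<lambda>u. \<Theta> * real u ^ p"
  assumes r: "r \<ge> 2" and c: "c > 0" and \<eta>: "\<eta> > 0" and \<Theta>: "\<Theta> \<ge> 0" and \<nu>: "\<nu> \<ge> 0"
    and d: "\<And>u. lo \<le> u \<Longrightarrow> u \<le> n \<Longrightarrow> real r / 2 \<le> d u \<and> d u \<le> real u"
    and \<theta>: "\<And>u. lo + r \<le> u \<Longrightarrow> u \<le> n \<Longrightarrow>
        \<theta> (u - r) * (1 + 4 * real r * (real r + 1) / real u) + 1 / (\<eta> * real u * (d u)\<^sup>2) \<le> \<theta> u"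
    and noise: "\<And>u. lo + r \<le> u \<Longrightarrow> u \<le> n \<Longrightarrow> \<theta> (u - r) * (step_noise (real r) * d u) \<le> \<nu>"
    and bad: "\<And>u k. lo + r * k \<le> u \<Longrightarrow> u \<le> n \<Longrightarrow> k \<ge> 1 \<Longrightarrow>
        growth r (\<lambda>u. real u * d u / real r) k u \<le> \<theta> u * (real u * (d u)\<^sup>2 / 4)"
    and U: "finite U" "card U \<le> n" "lo + r * k \<le> card U" and E: "E \<subseteq> Pow U"
    and unif: "\<And>f. f \<in> E \<Longrightarrow> card f = r" and lin: "linear_hg E"
  shows "ln (real (card {T \<in> matchings E. card T \<le> k}))
      \<ge> growth r (\<lambda>u. real u * d u / real r) k (card U) - real k * (\<eta> + \<nu>) - \<theta> (card U) * deviation E U (d (card U))"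
  using U E unif lin
proof (induction k arbitrary: U E)
  case 0
  have fE: "finite E" by (rule finite_subset[OF 0(4)]) (use 0 in simp)
  have "\<theta> (card U) * deviation E U (d (card U)) \<ge> 0" unfolding \<theta>_def
    by (intro mult_nonneg_nonneg \<Theta> deviation_nonneg) auto
  moreover have "real (card {T \<in> matchings E. card T \<le> 0}) \<ge> 1" using small_matchings_pos[OF fE, of 0] by linarith
  then have "ln (real (card {T \<in> matchings E. card T \<le> 0})) \<ge> 0" by (rule ln_ge_zero)
  ultimately show ?case by simp
next
  case (Suc k)
  let ?G = "growth r (\<lambda>u. real u * d u / real r)"
  let ?M = "\<lambda>k E. real (card {T \<in> matchings E. card T \<le> k})"
  define u where "u = card U"
  have u: "lo + r \<le> u" "u \<le> n" using Suc.prems by (auto simp: u_def)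
  have du: "real r / 2 \<le> d u" "d u \<le> real u" using d[of u] u by auto
  have dpos: "d u > 0" using du r by linarith
  have upos: "real u > 0" using dpos du by linarith
  have fE: "finite E" by (rule finite_subset[OF Suc.prems(4)]) (use Suc.prems in simp)
  have ne: "{} \<notin> E" using Suc.prems(5) r by force
  obtain F where F: "F \<subseteq> E" "\<And>v. v \<in> U \<Longrightarrow> real (degree F v) \<le> (real r + 1) * d u"
      "deviation F U (d u) \<le> deviation E U (d u)"
    using bounded_degree_subgraph[OF Suc.prems(1,4,5) du(1)] by metis
  have FU: "F \<subseteq> Pow U" and Funif: "\<And>f. f \<in> F \<Longrightarrow> card f = r" and Flin: "linear_hg F"
    using F(1) Suc.prems linear_hg_mono by auto
  have fF: "finite F" using finite_subset[OF F(1) fE] .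
  define W where "W = deviation F U (d u)"
  define A where "A = real (card F)"
  define a where "a = real u * d u / real r"
  define X where "X = (\<Sum>v\<in>U. real (degree F v) - d u)"
  have apos: "a > 0" using upos dpos r by (simp add: a_def)
  have XW: "X\<^sup>2 \<le> real u * W" unfolding X_def W_def u_def deviation_def by (rule square_sum_le[OF Suc.prems(1)])
  have rA: "real r * A = real u * d u + X"
    using sum_degree_uniform[OF Suc.prems(1) fF FU Funif] by (simp add: A_def X_def sum_subtractf u_def)
  have W0: "W \<ge> 0" unfolding W_def by (rule deviation_nonneg)
  have \<theta>0: "\<theta> w \<ge> 0" for w using \<Theta> by (simp add: \<theta>_def)
  have "matchings F \<subseteq> matchings E" using F(1) by (rule matchings_mono)
  then have "card {T \<in> matchings F. card T \<le> Suc k} \<le> card {T \<in> matchings E. card T \<le> Suc k}"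
    by (intro card_mono) (use finite_matchings[OF fE] in auto)
  then have ME: "?M (Suc k) F \<le> ?M (Suc k) E" by simp
  have MF1: "?M (Suc k) F \<ge> 1" using small_matchings_pos[OF fF, of "Suc k"] by linarith
  have "?G (Suc k) u - real (Suc k) * (\<eta> + \<nu>) - \<theta> u * W \<le> ln (?M (Suc k) F)"
  \<comment> \<open>With less than half of the ideal edge count, Cauchy-Schwarz forces
    \<open>W\<close> to be at least \<open>u * (d u)\<^sup>2 / 4\<close>, and \<open>bad\<close>
    makes the claimed bound at most zero.\<close>
  proof (cases "A < a / 2")
    case True
    have "real r * A < real r * (a / 2)" using True r by simp
    then have "- X > real u * d u / 2" using rA r by (simp add: a_def)
    then have "(real u * d u / 2)\<^sup>2 \<le> (- X)\<^sup>2" using upos dpos by (intro power_mono) auto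
    then have "(real u * d u)\<^sup>2 / 4 \<le> real u * W" using XW by (simp add: power_divide)
    then have "real u * (real u * (d u)\<^sup>2 / 4) \<le> real u * W" by (simp add: power2_eq_square mult_ac)
    then have "real u * (d u)\<^sup>2 / 4 \<le> W" using upos by simp
    then have "\<theta> u * (real u * (d u)\<^sup>2 / 4) \<le> \<theta> u * W" using \<theta>0 by (intro mult_left_mono) auto
    moreover have "?G (Suc k) u \<le> \<theta> u * (real u * (d u)\<^sup>2 / 4)" using bad[of "Suc k" u] u Suc.prems(3) by (simp add: u_def del: growth.simps)
    moreover have "real (Suc k) * (\<eta> + \<nu>) \<ge> 0" using \<eta> \<nu> by simp
    moreover have "ln (?M (Suc k) F) \<ge> 0" using MF1 by simp
    ultimately show ?thesis by linarith
  next
    case False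
    have Aa: "A \<ge> a / 2" using False by simp
    have A0: "A > 0" using Aa apos by linarith
    have Fne: "F \<noteq> {}" using A0 by (auto simp: A_def)
    define \<delta> where "\<delta> = d u - d (u - r)"
    have ur: "real (u - r) = real u - real r" "real r \<le> real u" using u by (auto simp: of_nat_diff)
    have r1: "real (r - 1) = real r - 1" using r by (simp add: of_nat_diff)
    note ps = power_shift_bounds[of c "real r" "real u" "r - 1"]
    have \<delta>eq: "\<delta> = c * real u ^ (r - 1) - c * (real u - real r) ^ (r - 1)" by (simp add: \<delta>_def d_def ur)
    have \<delta>: "\<delta> \<ge> 0" "\<delta> * real u \<le> real r * (real r - 1) * d u" "real r * (real r - 1) * d u \<le> \<delta> * (real u + real r * (real r - 1))"
      using ps(1-3)[OF _ _ ur(2) upos] c unfolding \<delta>eq d_def r1 by auto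
    have Ab: "real u * d u \<le> 2 * real r * A"
      using mult_left_mono[OF Aa, of "2 * real r"] r by (simp add: a_def)
    have step: "(\<Sum>e\<in>F. deviation (avoiding F e) (U - e) (d (u - r)))
        \<le> A * ((1 + 4 * real r * (real r + 1) / real u) * W + step_noise (real r) * d u)"
    proof -
      have "d (u - r) = d u - \<delta>" by (simp add: \<delta>_def)
      then show ?thesis
        using sum_deviation_step[OF Suc.prems(1) FU Funif r Flin F(2), of \<delta>] dpos du(2) \<delta> Ab
        unfolding u_def A_def W_def by simp
    qed
    have e_step: "?G k (u - r) - real k * (\<eta> + \<nu>) - \<theta> (u - r) * deviation (avoiding F e) (U - e) (d (u - r))
        \<le> ln (?M k (avoiding F e))" if e: "e \<in> F" for e
    proof -
      have eU: "e \<subseteq> U" using e FU by auto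
      have ce: "card (U - e) = u - r"
        using card_Diff_subset[OF finite_subset[OF eU Suc.prems(1)] eU] Funif[OF e] by (simp add: u_def)
      have sub: "avoiding F e \<subseteq> Pow (U - e)" using FU by (auto simp: avoiding_def)
      show ?thesis
      proof (rule Suc.IH[of "U - e" "avoiding F e", unfolded ce, OF _ _ _ sub])
        show "finite (U - e)" using Suc.prems(1) by simp
        show "u - r \<le> n" using u by simp
        show "lo + r * k \<le> u - r" using Suc.prems(3) by (simp add: u_def)
        show "card f = r" if "f \<in> avoiding F e" for f using that Funif avoiding_subset[of F e] by auto
        show "linear_hg (avoiding F e)" by (rule linear_hg_mono[OF Flin avoiding_subset])
      qed
    qed
    define B where "B = ?G k (u - r) - real k * (\<eta> + \<nu>)"
    define y where "y e = B - \<theta> (u - r) * deviation (avoiding F e) (U - e) (d (u - r))" for e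
    \<comment> \<open>Jensen over the first edge: the mean of the logarithmic bounds is enough, and
      in it only the mean deviation after one step appears.\<close>
    have "A * exp ((\<Sum>e\<in>F. y e) / A) \<le> (\<Sum>e\<in>F. exp (y e))"
      unfolding A_def by (rule sum_exp_ge[OF fF Fne])
    also have "\<dots> \<le> (\<Sum>e\<in>F. ?M k (avoiding F e))"
    proof (rule sum_mono)
      fix e assume e: "e \<in> F"
      have "?M k (avoiding F e) \<ge> 1" using small_matchings_pos[OF finite_avoiding[OF fF], of e k] by linarith
      moreover have "y e \<le> ln (?M k (avoiding F e))" using e_step[OF e] by (simp add: y_def B_def)
      ultimately show "exp (y e) \<le> ?M k (avoiding F e)" by (smt (verit) exp_ln exp_le_cancel_iff)
    qed
    also have "\<dots> \<le> real (Suc k) * ?M (Suc k) F"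
      by (rule small_matchings_Suc[OF fF]) (use ne F(1) in auto)
    finally have "A * exp ((\<Sum>e\<in>F. y e) / A) \<le> real (Suc k) * ?M (Suc k) F" .
    then have "ln (A * exp ((\<Sum>e\<in>F. y e) / A)) \<le> ln (real (Suc k) * ?M (Suc k) F)"
      using A0 by (intro ln_mono) auto
    then have 1: "ln A + (\<Sum>e\<in>F. y e) / A \<le> ln (real (Suc k)) + ln (?M (Suc k) F)"
      using A0 MF1 by (simp add: ln_mult_pos del: of_nat_Suc)
    have "(\<Sum>e\<in>F. y e) / A = B - \<theta> (u - r) * ((\<Sum>e\<in>F. deviation (avoiding F e) (U - e) (d (u - r))) / A)"
      using A0 by (simp add: y_def sum_subtractf sum_distrib_left[symmetric] A_def diff_divide_distrib)
    also have "\<dots> \<ge> B - \<theta> (u - r) * ((1 + 4 * real r * (real r + 1) / real u) * W + step_noise (real r) * d u)"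
    proof -
      have "(\<Sum>e\<in>F. deviation (avoiding F e) (U - e) (d (u - r))) / A
          \<le> (1 + 4 * real r * (real r + 1) / real u) * W + step_noise (real r) * d u"
        using step A0 by (simp add: pos_divide_le_eq mult.commute)
      from mult_left_mono[OF this \<theta>0[of "u - r"]] show ?thesis by (intro diff_left_mono)
    qed
    finally have 2: "(\<Sum>e\<in>F. y e) / A \<ge> B - \<theta> (u - r) * ((1 + 4 * real r * (real r + 1) / real u) * W + step_noise (real r) * d u)" .
    have 3: "ln A \<ge> ln a - \<eta> - (W / (real u * (d u)\<^sup>2)) / \<eta>"
    proof (rule ln_ge_of_relative_error[OF apos Aa _ _ \<eta>])
      have "real r * (a * (1 + X / (real u * d u))) = real u * d u * (1 + X / (real u * d u))"
        using r by (simp add: a_def)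
      also have "\<dots> = real r * A" using upos dpos by (simp add: distrib_left rA)
      finally show "A = a * (1 + X / (real u * d u))" using r by simp
      have "(X / (real u * d u))\<^sup>2 = X\<^sup>2 / (real u * d u)\<^sup>2" by (simp add: power_divide)
      also have "\<dots> \<le> (real u * W) / (real u * d u)\<^sup>2" by (rule divide_right_mono[OF XW]) simp
      also have "\<dots> = W / (real u * (d u)\<^sup>2)" using upos by (simp add: power2_eq_square)
      finally show "(X / (real u * d u))\<^sup>2 \<le> W / (real u * (d u)\<^sup>2)" .
    qed
    have 4: "(\<theta> (u - r) * (1 + 4 * real r * (real r + 1) / real u) + 1 / (\<eta> * real u * (d u)\<^sup>2)) * W \<le> \<theta> u * W"
      by (rule mult_right_mono[OF \<theta>[OF u] W0])
    have 5: "\<theta> (u - r) * (step_noise (real r) * d u) \<le> \<nu>" by (rule noise[OF u])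
    have 6: "?G (Suc k) u = ln a - ln (real (Suc k)) + ?G k (u - r)"
    proof -
      have "ln (a / real (Suc k)) = ln a - ln (real (Suc k))" using apos by (intro ln_divide_pos) auto
      then show ?thesis unfolding growth.simps a_def[symmetric] by simp
    qed
    have 7: "(W / (real u * (d u)\<^sup>2)) / \<eta> = 1 / (\<eta> * real u * (d u)\<^sup>2) * W" by (simp add: mult_ac)
    have 8: "\<theta> (u - r) * ((1 + 4 * real r * (real r + 1) / real u) * W + step_noise (real r) * d u)
      = (\<theta> (u - r) * (1 + 4 * real r * (real r + 1) / real u)) * W + \<theta> (u - r) * (step_noise (real r) * d u)"
      by (simp add: algebra_simps)
    have 9: "(\<theta> (u - r) * (1 + 4 * real r * (real r + 1) / real u)) * W + 1 / (\<eta> * real u * (d u)\<^sup>2) * W \<le> \<theta> u * W"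
      using 4 by (simp only: distrib_right)
    have 10: "real (Suc k) * (\<eta> + \<nu>) = real k * (\<eta> + \<nu>) + \<eta> + \<nu>" by (simp add: algebra_simps)
    show ?thesis using 1 2 3 5 6 7 8 9 10 B_def by linarith
  qed
  moreover have "ln (?M (Suc k) F) \<le> ln (?M (Suc k) E)" using ME MF1 by (intro ln_mono) auto
  moreover have "\<theta> u * W \<le> \<theta> u * deviation E U (d u)" using F(3) \<theta>0 by (simp add: W_def mult_left_mono)
  ultimately show ?case unfolding u_def[symmetric] by linarith
qed

section \<open>Evaluation of the ideal count\<close>

definition xlogx :: "real \<Rightarrow> real" where
  "xlogx x = x * ln x - x"

lemma xlogx_diff_le:
  assumes "x \<ge> 1"
  shows "xlogx x - xlogx (x - 1) \<le> ln x"
proof (cases "x = 1")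
  case True then show ?thesis by (simp add: xlogx_def)
next
  case False
  then have x: "x > 1" using assms by simp
  have "ln x - ln (x - 1) = ln (x / (x - 1))" using x by (simp add: ln_divide_pos)
  also have "\<dots> \<le> x / (x - 1) - 1" using x by (intro ln_le_minus_one) auto
  also have "\<dots> = 1 / (x - 1)" using x by (simp add: field_simps)
  finally have "(x - 1) * (ln x - ln (x - 1)) \<le> (x - 1) * (1 / (x - 1))" using x by (intro mult_left_mono) auto
  then show ?thesis using x by (simp add: xlogx_def algebra_simps)
qed

lemma ln_fact_le:
  assumes "k \<ge> 1"
  shows "ln (fact k :: real) \<le> real k * ln (real k) - real k + ln (real k) + 1"
  using assms
proof (induction k rule: nat_induct_at_least)
  case base then show ?case by simp
next
  case (Suc k)
  define x where "x = real k"
  have x: "x \<ge> 1" using Suc by (simp add: x_def)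
  have "ln x - ln (x + 1) = ln (x / (x + 1))" using x by (simp add: ln_divide_pos)
  also have "\<dots> \<le> x / (x + 1) - 1" using x by (intro ln_le_minus_one) auto
  also have "\<dots> = - (1 / (x + 1))" using x by (simp add: field_simps)
  finally have "(x + 1) * (ln x - ln (x + 1)) \<le> (x + 1) * (- (1 / (x + 1)))" using x by (intro mult_left_mono) auto
  then have 1: "x * ln x + ln x + 1 \<le> (x + 1) * ln (x + 1)" using x by (simp add: algebra_simps)
  have "ln (fact (Suc k) :: real) = ln (x + 1) + ln (fact k)"
    by (simp add: ln_mult_pos x_def add.commute)
  also have "\<dots> \<le> ln (x + 1) + (x * ln x - x + ln x + 1)" using Suc by (simp add: x_def)
  also have "\<dots> \<le> (x + 1) * ln (x + 1) - (x + 1) + ln (x + 1) + 1" using 1 by linarith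
  finally show ?case by (simp add: x_def add.commute)
qed

text \<open>In terms of \<open>x = u / r\<close> each step lowers \<open>x\<close> by one, and the
  ideal edge count is \<open>c * r ^ (r - 1) * x ^ r\<close>. The sum of the \<open>r * ln x\<close>
  is compared with an integral, \<open>xlogx\<close> being the antiderivative of
  \<open>ln\<close>.\<close>

lemma growth_ge:
  fixes c :: real
  assumes r: "r \<ge> 1" and c: "c > 0" and u: "r * k \<le> u"
  shows "growth r (\<lambda>u. real u * (c * real u ^ (r - 1)) / real r) k u
    \<ge> real k * ln (c * real r ^ (r - 1)) - ln (fact k)
       + real r * (xlogx (real u / real r) - xlogx (real u / real r - real k))"
  using u
proof (induction k arbitrary: u)
  case 0 then show ?case by simp
next
  case (Suc k)
  define x where "x = real u / real r"
  have r0: "real r > 0" using r by simp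
  have rk: "real r * (real k + 1) \<le> real u" using Suc.prems by (metis of_nat_Suc of_nat_le_iff of_nat_mult add.commute)
  then have x1: "x \<ge> real k + 1" using r0 by (simp add: x_def pos_le_divide_eq mult.commute)
  have ux: "real u = real r * x" using r0 by (simp add: x_def)
  have ur: "real (u - r) / real r = x - 1"
    using Suc.prems r0 by (simp add: x_def of_nat_diff diff_divide_distrib)
  have pw: "y * y ^ (r - 1) = y ^ r" for y :: real using r by (cases r) auto
  have "real u * (c * real u ^ (r - 1)) / real r = (c * real r ^ (r - 1)) * x ^ r"
    unfolding ux power_mult_distrib pw[symmetric] using r0 by simp
  then have "ln (real u * (c * real u ^ (r - 1)) / real r / real (Suc k)) = ln ((c * real r ^ (r - 1)) * x ^ r) - ln (real (Suc k))"
    using c r0 x1 by (simp only:, intro ln_divide_pos) auto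
  also have "\<dots> = ln (c * real r ^ (r - 1)) + real r * ln x - ln (real (Suc k))"
    using c r0 x1 by (subst ln_mult_pos) (auto simp: ln_realpow)
  finally have 1: "ln (real u * (c * real u ^ (r - 1)) / real r / real (Suc k))
    = ln (c * real r ^ (r - 1)) + real r * ln x - ln (real (Suc k))" .
  have 2: "real r * (xlogx x - xlogx (x - 1)) \<le> real r * ln x"
    using xlogx_diff_le[of x] x1 r0 by (intro mult_left_mono) auto
  have 3: "ln (fact (Suc k) :: real) = ln (real (Suc k)) + ln (fact k)" by (simp add: ln_mult_pos del: of_nat_Suc)
  have IH: "growth r (\<lambda>u. real u * (c * real u ^ (r - 1)) / real r) k (u - r)
    \<ge> real k * ln (c * real r ^ (r - 1)) - ln (fact k) + real r * (xlogx (x - 1) - xlogx (x - 1 - real k))"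
    using Suc.IH[of "u - r"] Suc.prems ur by simp
  have 4: "x - real (Suc k) = x - 1 - real k" by simp
  have 5: "real (Suc k) * ln (c * real r ^ (r - 1)) = real k * ln (c * real r ^ (r - 1)) + ln (c * real r ^ (r - 1))"
    by (simp add: algebra_simps)
  show ?case unfolding growth.simps 1 3 x_def[symmetric] 4 5 using IH 2 by (simp only: right_diff_distrib)
qed

text \<open>The target degree is \<open>D * (u / V) ^ (r - 1)\<close>, since an edge at an uncovered
  vertex survives as long as its other \<open>r - 1\<close> vertices are uncovered. The power of
  \<open>\<tau>\<close> in the error is the price for continuing until only about a fraction
  \<open>\<tau>\<close> of the vertices is left.\<close>

lemma ln_matchings_ge:
  fixes U :: "'v set" and \<tau> \<eta> :: real and r D k :: nat
  defines "V \<equiv> real (card U)"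
  defines "L \<equiv> 4 * ln (V * real D) + 2 / \<eta>"
  assumes U: "finite U" "E \<subseteq> Pow U" and unif: "\<And>f. f \<in> E \<Longrightarrow> card f = r" and lin: "linear_hg E"
    and r: "r \<ge> 2" and reg: "\<And>v. v \<in> U \<Longrightarrow> degree E v = D" and D: "1 \<le> D" "real D \<le> V"
    and \<tau>: "0 < \<tau>" "\<tau> \<le> 1" "real r / 2 \<le> real D * \<tau> ^ (r - 1)" and \<eta>: "\<eta> > 0"
    and k: "k \<ge> 1" "\<tau> * V + 1 + real r * real k \<le> V"
  shows "ln (real (card {T \<in> matchings E. card T \<le> k}))
    \<ge> real k * (ln (real D) + 1 - real r) - ln (real k) - 1
      - real k * (\<eta> + step_noise (real r) * L / (real D * \<tau> ^ (6 * r + 4)))"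
proof -
  define R where "R = r - 1"
  \<comment> \<open>Chosen so that \<open>- p * r + 4 * r * (r + 1) = - r\<close>: the price falls
    faster than the deviation grows, with room for the additional term in hypothesis
    \<open>\<theta>\<close>.\<close>
  define p where "p = 4 * r + 5"
  define c where "c = real D / V ^ R"
  \<comment> \<open>The exponent is \<open>p + 2 * (r - 1) + 1\<close>, from the powers of
    \<open>u / V\<close> in the price, in the squared degree and in the factor \<open>u\<close> of
    hypothesis \<open>bad\<close>.\<close>
  define \<Theta>' where "\<Theta>' = L / ((real D)\<^sup>2 * \<tau> ^ (6 * r + 4))"
  define \<Theta> where "\<Theta> = \<Theta>' / V ^ p"
  define \<nu> where "\<nu> = step_noise (real r) * L / (real D * \<tau> ^ (6 * r + 4))"
  define lo where "lo = nat \<lceil>\<tau> * V\<rceil>"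
  have rR: "r = Suc R" "real R = real r - 1" using r by (auto simp: R_def of_nat_diff)
  have V1: "V \<ge> 1" using D by linarith
  have VD: "V * real D \<ge> 1" using V1 D mult_mono[of 1 V 1 "real D"] by simp
  \<comment> \<open>In \<open>L\<close> the summand \<open>2 / \<eta>\<close> serves hypothesis
    \<open>\<theta>\<close>, and \<open>4 * ln (V * D)\<close> serves \<open>bad\<close>, where
    \<open>growth\<close> is at most \<open>V * ln (V * D)\<close>.\<close>
  have L0: "L > 0" "L \<ge> 2 / \<eta>" "L \<ge> 4 * ln (V * real D)" using ln_ge_zero[OF VD] \<eta> by (auto simp: L_def add_nonneg_pos)
  have \<Theta>'0: "\<Theta>' > 0" using L0 D \<tau> by (simp add: \<Theta>'_def)
  have c0: "c > 0" using D V1 by (simp add: c_def)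
  have sn: "step_noise (real r) \<ge> 0" using r by (intro step_noise_nonneg) simp
  have \<nu>0: "\<nu> \<ge> 0" using sn L0 D \<tau> by (simp add: \<nu>_def)
  have rng: "\<tau> \<le> real u / V" "real u / V \<le> 1" if "lo \<le> u" "u \<le> card U" for u
  proof -
    have "\<tau> * V \<le> real u" using that \<tau> V1 by (simp add: lo_def)
    then show "\<tau> \<le> real u / V" using V1 by (simp add: pos_le_divide_eq)
    show "real u / V \<le> 1" using that V1 by (simp add: V_def)
  qed
  have dt: "c * real u ^ R = real D * (real u / V) ^ R" for u by (simp add: c_def power_divide)
  have \<theta>t: "\<Theta> * real u ^ p = \<Theta>' * (real u / V) ^ p" for u by (simp add: \<Theta>_def power_divide)
  have upos: "real u > 0" if "lo \<le> u" "u \<le> card U" for u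
    using rng[OF that] \<tau> V1 by (smt (verit) divide_nonpos_pos)
  have main: "ln (real (card {T \<in> matchings E. card T \<le> k}))
    \<ge> growth r (\<lambda>u. real u * (c * real u ^ (r - 1)) / real r) k (card U) - real k * (\<eta> + \<nu>)
      - \<Theta> * real (card U) ^ p * deviation E U (c * real (card U) ^ (r - 1))"
  proof (rule ln_small_matchings_ge[where n = "card U" and lo = lo and k = k])
    show "2 \<le> r" "0 < c" "0 < \<eta>" "0 \<le> \<nu>" "finite U" "card U \<le> card U" "E \<subseteq> Pow U" "linear_hg E"
      using r c0 \<eta> \<nu>0 U lin by auto
    show "0 \<le> \<Theta>" using \<Theta>'0 V1 by (simp add: \<Theta>_def)
    show "card f = r" if "f \<in> E" for f using unif that .
    have "real lo \<le> \<tau> * V + 1" using \<tau> V1 by (simp add: lo_def)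
    then have "real (lo + r * k) \<le> real (card U)" using k by (simp add: V_def)
    then show "lo + r * k \<le> card U" by linarith
    fix u assume u: "lo \<le> u" "u \<le> card U"
    have "real D * \<tau> ^ R \<le> real D * (real u / V) ^ R" using rng[OF u] \<tau> by (intro mult_left_mono power_mono) auto
    then show "real r / 2 \<le> c * real u ^ (r - 1) \<and> c * real u ^ (r - 1) \<le> real u"
    proof (intro conjI)
      have "(real u / V) ^ R \<le> (real u / V) ^ 1" using rng[OF u] r \<tau>(1) by (intro power_decreasing) (auto simp: R_def)
      then have "real D * (real u / V) ^ R \<le> V * (real u / V)" using D V1 by (intro mult_mono) auto
      then show "c * real u ^ (r - 1) \<le> real u" using V1 dt[of u] by (simp add: R_def)
    qed (use \<tau>(3) dt[of u] in \<open>simp add: R_def\<close>)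
  next
    fix u assume u: "lo + r \<le> u" "u \<le> card U"
    define t where "t = real u / V"
    have t: "\<tau> \<le> t" "t \<le> 1" "t > 0" using rng[of u] u \<tau> by (auto simp: t_def)
    have up: "real u > 0" "real u \<ge> 1" using upos[of u] u by auto
    define z where "z = real r / real u"
    have z: "0 \<le> z" "z \<le> 1" using u up by (auto simp: z_def)
    have ur: "real (u - r) = real u * (1 - z)" using u up by (simp add: z_def of_nat_diff algebra_simps)
    define K where "K = 4 * real r * (real r + 1)"
    have 1: "(1 - z) ^ p * (1 + K / real u) \<le> 1 - 1 / (2 * real u)"
    proof -
      have "(1 - z) ^ p \<le> exp (- z) ^ p" using exp_ge_add_one_self[of "- z"] z by (intro power_mono) auto
      then have "(1 - z) ^ p * (1 + K / real u) \<le> exp (- z) ^ p * exp (K / real u)"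
        using exp_ge_add_one_self[of "K / real u"] z by (intro mult_mono) (auto simp: K_def)
      also have "\<dots> = exp (- real p * z + K / real u)" by (simp add: exp_of_nat_mult[symmetric] mult_exp_exp)
      also have "\<dots> \<le> exp (- (1 / real u))"
      proof -
        have "- real p * z + K / real u = - (real r / real u)" using up by (simp add: p_def z_def K_def field_simps)
        also have "\<dots> \<le> - (1 / real u)" using r by (simp add: divide_right_mono)
        finally show ?thesis by simp
      qed
      also have "\<dots> \<le> 1 - 1 / (2 * real u)"
      proof -
        define y where "y = 1 / real u"
        have y: "0 < y" "y \<le> 1" using up by (auto simp: y_def)
        have "exp (- y) = 1 / exp y" by (simp add: exp_minus inverse_eq_divide)
        also have "\<dots> \<le> 1 / (1 + y)" using exp_ge_add_one_self[of y] y by (intro divide_left_mono) auto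
        also have "\<dots> \<le> 1 - y / 2"
        proof -
          have "y * y \<le> y" using y mult_left_le[of y y] by simp
          then have "1 \<le> (1 - y / 2) * (1 + y)" by (simp add: algebra_simps)
          then show ?thesis using y by (simp add: pos_divide_le_eq)
        qed
        finally show ?thesis by (simp add: y_def)
      qed
      finally show ?thesis .
    qed
    have dge: "(c * real u ^ (r - 1))\<^sup>2 = (real D)\<^sup>2 * t ^ (2 * R)"
      using dt[of u] by (simp add: R_def t_def power_mult_distrib power_mult[symmetric] mult.commute)
    have big: "2 / \<eta> \<le> \<Theta>' * t ^ p * ((real D)\<^sup>2 * t ^ (2 * R))"
    proof -
      have "2 / \<eta> \<le> L" using L0 by simp
      also have "L = \<Theta>' * ((real D)\<^sup>2 * \<tau> ^ (6 * r + 4))" using D \<tau> by (simp add: \<Theta>'_def)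
      also have "\<tau> ^ (6 * r + 4) \<le> t ^ (p + 2 * R)"
      proof -
        have "p + 2 * R \<le> 6 * r + 4" using r unfolding p_def R_def by simp
        then have "\<tau> ^ (6 * r + 4) \<le> \<tau> ^ (p + 2 * R)" using \<tau> by (intro power_decreasing) auto
        also have "\<dots> \<le> t ^ (p + 2 * R)" using t \<tau> by (intro power_mono) auto
        finally show ?thesis .
      qed
      finally have "2 / \<eta> \<le> \<Theta>' * ((real D)\<^sup>2 * t ^ (p + 2 * R))" using \<Theta>'0 by (simp add: mult_left_mono)
      then show ?thesis by (simp add: power_add mult_ac)
    qed
    have b: "1 / (\<eta> * real u * (c * real u ^ (r - 1))\<^sup>2) \<le> \<Theta>' * t ^ p * (1 / (2 * real u))"
    proof -
      have X: "(real D)\<^sup>2 * t ^ (2 * R) > 0" using D t by simp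
      have "1 / \<eta> \<le> \<Theta>' * t ^ p / 2 * ((real D)\<^sup>2 * t ^ (2 * R))" using big by simp
      then have "1 / \<eta> / ((real D)\<^sup>2 * t ^ (2 * R)) \<le> \<Theta>' * t ^ p / 2"
        by (simp only: pos_divide_le_eq[OF X])
      then have "1 / \<eta> / ((real D)\<^sup>2 * t ^ (2 * R)) / real u \<le> \<Theta>' * t ^ p / 2 / real u"
        using up by (intro divide_right_mono) auto
      then show ?thesis unfolding dge by (simp add: mult_ac)
    qed
    have "\<Theta> * real (u - r) ^ p = \<Theta>' * (real (u - r) / V) ^ p" by (rule \<theta>t)
    also have "\<dots> = \<Theta>' * t ^ p * (1 - z) ^ p" by (simp add: ur t_def power_mult_distrib power_divide)
    finally have "\<Theta> * real (u - r) ^ p * (1 + K / real u) = \<Theta>' * t ^ p * ((1 - z) ^ p * (1 + K / real u))" by simp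
    also have "\<dots> \<le> \<Theta>' * t ^ p * (1 - 1 / (2 * real u))" using 1 \<Theta>'0 t by (intro mult_left_mono) auto
    finally have "\<Theta> * real (u - r) ^ p * (1 + K / real u) + 1 / (\<eta> * real u * (c * real u ^ (r - 1))\<^sup>2) \<le> \<Theta>' * t ^ p"
      using b by (simp add: algebra_simps)
    then show "\<Theta> * real (u - r) ^ p * (1 + 4 * real r * (real r + 1) / real u) + 1 / (\<eta> * real u * (c * real u ^ (r - 1))\<^sup>2)
      \<le> \<Theta> * real u ^ p" unfolding \<theta>t K_def t_def .
    have "\<Theta> * real (u - r) ^ p = \<Theta>' * (real (u - r) / V) ^ p" by (rule \<theta>t)
    also have "\<dots> \<le> \<Theta>' * 1" using \<Theta>'0 u V1 by (intro mult_left_mono power_le_one) (auto simp: V_def)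
    finally have "\<Theta> * real (u - r) ^ p \<le> \<Theta>'" by simp
    moreover have "c * real u ^ (r - 1) \<le> real D"
      using dt[of u] t mult_left_mono[of "t ^ R" 1 "real D"] by (simp add: R_def t_def power_le_one)
    ultimately have "\<Theta> * real (u - r) ^ p * (step_noise (real r) * (c * real u ^ (r - 1))) \<le> \<Theta>' * (step_noise (real r) * real D)"
      using sn c0 \<Theta>'0 by (intro mult_mono mult_left_mono) auto
    also have "\<dots> = \<nu>" using D \<tau> by (simp add: \<Theta>'_def \<nu>_def power2_eq_square field_simps)
    finally show "\<Theta> * real (u - r) ^ p * (step_noise (real r) * (c * real u ^ (r - 1))) \<le> \<nu>" .
  next
    fix u k assume u: "lo + r * k \<le> u" "u \<le> card U" "1 \<le> k"
    define t where "t = real u / V"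
    have t: "\<tau> \<le> t" "t \<le> 1" "t > 0" using rng[of u] u \<tau> by (auto simp: t_def)
    have gr: "growth r (\<lambda>u. real u * (c * real u ^ (r - 1)) / real r) j w \<le> real j * ln (V * real D)"
      if "w \<le> card U" for j w
      using that
    proof (induction j arbitrary: w)
      case (Suc j)
      have "real w * (c * real w ^ (r - 1)) / real r / real (Suc j) \<le> V * real D"
      proof -
        have "c * real w ^ (r - 1) \<le> real D"
          using dt[of w] Suc.prems V1 mult_left_mono[of "(real w / V) ^ R" 1 "real D"] by (simp add: R_def power_le_one V_def)
        then have 1: "real w * (c * real w ^ (r - 1)) \<le> V * real D"
          using Suc.prems c0 by (intro mult_mono) (auto simp: V_def)
        have "real w * (c * real w ^ (r - 1)) / (real r * real (Suc j)) \<le> real w * (c * real w ^ (r - 1)) / 1"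
          using c0 r mult_mono[of 1 "real r" 1 "real (Suc j)"] by (intro divide_left_mono) auto
        then show ?thesis using 1 by (simp add: divide_divide_eq_left)
      qed
      then have "ln (real w * (c * real w ^ (r - 1)) / real r / real (Suc j)) \<le> ln (V * real D)"
      proof (cases "w = 0")
        case True then show ?thesis using ln_ge_zero[OF VD] by simp
      next
        case False
        then have "real w * (c * real w ^ (r - 1)) / real r / real (Suc j) > 0" using c0 r by simp
        then show ?thesis using \<open>real w * (c * real w ^ (r - 1)) / real r / real (Suc j) \<le> V * real D\<close> by (intro ln_mono) auto
      qed
      moreover have "growth r (\<lambda>u. real u * (c * real u ^ (r - 1)) / real r) j (w - r) \<le> real j * ln (V * real D)"
        using Suc by auto
      ultimately show ?case by (simp add: algebra_simps del: of_nat_Suc) (simp add: algebra_simps)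
    qed simp
    have "k \<le> r * k" using r by simp
    then have "k \<le> card U" using u(1,2) by linarith
    then have "real k \<le> V" by (simp add: V_def)
    then have "real k * ln (V * real D) \<le> V * (L / 4)"
      using L0 ln_ge_zero[OF VD] V1 by (intro mult_mono) auto
    also have "\<dots> \<le> \<Theta>' * t ^ p * (real u * ((real D)\<^sup>2 * t ^ (2 * R)) / 4)"
    proof -
      have "L = \<Theta>' * ((real D)\<^sup>2 * \<tau> ^ (6 * r + 4))" using D \<tau> by (simp add: \<Theta>'_def)
      also have "\<tau> ^ (6 * r + 4) \<le> t ^ (6 * r + 4)" using t \<tau> by (intro power_mono) auto
      also have "6 * r + 4 = p + 2 * R + 1" by (simp add: p_def rR)
      finally have "L \<le> \<Theta>' * ((real D)\<^sup>2 * t ^ (p + 2 * R + 1))" using \<Theta>'0 by (simp add: mult_left_mono)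
      then have "V * (L / 4) \<le> V * (\<Theta>' * ((real D)\<^sup>2 * t ^ (p + 2 * R + 1)) / 4)" using V1 by (intro mult_left_mono) auto
      also have "\<dots> = \<Theta>' * t ^ p * ((V * t) * ((real D)\<^sup>2 * t ^ (2 * R)) / 4)" by (simp add: power_add mult_ac)
      also have "V * t = real u" using V1 by (simp add: t_def)
      finally show ?thesis .
    qed
    also have "\<dots> = \<Theta> * real u ^ p * (real u * (c * real u ^ (r - 1))\<^sup>2 / 4)"
      unfolding \<theta>t using dt[of u] by (simp add: R_def t_def power_mult_distrib power_mult[symmetric] mult.commute)
    finally show "growth r (\<lambda>u. real u * (c * real u ^ (r - 1)) / real r) k u
      \<le> \<Theta> * real u ^ p * (real u * (c * real u ^ (r - 1))\<^sup>2 / 4)" using gr[of u k] u by linarith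
  qed
  have "c * real (card U) ^ (r - 1) = real D" using dt[of "card U"] V1 by (simp add: R_def V_def)
  \<comment> \<open>Regularity enters here: the initial degrees equal the target, so the process
    starts with no deviation to pay for.\<close>
  then have dev: "deviation E U (c * real (card U) ^ (r - 1)) = 0" using reg by (simp add: deviation_def)
  define q where "q = V / real r"
  have r0: "real r > 0" using r by simp
  have kV: "real r * real k \<le> V" using k(2) \<tau>(1) V1 by (smt (verit) mult_pos_pos)
  then have kq: "real k \<le> q" using r0 by (simp add: q_def pos_le_divide_eq mult.commute)
  have k0: "real k > 0" using k by simp
  have q0: "q > 0" using kq k0 by linarith
  have x1: "xlogx q - xlogx (q - real k) \<ge> real k * ln q - real k"
  proof -
    have "(q - real k) * ln (q - real k) \<le> (q - real k) * ln q"
    proof (cases "q = real k")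
      case False then show ?thesis using kq k0 by (intro mult_left_mono ln_mono) auto
    qed simp
    then show ?thesis by (simp add: xlogx_def algebra_simps)
  qed
  have "r * k \<le> card U" using kV by (simp add: V_def) (metis of_nat_le_iff of_nat_mult)
  from growth_ge[OF _ c0 this] r
  have "growth r (\<lambda>u. real u * (c * real u ^ (r - 1)) / real r) k (card U)
    \<ge> real k * ln (c * real r ^ (r - 1)) - ln (fact k) + real r * (xlogx q - xlogx (q - real k))"
    by (simp add: q_def V_def)
  moreover have "real r * (xlogx q - xlogx (q - real k)) \<ge> real r * (real k * ln q - real k)"
    using x1 r0 by (intro mult_left_mono) auto
  moreover have "real k * ln (c * real r ^ (r - 1)) + real r * (real k * ln q - real k)
    = real k * (ln (real D) + ln q) - real r * real k"
  proof -
    have "c * real r ^ (r - 1) * q ^ r = real D * q"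
    proof -
      have "c * real r ^ (r - 1) * q ^ r = c * (real r * q) ^ R * q"
        using r by (simp add: R_def power_mult_distrib power_eq_if[of q r])
      also have "real r * q = V" using r0 by (simp add: q_def)
      finally show ?thesis using V1 by (simp add: c_def)
    qed
    then have "ln (c * real r ^ (r - 1)) + real r * ln q = ln (real D) + ln q"
      using c0 r0 q0 D by (metis (no_types, opaque_lifting) ln_mult_pos ln_realpow mult_pos_pos of_nat_0_less_iff zero_less_power less_le_trans zero_less_one)
    then have "real k * (ln (c * real r ^ (r - 1)) + real r * ln q) = real k * (ln (real D) + ln q)" by simp
    then show ?thesis by (simp add: algebra_simps)
  qed
  moreover have "ln (fact k :: real) \<le> real k * ln (real k) - real k + ln (real k) + 1" by (rule ln_fact_le[OF k(1)])
  moreover have "real k * ln (real k) \<le> real k * ln q" using kq k0 by (intro mult_left_mono ln_mono) auto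
  ultimately have "growth r (\<lambda>u. real u * (c * real u ^ (r - 1)) / real r) k (card U)
    \<ge> real k * (ln (real D) + 1 - real r) - ln (real k) - 1"
    by (simp add: algebra_simps)
  then show ?thesis using main unfolding dev \<nu>_def by simp
qed

section \<open>Matchings covering a given number of vertices\<close>

text \<open>Used for \<open>y = z / s ^ r\<close> with \<open>s = i / m\<close>, which is huge for
  small \<open>i\<close>. With \<open>a = 1 / (2 * r)\<close> the power of \<open>s\<close> becomes
  an inverse square root, whose sum over \<open>i\<close> is of order \<open>m\<close>.\<close>

lemma ln_one_plus_le_powr:
  fixes y a :: real
  assumes "y \<ge> 0" "0 < a" "a \<le> 1"
  shows "ln (1 + y) \<le> y powr a / a"
proof (cases "y \<le> 1")
  case True
  have "ln (1 + y) \<le> y" using assms ln_add_one_self_le_self by simp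
  also have "\<dots> = y powr 1" using assms by simp
  also have "\<dots> \<le> y powr a" using assms True by (intro powr_mono') auto
  also have "\<dots> \<le> y powr a / a"
    using assms by (simp add: pos_le_divide_eq mult_left_le)
  finally show ?thesis .
next
  case False
  then have y: "y > 1" by simp
  have "ln (1 + y) \<le> ln (2 * y)" using y by (intro ln_mono) auto
  also have "\<dots> = ln 2 + ln y" using y by (simp add: ln_mult_pos)
  also have "ln (2::real) \<le> 2 - 1" by (rule ln_le_minus_one) simp
  finally have 1: "ln (1 + y) \<le> 1 + ln y" by simp
  have "1 + a * ln y \<le> y powr a" using y exp_ge_add_one_self[of "a * ln y"] by (simp add: powr_def)
  then have "(1 + a * ln y) / a \<le> y powr a / a" using assms by (intro divide_right_mono) auto
  moreover have "(1 + a * ln y) / a = 1 / a + ln y" using assms by (simp add: field_simps)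
  moreover have "1 / a \<ge> 1" using assms by simp
  ultimately show ?thesis using 1 by linarith
qed

lemma sum_inverse_sqrt_le: "(\<Sum>i=1..m. 1 / sqrt (real i)) \<le> 2 * sqrt (real m)"
proof (induction m)
  case (Suc m)
  define s t where "s = sqrt (real (Suc m))" and "t = sqrt (real m)"
  have s: "s > 0" "s * s = t * t + 1" by (auto simp: s_def t_def)
  have "0 \<le> (s - t) * (s - t)" by simp
  then have "1 \<le> (2 * s - 2 * t) * s" using s(2) by (simp add: algebra_simps)
  then have "1 / s \<le> 2 * s - 2 * t" using s(1) by (simp add: pos_divide_le_eq)
  then show ?case using Suc by (simp add: s_def t_def)
qed simp

lemma sum_ln_eq_ln_fact: "(\<Sum>i=1..m. ln (real i)) = ln (fact m)"
proof (induction m)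
  case (Suc m)
  have "ln (fact (Suc m) :: real) = ln (real (Suc m)) + ln (fact m)"
    unfolding fact_Suc by (rule ln_mult_pos) auto
  then show ?case using Suc by simp
qed simp

text \<open>\<open>z\<close> measures, relative to \<open>V * D / r\<close>, the edges that do not
  follow the law \<open>(i / m) ^ r\<close>: members of the matching and edges at uncovered
  vertices. In the logarithm of \<open>matching_kraft\<close> the terms
  \<open>r * ln (i / m)\<close> sum to about \<open>- r * m\<close>, and the factorial contributes
  the \<open>+ m\<close>.\<close>

lemma ln_matchings_le:
  fixes U :: "'v set" and r D m :: nat
  defines "V \<equiv> real (card U)"
  defines "z \<equiv> (real r * real m + real r * real D * (V - real r * real m)) / (V * real D)"
  assumes U: "finite U" "E \<subseteq> Pow U" and unif: "\<And>f. f \<in> E \<Longrightarrow> card f = r" and lin: "linear_hg E"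
    and r: "r \<ge> 1" and deg: "\<And>v. v \<in> U \<Longrightarrow> degree E v \<le> D" and D: "1 \<le> D"
    and m: "m \<ge> 1" and ne: "{T \<in> matchings E. card T = m} \<noteq> {}"
  shows "ln (real (card {T \<in> matchings E. card T = m}))
    \<le> real m * (ln (V * real D / (real r * real m)) - (real r - 1) + 4 * real r * z powr (1 / (2 * real r)))
      + (real r - 1) * (ln (real m) + 1)"
proof -
  let ?N = "{T \<in> matchings E. card T = m}"
  define a where "a = 1 / (2 * real r)"
  define X where "X i = V * real D / real r * ((real i / real m) ^ r + z)" for i
  have fE: "finite E" by (rule finite_subset[OF U(2)]) (use U in simp)
  have emp: "{} \<notin> E" using unif r by force
  have fN: "finite ?N" using finite_matchings[OF fE] by simp
  have r0: "real r > 0" and m0: "real m > 0" and D0: "real D > 0" using r m D by auto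
  obtain T0 where T0: "T0 \<in> matchings E" "card T0 = m" using ne by auto
  have "\<Union>T0 \<subseteq> U" using T0 U by (auto simp: matchings_def)
  then have "r * m \<le> card U" using matching_card_Union[OF fE T0(1) unif r] T0(2) card_mono[OF U(1)] by metis
  then have rmV: "real r * real m \<le> V" unfolding V_def by (metis of_nat_le_iff of_nat_mult)
  then have V0: "V > 0" using r0 m0 by (smt (verit) mult_pos_pos)
  have z0: "z > 0" unfolding z_def using r0 m0 D0 V0 rmV by (intro divide_pos_pos add_pos_nonneg mult_pos_pos mult_nonneg_nonneg) auto
  have cE: "real (card E) \<le> V * real D / real r"
  proof -
    have "real r * real (card E) = (\<Sum>v\<in>U. real (degree E v))" using sum_degree_uniform[OF U(1) fE U(2) unif] by simp
    also have "\<dots> \<le> (\<Sum>v\<in>U. real D)" by (rule sum_mono) (use deg in simp)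
    finally show ?thesis using r0 by (simp add: V_def pos_le_divide_eq mult.commute)
  qed
  have av: "avail i m E T \<le> X i" if "T \<in> ?N" "i \<in> {1..m}" for T i
  proof -
    have "avail i m E T \<le> real m + real (card E) * (real i / real m) ^ r + real D * (V - real r * real m)"
      unfolding V_def using avail_le[OF U unif r lin deg] that by auto
    also have "\<dots> \<le> real m + V * real D / real r * (real i / real m) ^ r + real D * (V - real r * real m)"
      using mult_right_mono[OF cE, of "(real i / real m) ^ r"] by simp
    also have "\<dots> = X i" using r0 D0 V0 by (simp add: X_def z_def field_simps)
    finally show ?thesis .
  qed
  have avp: "avail i m E T > 0" if "T \<in> ?N" "i \<in> {1..m}" for T i
  proof (rule avail_pos[OF fE emp])
    show "T \<noteq> {}" using that m by auto
  qed (use that in auto)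
  have Xp: "X i > 0" for i unfolding X_def using V0 D0 r0 z0 by (intro mult_pos_pos add_nonneg_pos) auto
  have PX: "(\<Prod>i=1..m. X i) > 0" using Xp by (intro prod_pos) auto
  have "real (card ?N) * (fact m / (\<Prod>i=1..m. X i)) = (\<Sum>T\<in>?N. fact m / (\<Prod>i=1..m. X i))" by simp
  also have "\<dots> \<le> (\<Sum>T\<in>?N. fact m / (\<Prod>i=1..m. avail i m E T))"
  proof (rule sum_mono)
    fix T assume T: "T \<in> ?N"
    have "(\<Prod>i=1..m. avail i m E T) \<le> (\<Prod>i=1..m. X i)" using av[OF T] avp[OF T] by (intro prod_mono) (auto simp: less_imp_le)
    moreover have "(\<Prod>i=1..m. avail i m E T) > 0" using avp[OF T] by (intro prod_pos) auto
    ultimately show "fact m / (\<Prod>i=1..m. X i) \<le> fact m / (\<Prod>i=1..m. avail i m E T)"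
      by (intro divide_left_mono mult_pos_pos PX) auto
  qed
  also have "\<dots> \<le> 1" by (rule matching_kraft[OF fE emp])
  finally have "real (card ?N) * fact m \<le> (\<Prod>i=1..m. X i)" using PX by (simp add: pos_divide_le_eq)
  moreover have cN: "real (card ?N) > 0" using ne fN by (simp add: card_gt_0_iff)
  ultimately have "ln (real (card ?N) * fact m) \<le> ln (\<Prod>i=1..m. X i)" by (intro ln_mono) auto
  then have "ln (real (card ?N)) + ln (fact m) \<le> (\<Sum>i=1..m. ln (X i))"
  proof -
    have "ln (\<Prod>i=1..m. X i) = (\<Sum>i=1..m. ln (X i))" using less_imp_neq[OF Xp] by (intro ln_prod) (auto dest: sym)
    moreover have "ln (real (card ?N) * fact m) = ln (real (card ?N)) + ln (fact m)"
      by (rule ln_mult_pos[OF cN]) simp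
    ultimately show ?thesis using \<open>ln (real (card ?N) * fact m) \<le> ln (\<Prod>i=1..m. X i)\<close> by linarith
  qed
  also have "\<dots> \<le> (\<Sum>i=1..m. ln (V * real D / real r) + real r * (ln (real i) - ln (real m)) + 2 * real r * z powr a * sqrt (real m) * (1 / sqrt (real i)))"
  proof (rule sum_mono)
    fix i assume i: "i \<in> {1..m}"
    define s where "s = real i / real m"
    have s0: "s > 0" using i m0 by (simp add: s_def)
    have "ln (X i) = ln (V * real D / real r) + ln (s ^ r + z)"
      unfolding X_def s_def[symmetric] using V0 D0 r0 z0 s0 by (intro ln_mult_pos) (auto intro: add_pos_pos)
    also have "s ^ r + z = s ^ r * (1 + z / s ^ r)" using s0 by (simp add: field_simps)
    also have "ln (s ^ r * (1 + z / s ^ r)) = real r * ln s + ln (1 + z / s ^ r)"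
      using s0 z0 by (subst ln_mult_pos) (auto simp: ln_realpow add_pos_pos)
    also have "ln (1 + z / s ^ r) \<le> (z / s ^ r) powr a / a"
      using s0 z0 r by (intro ln_one_plus_le_powr) (auto simp: a_def)
    also have "(z / s ^ r) powr a / a = 2 * real r * z powr a * sqrt (real m) * (1 / sqrt (real i))"
    proof -
      have "(s ^ r) powr a = s powr (real r * a)" using s0 by (simp add: powr_realpow[symmetric] powr_powr)
      also have "\<dots> = sqrt s" using r0 s0 by (simp add: a_def powr_half_sqrt)
      finally have "(z / s ^ r) powr a = z powr a / sqrt s" using s0 z0 by (simp add: powr_divide)
      moreover have "1 / sqrt s = sqrt (real m) * (1 / sqrt (real i))" by (simp add: s_def real_sqrt_divide)
      ultimately have "(z / s ^ r) powr a = z powr a * (sqrt (real m) * (1 / sqrt (real i)))"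
        by (metis divide_inverse mult_1 inverse_eq_divide)
      moreover have "x / a = 2 * real r * x" for x using r0 by (simp add: a_def)
      ultimately show ?thesis by (simp only: mult.assoc)
    qed
    also have "ln s = ln (real i) - ln (real m)" unfolding s_def using i m0 by (intro ln_divide_pos) auto
    finally show "ln (X i) \<le> ln (V * real D / real r) + real r * (ln (real i) - ln (real m)) + 2 * real r * z powr a * sqrt (real m) * (1 / sqrt (real i))" by simp
  qed
  also have "\<dots> = real m * ln (V * real D / real r) + real r * (ln (fact m) - real m * ln (real m))
      + 2 * real r * z powr a * sqrt (real m) * (\<Sum>i=1..m. 1 / sqrt (real i))"
    by (simp only: sum.distrib sum_distrib_left[symmetric] sum_subtractf sum_ln_eq_ln_fact sum_constant card_atLeastAtMost) simp
  also have "2 * real r * z powr a * sqrt (real m) * (\<Sum>i=1..m. 1 / sqrt (real i)) \<le> 2 * real r * z powr a * sqrt (real m) * (2 * sqrt (real m))"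
    using r0 by (intro mult_left_mono sum_inverse_sqrt_le) auto
  also have "\<dots> = real m * (4 * real r * z powr a)" using m0 by (simp add: mult_ac)
  finally have "ln (real (card ?N)) \<le> real m * ln (V * real D / real r) + (real r - 1) * ln (fact m) - real r * (real m * ln (real m))
      + real m * (4 * real r * z powr a)" by (simp add: algebra_simps)
  also have "(real r - 1) * ln (fact m) \<le> (real r - 1) * (real m * ln (real m) - real m + ln (real m) + 1)"
    using r by (intro mult_left_mono ln_fact_le[OF m]) auto
  finally have "ln (real (card ?N)) \<le> real m * (ln (V * real D / real r) - ln (real m)) - (real r - 1) * real m
      + (real r - 1) * (ln (real m) + 1) + real m * (4 * real r * z powr a)"
    by (simp add: algebra_simps)
  moreover have eq: "ln (V * real D / (real r * real m)) = ln (V * real D / real r) - ln (real m)"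
    using V0 D0 r0 m0 by (subst ln_divide_pos[symmetric]) auto
  ultimately show ?thesis unfolding a_def[symmetric] eq by (simp add: algebra_simps)
qed

text \<open>Leaving a fraction \<open>1 - g\<close> of the vertices uncovered costs a term of order \<open>ln D\<close>, which absorbs
  all bounded errors.\<close>

lemma uncovered_absorbs:
  fixes \<gamma> \<epsilon> :: real and r :: nat
  assumes r: "r \<ge> 1" and \<gamma>: "0 \<le> \<gamma>" "\<gamma> < 1" and \<epsilon>: "\<epsilon> > 0"
  shows "\<exists>D0\<ge>1. (1 - \<gamma>) * ln D0 \<ge> real r \<and> (\<forall>D\<ge>D0. \<forall>g z. 0 < g \<longrightarrow> g \<le> 1 \<longrightarrow> 0 \<le> z \<longrightarrow> z \<le> 1 / D + real r * (1 - g) \<longrightarrow>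
    g * (ln D - ln g - (real r - 1) + 4 * real r * z powr (1 / (2 * real r)))
      \<le> (1 - \<gamma> * (1 - g)) * ln D + 1 - real r + \<epsilon>)"
proof -
  define a where "a = 1 / (2 * real r)"
  \<comment> \<open>Chosen so that \<open>4 * r * w powr a = \<epsilon>\<close>. One half of
    \<open>w\<close> is reserved for \<open>1 / D\<close>, the other for \<open>r * (1 - g)\<close>,
    which fixes \<open>b\<close>.\<close>
  define w where "w = (\<epsilon> / (4 * real r)) ^ (2 * r)"
  define b where "b = w / (2 * real r)"
  define D0 where "D0 = max 1 (max (2 / w) (exp ((real r + 4 * real r * (1 + real r) / b) / (1 - \<gamma>))))"
  have r0: "real r \<ge> 1" using r by simp
  have w: "w > 0" using \<epsilon> r0 by (simp add: w_def)
  have b: "b > 0" using w r0 by (simp add: b_def)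
  have a: "0 < a" "a \<le> 1" using r0 by (auto simp: a_def)
  have wa: "w powr a = \<epsilon> / (4 * real r)"
  proof -
    have "w = (\<epsilon> / (4 * real r)) powr (real (2 * r))" unfolding w_def using \<epsilon> r0 by (subst powr_realpow) auto
    then show ?thesis using \<epsilon> r0 by (simp add: powr_powr a_def)
  qed
  have D01: "D0 \<ge> 1" "D0 \<ge> 2 / w" "D0 \<ge> exp ((real r + 4 * real r * (1 + real r) / b) / (1 - \<gamma>))" by (auto simp: D0_def)
  have big: "(1 - \<gamma>) * ln D \<ge> real r + 4 * real r * (1 + real r) / b" if "D \<ge> D0" for D
  proof -
    have "exp ((real r + 4 * real r * (1 + real r) / b) / (1 - \<gamma>)) \<le> D" using that D01 by linarith
    then have "(real r + 4 * real r * (1 + real r) / b) / (1 - \<gamma>) \<le> ln D" using that D01(1) by (subst ln_ge_iff) auto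
    then show ?thesis using \<gamma> by (simp add: pos_divide_le_eq mult.commute)
  qed
  show ?thesis
  proof (intro exI[of _ D0] conjI allI impI)
    show "1 \<le> D0" by (rule D01)
    have "4 * real r * (1 + real r) / b \<ge> 0" using b by simp
    then show "real r \<le> (1 - \<gamma>) * ln D0" using big[of D0] by simp
    fix D g z :: real assume D: "D0 \<le> D" and g: "0 < g" "g \<le> 1" and z: "0 \<le> z" "z \<le> 1 / D + real r * (1 - g)"
    have D1: "D \<ge> 1" using D D01 by linarith
    have lg: "- (g * ln g) \<le> 1 - g"
    proof -
      have "ln (1 / g) \<le> 1 / g - 1" using g by (intro ln_le_minus_one) auto
      then have "g * ln (1 / g) \<le> g * (1 / g - 1)" using g by (intro mult_left_mono) auto
      then show ?thesis using g by (simp add: ln_divide_pos algebra_simps)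
    qed
    have gz: "g * (4 * real r * z powr a) \<le> 4 * real r * z powr a" using g r0 by (intro mult_left_le_one_le) auto
    have "4 * real r * z powr a - (1 - g) * ((1 - \<gamma>) * ln D - real r) \<le> \<epsilon>"
    \<comment> \<open>If a fraction of at least \<open>b\<close> is uncovered, the term in
      \<open>ln D\<close> beats the trivial bound \<open>z \<le> 1 + r\<close>; otherwise
      \<open>z \<le> w\<close> is small by itself.\<close>
    proof (cases "1 - g \<ge> b")
      case True
      have "z \<le> 1 + real r"
      proof -
        have "1 / D \<le> 1" using D1 by simp
        moreover have "real r * (1 - g) \<le> real r" using g r0 by (simp add: algebra_simps)
        ultimately show ?thesis using z by linarith
      qed
      then have "z powr a \<le> (1 + real r) powr a" using z a by (intro powr_mono2) auto
      also have "\<dots> \<le> (1 + real r) powr 1" using a r0 by (intro powr_mono) auto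
      finally have "4 * real r * z powr a \<le> 4 * real r * (1 + real r)" using r0 by (intro mult_left_mono) auto
      moreover have "(1 - g) * ((1 - \<gamma>) * ln D - real r) \<ge> b * (4 * real r * (1 + real r) / b)"
        using True big[OF D] b r0 by (intro mult_mono) auto
      ultimately show ?thesis using b \<epsilon> by simp
    next
      case False
      have "1 / D \<le> w / 2"
      proof -
        have "2 / w \<le> D" using D D01 by linarith
        then show ?thesis using w D1 by (simp add: field_simps)
      qed
      moreover have "real r * (1 - g) \<le> real r * b" using False r0 by (intro mult_left_mono) auto
      moreover have "real r * b = w / 2" using r0 by (simp add: b_def)
      ultimately have "z \<le> w" using z by linarith
      then have "z powr a \<le> \<epsilon> / (4 * real r)" unfolding wa[symmetric] using z a by (intro powr_mono2) auto
      then have "4 * real r * z powr a \<le> \<epsilon>" using r0 by (simp add: field_simps)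
      moreover have "(1 - g) * ((1 - \<gamma>) * ln D - real r) \<ge> 0"
      proof -
        have "4 * real r * (1 + real r) / b \<ge> 0" using b by simp
        then show ?thesis using big[OF D] g by (intro mult_nonneg_nonneg) auto
      qed
      ultimately show ?thesis by linarith
    qed
    then show "g * (ln D - ln g - (real r - 1) + 4 * real r * z powr (1 / (2 * real r)))
      \<le> (1 - \<gamma> * (1 - g)) * ln D + 1 - real r + \<epsilon>"
      using lg gz unfolding a_def[symmetric] by (simp add: algebra_simps)
  qed
qed

text \<open>Of the gain \<open>(ln D) / r\<close> for each uncovered vertex, the share
  \<open>1 - \<gamma>\<close> is spent on the error terms. The share \<open>\<gamma>\<close> stays
  in the bound: the vertices that the matching leaves free are to pay for larger blocks.\<close>

lemma matchings_le_exp: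
  fixes \<gamma> \<epsilon> :: real and r :: nat
  assumes r: "r \<ge> 1" and \<gamma>: "0 \<le> \<gamma>" "\<gamma> < 1" and \<epsilon>: "\<epsilon> > 0"
  shows "\<exists>D0. \<forall>D (U :: 'v set) E m. D0 \<le> real D \<longrightarrow> finite U \<longrightarrow> E \<subseteq> Pow U \<longrightarrow> (\<forall>f\<in>E. card f = r) \<longrightarrow> linear_hg E \<longrightarrow>
     (\<forall>v\<in>U. degree E v \<le> D) \<longrightarrow> r \<le> card U \<longrightarrow> r * m \<le> card U \<longrightarrow>
     real (card {T \<in> matchings E. card T = m})
      \<le> exp (real (card U) / real r * (ln (real D) + 1 - real r + \<epsilon>) + (real r - 1) * (ln (real (card U) / real r) + 1)
          - \<gamma> * ((real (card U) - real r * real m) / real r) * ln (real D))"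
proof -
  obtain D0 where D0: "D0 \<ge> 1" "(1 - \<gamma>) * ln D0 \<ge> real r"
    and main: "\<And>D g z. D \<ge> D0 \<Longrightarrow> 0 < g \<Longrightarrow> g \<le> 1 \<Longrightarrow> 0 \<le> z \<Longrightarrow> z \<le> 1 / D + real r * (1 - g) \<Longrightarrow>
      g * (ln D - ln g - (real r - 1) + 4 * real r * z powr (1 / (2 * real r)))
      \<le> (1 - \<gamma> * (1 - g)) * ln D + 1 - real r + \<epsilon>"
    using uncovered_absorbs[OF r \<gamma> \<epsilon>] by blast
  show ?thesis
  proof (intro exI[of _ D0] allI impI)
    fix D m and U :: "'v set" and E
    assume D: "D0 \<le> real D" and U: "finite U" "E \<subseteq> Pow U" and unif: "\<forall>f\<in>E. card f = r" and lin: "linear_hg E"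
      and deg: "\<forall>v\<in>U. degree E v \<le> D" and rU: "r \<le> card U" and rm: "r * m \<le> card U"
    define V where "V = real (card U)"
    define q where "q = V / real r"
    define g where "g = real m / q"
    have r0: "real r \<ge> 1" using r by simp
    have V: "V \<ge> real r" using rU by (simp add: V_def)
    then have V0: "V > 0" using r0 by linarith
    have q: "q \<ge> 1" using V r0 by (simp add: q_def)
    have Vq: "V = real r * q" using r0 by (simp add: q_def)
    have mg: "real m = q * g" using q by (simp add: g_def)
    have rmV: "real r * real m \<le> V" using rm unfolding V_def by (metis of_nat_le_iff of_nat_mult)
    have g: "0 \<le> g" "g \<le> 1" using rmV q r0 by (auto simp: g_def Vq)
    have Dp: "real D \<ge> 1" using D D0 by linarith
    have unc: "(V - real r * real m) / real r = q * (1 - g)" using r0 by (simp add: Vq mg field_simps)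
    let ?N = "{T \<in> matchings E. card T = m}"
    let ?Q = "q * (ln (real D) + 1 - real r + \<epsilon>) + (real r - 1) * (ln q + 1) - \<gamma> * (q * (1 - g)) * ln (real D)"
    have lq: "ln q \<ge> 0" using q by simp
    have Qeq: "?Q = q * ((1 - \<gamma> * (1 - g)) * ln (real D) + 1 - real r + \<epsilon>) + (real r - 1) * (ln q + 1)"
      by (simp add: algebra_simps)
    have "real (card ?N) \<le> exp ?Q"
    proof (cases "?N = {}")
      case True
      then have "card ?N = 0" by (simp only: card.empty)
      then show ?thesis by simp
    next
      case False
      have fN: "finite ?N" using finite_matchings[OF finite_subset[OF U(2)]] U(1) by simp
      then have cN: "real (card ?N) > 0" using False by (simp add: card_gt_0_iff)
      have "ln (real (card ?N)) \<le> ?Q"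
      \<comment> \<open>The general estimate needs \<open>g > 0\<close>. For the empty matching it
        is enough that the exponent is nonnegative, which the choice of \<open>D0\<close>
        ensures.\<close>
      proof (cases "m = 0")
        case True
        have "?N \<subseteq> {{}}"
          using True matching_finite[OF finite_subset[OF U(2)]] U(1) by auto
        then have "card ?N \<le> card {{} :: 'v set set}" by (rule card_mono[rotated]) simp
        then have "real (card ?N) \<le> 1" by simp
        then have "ln (real (card ?N)) \<le> 0" using cN by simp
        moreover have "(1 - \<gamma>) * ln (real D) \<ge> real r"
        proof -
          have "ln D0 \<le> ln (real D)" using D D0 by (intro ln_mono) auto
          then have "(1 - \<gamma>) * ln D0 \<le> (1 - \<gamma>) * ln (real D)" using \<gamma> by (intro mult_left_mono) auto
          then show ?thesis using D0 by linarith
        qed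
        then have "q * ((1 - \<gamma> * (1 - g)) * ln (real D) + 1 - real r + \<epsilon>) \<ge> 0"
          using q \<epsilon> True by (simp add: g_def)
        moreover have "(real r - 1) * (ln q + 1) \<ge> 0" using r0 lq by simp
        ultimately show ?thesis unfolding Qeq by linarith
      next
        case m: False
        define z where "z = (real r * real m + real r * real D * (V - real r * real m)) / (V * real D)"
        have g0: "g > 0" using m q by (simp add: g_def)
        have zeq: "z = g / real D + real r * (1 - g)"
          using q r0 Dp by (simp add: z_def Vq mg field_simps)
        have z0: "z \<ge> 0" unfolding zeq using g Dp by simp
        have zle: "z \<le> 1 / real D + real r * (1 - g)" unfolding zeq using g Dp by (simp add: divide_right_mono)
        have "ln (real (card ?N)) \<le> real m * (ln (V * real D / (real r * real m)) - (real r - 1) + 4 * real r * z powr (1 / (2 * real r)))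
          + (real r - 1) * (ln (real m) + 1)"
          unfolding V_def z_def
          by (rule ln_matchings_le[OF U _ lin r _ _ _ False]) (use unif deg Dp m in auto)
        also have "V * real D / (real r * real m) = real D / g" using q r0 g0 by (simp add: Vq mg)
        also have "ln (real D / g) = ln (real D) - ln g" using Dp g0 by (intro ln_divide_pos) auto
        also have "real m * (ln (real D) - ln g - (real r - 1) + 4 * real r * z powr (1 / (2 * real r)))
            = q * (g * (ln (real D) - ln g - (real r - 1) + 4 * real r * z powr (1 / (2 * real r))))"
          unfolding mg by simp
        also have "\<dots> \<le> q * ((1 - \<gamma> * (1 - g)) * ln (real D) + 1 - real r + \<epsilon>)"
          using q by (intro mult_left_mono main[OF D g0 g(2) z0 zle]) auto
        also have "ln (real m) \<le> ln q"
        proof -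
          have "real m \<le> q" using g q mg by (metis mult_left_le mult.commute zero_le_one order_trans)
          then show ?thesis using m by (intro ln_mono) auto
        qed
        finally show ?thesis unfolding Qeq using r0 by (simp add: mult_left_mono)
      qed
      then have "exp (ln (real (card ?N))) \<le> exp ?Q" by (simp only: exp_le_cancel_iff)
      then show ?thesis by (simp only: exp_ln[OF cN])
    qed
    then show "real (card ?N)
      \<le> exp (real (card U) / real r * (ln (real D) + 1 - real r + \<epsilon>) + (real r - 1) * (ln (real (card U) / real r) + 1)
          - \<gamma> * ((real (card U) - real r * real m) / real r) * ln (real D))"
      unfolding V_def[symmetric] unc unfolding q_def .
  qed
qed

section \<open>The hypergraph of subsets\<close>

definition facets :: "nat \<Rightarrow> 'a set \<Rightarrow> 'a set set" where
  "facets k R = {S. S \<subseteq> R \<and> card S = k}"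

definition subsets_hg :: "nat \<Rightarrow> nat \<Rightarrow> nat set set set" where
  "subsets_hg n k = facets k ` {R. R \<subseteq> {1..n} \<and> card R = Suc k}"

lemma card_facets: "finite R \<Longrightarrow> card (facets k R) = card R choose k"
  unfolding facets_def by (rule n_subsets)

lemma finite_facets: "finite R \<Longrightarrow> finite (facets k R)"
  unfolding facets_def by simp

lemma facets_Int: "facets k R \<inter> facets k R' = facets k (R \<inter> R')"
  by (auto simp: facets_def)

lemma facets_disjoint_iff:
  assumes "finite R"
  shows "facets k R \<inter> facets k R' = {} \<longleftrightarrow> card (R \<inter> R') < k"
proof -
  have f: "finite (R \<inter> R')" using assms by simp
  have "facets k R \<inter> facets k R' = {} \<longleftrightarrow> card (facets k (R \<inter> R')) = 0"
    unfolding facets_Int using finite_facets[OF f] by simp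
  also have "\<dots> \<longleftrightarrow> card (R \<inter> R') < k" unfolding card_facets[OF f] by (simp add: binomial_eq_0_iff)
  finally show ?thesis .
qed

context
  fixes n k :: nat
  assumes k: "k \<ge> 1"
begin

abbreviation "rsets \<equiv> {R. R \<subseteq> {1..n} \<and> card R = Suc k}"

lemma rsets_fin: "R \<in> rsets \<Longrightarrow> finite R"
  by (rule finite_subset[of _ "{1..n}"]) auto

lemma card_facets_rset: "R \<in> rsets \<Longrightarrow> card (facets k R) = Suc k"
  using card_facets[OF rsets_fin, of R k] by simp

lemma facets_inter_le_1:
  assumes "R \<in> rsets" "R' \<in> rsets" "R \<noteq> R'"
  shows "card (facets k R \<inter> facets k R') \<le> 1"
proof -
  note f = rsets_fin[OF assms(1)] rsets_fin[OF assms(2)]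
  have "R \<inter> R' \<noteq> R"
  proof
    assume "R \<inter> R' = R"
    then have "R \<subseteq> R'" by auto
    then have "R = R'" by (rule card_subset_eq[OF f(2)]) (use assms in auto)
    then show False using assms(3) by simp
  qed
  then have "R \<inter> R' \<subset> R" by auto
  then have "card (R \<inter> R') < card R" by (rule psubset_card_mono[OF f(1)])
  then have c: "card (R \<inter> R') \<le> k" using assms by simp
  have "card (R \<inter> R') choose k \<le> 1"
  proof (cases "card (R \<inter> R') = k")
    case False
    then have "card (R \<inter> R') choose k = 0" using c by (intro binomial_eq_0) simp
    then show ?thesis by linarith
  qed simp
  then show ?thesis unfolding facets_Int using card_facets[of "R \<inter> R'" k] f by simp
qed

lemma inj_on_facets: "inj_on (facets k) rsets"
proof (rule inj_onI, rule ccontr)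
  fix R R' assume R: "R \<in> rsets" "R' \<in> rsets" "facets k R = facets k R'" "R \<noteq> R'"
  have "card (facets k R \<inter> facets k R') \<le> 1" by (rule facets_inter_le_1[OF R(1,2,4)])
  then show False using card_facets_rset[OF R(1)] R(3) k by simp
qed

lemma linear_subsets_hg: "linear_hg (subsets_hg n k)"
  unfolding linear_hg_def subsets_hg_def
proof (intro ballI impI)
  fix e f assume "e \<in> facets k ` rsets" "f \<in> facets k ` rsets" "e \<noteq> f"
  then obtain R R' where R: "R \<in> rsets" "R' \<in> rsets" "e = facets k R" "f = facets k R'" by auto
  then have "R \<noteq> R'" using \<open>e \<noteq> f\<close> by auto
  then show "card (e \<inter> f) \<le> 1" using facets_inter_le_1[OF R(1,2)] R(3,4) by simp
qed

lemma subsets_hg_uniform: "f \<in> subsets_hg n k \<Longrightarrow> card f = Suc k"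
  using card_facets_rset by (auto simp: subsets_hg_def)

lemma subsets_hg_sub: "subsets_hg n k \<subseteq> Pow (facets k {1..n})"
  by (auto simp: subsets_hg_def facets_def)

lemma card_facets_ground: "card (facets k {1..n}) = n choose k"
  using card_facets[of "{1..n}" k] by simp

lemma degree_subsets_hg:
  assumes S: "S \<in> facets k {1..n}"
  shows "degree (subsets_hg n k) S = n - k"
proof -
  have fS: "finite S" "S \<subseteq> {1..n}" "card S = k" using S finite_subset[of S "{1..n}"] by (auto simp: facets_def)
  have "{f \<in> subsets_hg n k. S \<in> f} = facets k ` {R \<in> rsets. S \<subseteq> R}"
    using fS by (auto simp: subsets_hg_def facets_def)
  moreover have "inj_on (facets k) {R \<in> rsets. S \<subseteq> R}" using inj_on_facets by (rule inj_on_subset) auto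
  ultimately have "degree (subsets_hg n k) S = card {R \<in> rsets. S \<subseteq> R}" unfolding degree_def by (simp add: card_image)
  also have "{R \<in> rsets. S \<subseteq> R} = (\<lambda>y. insert y S) ` ({1..n} - S)"
  proof (rule equalityI; rule subsetI)
    fix R assume R: "R \<in> {R \<in> rsets. S \<subseteq> R}"
    then have "finite R" by (intro rsets_fin) simp
    then have "card (R - S) = 1" using R fS by (simp add: card_Diff_subset)
    then obtain y where y: "R - S = {y}" by (auto simp: card_1_singleton_iff)
    have "S \<subseteq> R" "R \<subseteq> {1..n}" using R by auto
    then have "R = insert y S" "y \<in> {1..n} - S" using y by blast+
    then show "R \<in> (\<lambda>y. insert y S) ` ({1..n} - S)" by auto
  qed (use fS in auto)
  also have "card ((\<lambda>y. insert y S) ` ({1..n} - S)) = card ({1..n} - S)"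
    by (rule card_image) (auto simp: inj_on_def)
  also have "\<dots> = n - k" using fS by (simp add: card_Diff_subset)
  finally show ?thesis .
qed

lemma card_separated_le:
  "card {G. G \<subseteq> rsets \<and> (\<forall>R\<in>G. \<forall>R'\<in>G. R \<noteq> R' \<longrightarrow> card (R \<inter> R') < k) \<and> card G = m}
    \<le> card {T \<in> matchings (subsets_hg n k). card T = m}"
proof (rule card_inj_on_le)
  let ?S = "{G. G \<subseteq> rsets \<and> (\<forall>R\<in>G. \<forall>R'\<in>G. R \<noteq> R' \<longrightarrow> card (R \<inter> R') < k) \<and> card G = m}"
  show "inj_on ((`) (facets k)) ?S"
    using inj_on_image_eq_iff[OF inj_on_facets] by (auto intro!: inj_onI)
  show "(`) (facets k) ` ?S \<subseteq> {T \<in> matchings (subsets_hg n k). card T = m}"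
  proof
    fix T assume "T \<in> (`) (facets k) ` ?S"
    then obtain G where G: "G \<in> ?S" and T: "T = facets k ` G" by auto
    have "card T = m" using G card_image[OF inj_on_subset[OF inj_on_facets], of G] by (simp add: T)
    moreover have "T \<subseteq> subsets_hg n k" using G by (auto simp: T subsets_hg_def)
    moreover have "e \<inter> f = {}" if ef: "e \<in> T" "f \<in> T" "e \<noteq> f" for e f
    proof -
      obtain R R' where R: "R \<in> G" "R' \<in> G" "e = facets k R" "f = facets k R'" using ef by (auto simp: T)
      then have "R \<noteq> R'" using ef by auto
      have sep: "\<forall>R\<in>G. \<forall>R'\<in>G. R \<noteq> R' \<longrightarrow> card (R \<inter> R') < k" and "G \<subseteq> rsets" using G by auto
      then have "finite R" using R(1) by (intro rsets_fin) (rule subsetD)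
      moreover have "card (R \<inter> R') < k" using sep R(1,2) \<open>R \<noteq> R'\<close> by blast
      ultimately show ?thesis unfolding R(3,4) using facets_disjoint_iff[of R k R'] by blast
    qed
    ultimately show "T \<in> {T \<in> matchings (subsets_hg n k). card T = m}" by (auto simp: matchings_def)
  qed
  show "finite {T \<in> matchings (subsets_hg n k). card T = m}"
    using finite_matchings[of "subsets_hg n k"] by (simp add: subsets_hg_def)
qed

lemma card_matchings_le_separated:
  "card (matchings (subsets_hg n k))
    \<le> card {G. G \<subseteq> rsets \<and> (\<forall>R\<in>G. \<forall>R'\<in>G. R \<noteq> R' \<longrightarrow> card (R \<inter> R') < k)}"
proof (rule card_inj_on_le)
  let ?f = "\<lambda>T. {R \<in> rsets. facets k R \<in> T}"
  show "inj_on ?f (matchings (subsets_hg n k))"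
  proof (rule inj_onI)
    fix T T' assume T: "T \<in> matchings (subsets_hg n k)" "T' \<in> matchings (subsets_hg n k)" "?f T = ?f T'"
    have im: "X = facets k ` ?f X" if "X \<in> matchings (subsets_hg n k)" for X
      using that by (auto simp: matchings_def subsets_hg_def)
    show "T = T'" using im[OF T(1)] im[OF T(2)] T(3) by simp
  qed
  show "?f ` matchings (subsets_hg n k) \<subseteq> {G. G \<subseteq> rsets \<and> (\<forall>R\<in>G. \<forall>R'\<in>G. R \<noteq> R' \<longrightarrow> card (R \<inter> R') < k)}"
  proof (intro image_subsetI CollectI conjI ballI impI)
    fix T R R' assume T: "T \<in> matchings (subsets_hg n k)" and R: "R \<in> ?f T" "R' \<in> ?f T" "R \<noteq> R'"
    have "facets k R \<noteq> facets k R'" using inj_onD[OF inj_on_facets] R by blast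
    moreover have "facets k R \<in> T" "facets k R' \<in> T" "finite R" using R rsets_fin by blast+
    ultimately show "card (R \<inter> R') < k"
      using T facets_disjoint_iff[of R k R'] unfolding matchings_def by blast
  qed auto
  show "finite {G. G \<subseteq> rsets \<and> (\<forall>R\<in>G. \<forall>R'\<in>G. R \<noteq> R' \<longrightarrow> card (R \<inter> R') < k)}"
    by (rule finite_subset[of _ "Pow rsets"]) auto
qed

end

section \<open>Counting packings by block weights\<close>

lemma packing_sum_le:
  assumes P: "P \<in> packings n (Suc k)"
  shows "(\<Sum>U\<in>P. card U choose k) \<le> n choose k"
proof -
  have sub: "P \<subseteq> Pow {1..n}" using P by (simp add: packings_def)
  have fU: "finite U" if "U \<in> P" for U by (rule finite_subset[of _ "{1..n}"]) (use sub that in auto)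
  have fP: "finite P" by (rule finite_subset[OF sub]) simp
  have "(\<Sum>U\<in>P. card U choose k) = (\<Sum>U\<in>P. card (facets k U))"
    by (rule sum.cong[OF refl]) (simp add: card_facets[OF fU])
  also have "\<dots> = card (\<Union>U\<in>P. facets k U)"
  proof (rule card_UN_disjoint[symmetric, OF fP])
    show "\<forall>U\<in>P. finite (facets k U)" using finite_facets fU by auto
    show "\<forall>U\<in>P. \<forall>U'\<in>P. U \<noteq> U' \<longrightarrow> facets k U \<inter> facets k U' = {}"
      using facets_disjoint_iff[OF fU] P by (auto simp: packings_def)
  qed
  also have "\<dots> \<le> card (facets k {1..n})"
    by (rule card_mono) (use sub finite_facets[of "{1..n}"] in \<open>auto simp: facets_def\<close>)
  also have "\<dots> = n choose k" using card_facets[of "{1..n}" k] by simp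
  finally show ?thesis .
qed

text \<open>Expanding the product of the \<open>1 + w x\<close> sums over all subsets at once. Once
  the constraints on a family have been turned into weights, they can be given up.\<close>

lemma sum_prod_Pow_le_exp:
  fixes w :: "'a \<Rightarrow> real"
  assumes "finite X" "\<And>x. x \<in> X \<Longrightarrow> w x \<ge> 0"
  shows "(\<Sum>B\<in>Pow X. \<Prod>x\<in>B. w x) \<le> exp (\<Sum>x\<in>X. w x)"
proof -
  have "(\<Sum>B\<in>Pow X. \<Prod>x\<in>B. w x) = (\<Prod>x\<in>X. w x + 1)"
    using prod_add[OF assms(1), of w "\<lambda>_. 1"] by simp
  also have "\<dots> \<le> (\<Prod>x\<in>X. exp (w x))"
    using exp_ge_add_one_self assms(2) by (intro prod_mono) (auto simp: add.commute add_nonneg_nonneg)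
  also have "\<dots> = exp (\<Sum>x\<in>X. w x)" using assms(1) by (simp add: exp_sum)
  finally show ?thesis .
qed

lemma sum_power_from_le:
  fixes x :: real
  assumes "0 \<le> x" "x \<le> 1 / 2"
  shows "(\<Sum>j\<in>{a..<a + m}. x ^ j) \<le> 2 * x ^ a"
proof (induction m arbitrary: a)
  case (Suc m)
  have "(\<Sum>j\<in>{a..<a + Suc m}. x ^ j) = x ^ a + (\<Sum>j\<in>{Suc a..<Suc a + m}. x ^ j)"
    by (simp add: sum.atLeast_Suc_lessThan)
  also have "\<dots> \<le> x ^ a + 2 * x ^ Suc a" using Suc by (intro add_left_mono)
  also have "\<dots> \<le> 2 * x ^ a" using assms mult_right_mono[of x "1/2" "x ^ a"] by simp
  finally show ?case .
qed (use assms in simp)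

text \<open>A set of size \<open>k + j\<close> extends a \<open>k\<close>-set by \<open>j\<close>
  elements, so there are at most \<open>(n choose k) * (n - k) ^ j\<close> of them. Weights that
  outdo \<open>(n - k) ^ j\<close> by \<open>x ^ j\<close> give a geometric series starting at
  \<open>j = a\<close>.\<close>

lemma sum_weights_le:
  fixes \<omega> :: "nat \<Rightarrow> real"
  assumes kn: "k \<le> n" and x: "0 \<le> x" "x \<le> 1 / 2"
    and \<omega>: "\<And>j. j \<ge> a \<Longrightarrow> k + j \<le> n \<Longrightarrow> \<omega> (k + j) \<ge> 0 \<and> real (n - k) ^ j * \<omega> (k + j) \<le> x ^ j"
  shows "(\<Sum>U\<in>{U. U \<subseteq> {1..n} \<and> k + a \<le> card U}. \<omega> (card U)) \<le> real (n choose k) * (2 * x ^ a)"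
proof -
  have X: "{U. U \<subseteq> {1..n} \<and> k + a \<le> card U} = (\<Union>u\<in>{k + a..n}. {U. U \<subseteq> {1..n} \<and> card U = u})" (is "?X = _")
  proof (rule equalityI; rule subsetI)
    fix U assume U: "U \<in> ?X"
    then have "card U \<le> card {1..n}" by (intro card_mono) auto
    then show "U \<in> (\<Union>u\<in>{k + a..n}. {U. U \<subseteq> {1..n} \<and> card U = u})" using U by auto
  qed auto
  have "(\<Sum>U\<in>?X. \<omega> (card U)) = (\<Sum>u\<in>{k + a..n}. \<Sum>U\<in>{U. U \<subseteq> {1..n} \<and> card U = u}. \<omega> (card U))"
    unfolding X by (rule sum.UNION_disjoint) auto
  also have "\<dots> = (\<Sum>u\<in>{k + a..n}. real (n choose u) * \<omega> u)"
    by (rule sum.cong[OF refl]) (use n_subsets[of "{1..n}"] in simp)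
  also have "\<dots> \<le> (\<Sum>u\<in>{k + a..n}. real (n choose k) * x ^ (u - k))"
  proof (rule sum_mono)
    fix u assume u: "u \<in> {k + a..n}"
    define j where "j = u - k"
    have uj: "u = k + j" "j \<ge> a" "j \<le> n - k" using u by (auto simp: j_def)
    have "(n choose u) * 1 \<le> (n choose u) * (u choose k)" using uj by (intro mult_le_mono2) (simp add: Suc_le_eq)
    also have "\<dots> = (n choose k) * ((n - k) choose j)" using choose_mult[of k u n] u by (simp add: j_def)
    also have "\<dots> \<le> (n choose k) * (n - k) ^ j" by (intro mult_le_mono2 binomial_le_pow[OF uj(3)])
    finally have "real (n choose u) \<le> real (n choose k) * real (n - k) ^ j"
      by (metis mult.right_neutral of_nat_le_iff of_nat_mult of_nat_power)
    then have "real (n choose u) * \<omega> u \<le> real (n choose k) * real (n - k) ^ j * \<omega> u"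
      using \<omega>[of j] uj u by (intro mult_right_mono) auto
    also have "\<dots> = real (n choose k) * (real (n - k) ^ j * \<omega> (k + j))" by (simp add: uj(1))
    also have "\<dots> \<le> real (n choose k) * x ^ j" using \<omega>[of j] uj u by (intro mult_left_mono) auto
    finally show "real (n choose u) * \<omega> u \<le> real (n choose k) * x ^ (u - k)" by (simp add: j_def)
  qed
  also have "\<dots> = real (n choose k) * (\<Sum>u\<in>{k + a..n}. x ^ (u - k))" by (simp add: sum_distrib_left)
  also have "(\<Sum>u\<in>{k + a..n}. x ^ (u - k)) = (\<Sum>j\<in>{a..<a + (Suc n - (k + a))}. x ^ j)"
    by (rule sum.reindex_bij_witness[of _ "\<lambda>j. k + j" "\<lambda>u. u - k"]) auto
  also have "\<dots> \<le> 2 * x ^ a" by (rule sum_power_from_le[OF x])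
  finally show ?thesis by (simp add: mult_left_mono)
qed

lemma binomial_ge_linear: "k \<ge> 1 \<Longrightarrow> j \<le> (k + j) choose k"
proof (induction j)
  case (Suc j)
  obtain i where i: "k = Suc i" using Suc.prems by (cases k) auto
  have "(k + Suc j) choose k = ((k + j) choose i) + ((k + j) choose k)" by (simp add: i)
  moreover have "(k + j) choose i \<ge> 1" by (simp add: i Suc_le_eq)
  ultimately show ?case using Suc by simp
qed simp

text \<open>The blocks of a packing share no \<open>k\<close>-subset, so charging
  \<open>2 * ln n\<close> per \<open>k\<close>-subset costs at most
  \<open>2 * ln n * (n choose k)\<close> in total. Half of the charge pays for choosing the elements
  that a block has beyond \<open>k\<close>, the other half makes the series geometric with ratio
  \<open>1 / n\<close>.\<close>

lemma card_packings_crude: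
  assumes k: "k \<ge> 1" "k \<le> n" and n: "n \<ge> 2"
  shows "real (card (packings n (Suc k))) \<le> exp (real (n choose k) * (2 * ln (real n) + 1))"
proof -
  define \<omega> where "\<omega> u = exp (- 2 * ln (real n) * real (u choose k))" for u
  let ?X = "{U. U \<subseteq> {1..n} \<and> k + 1 \<le> card U}"
  have ln0: "ln (real n) \<ge> 0" using n by simp
  have "real (card (packings n (Suc k))) = (\<Sum>P\<in>packings n (Suc k). 1)" by simp
  also have "\<dots> \<le> (\<Sum>P\<in>packings n (Suc k). exp (2 * ln (real n) * real (n choose k)) * (\<Prod>U\<in>P. \<omega> (card U)))"
  proof (rule sum_mono)
    fix P assume P: "P \<in> packings n (Suc k)"
    have fP: "finite P" by (rule finite_subset[of _ "Pow {1..n}"]) (use P in \<open>auto simp: packings_def\<close>)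
    have "(\<Prod>U\<in>P. \<omega> (card U)) = exp (- 2 * ln (real n) * real (\<Sum>U\<in>P. card U choose k))"
      by (simp only: \<omega>_def exp_sum[OF fP, symmetric] sum_distrib_left[symmetric] of_nat_sum)
    moreover have "2 * ln (real n) * real (\<Sum>U\<in>P. card U choose k) \<le> 2 * ln (real n) * real (n choose k)"
      using packing_sum_le[OF P] ln0 by (intro mult_left_mono) (simp_all del: of_nat_sum)
    ultimately show "1 \<le> exp (2 * ln (real n) * real (n choose k)) * (\<Prod>U\<in>P. \<omega> (card U))"
      by (simp add: exp_add[symmetric])
  qed
  also have "\<dots> = exp (2 * ln (real n) * real (n choose k)) * (\<Sum>P\<in>packings n (Suc k). \<Prod>U\<in>P. \<omega> (card U))"
    by (simp only: sum_distrib_left)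
  also have "(\<Sum>P\<in>packings n (Suc k). \<Prod>U\<in>P. \<omega> (card U)) \<le> (\<Sum>P\<in>Pow ?X. \<Prod>U\<in>P. \<omega> (card U))"
    by (rule sum_mono2) (auto simp: packings_def \<omega>_def intro!: prod_nonneg)
  also have "\<dots> \<le> exp (\<Sum>U\<in>?X. \<omega> (card U))" by (rule sum_prod_Pow_le_exp) (auto simp: \<omega>_def)
  also have "(\<Sum>U\<in>?X. \<omega> (card U)) \<le> real (n choose k) * (2 * (1 / real n) ^ 1)"
  proof (rule sum_weights_le[OF k(2)])
    show "1 / real n \<le> 1 / 2" using n by simp
    fix j :: nat assume j: "1 \<le> j" "k + j \<le> n"
    have "\<omega> (k + j) \<le> exp (- 2 * ln (real n) * real j)"
      using binomial_ge_linear[OF k(1), of j] ln0 by (simp add: \<omega>_def mult_left_mono)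
    also have "\<dots> = (1 / real n) ^ j * (1 / real n) ^ j"
    proof -
      have "exp (- 2 * ln (real n) * real j) = exp (- ln (real n)) ^ j * exp (- ln (real n)) ^ j"
        by (simp add: exp_of_nat_mult[symmetric] mult_exp_exp)
      also have "exp (- ln (real n)) = 1 / real n" using n by (simp add: exp_minus inverse_eq_divide)
      finally show ?thesis .
    qed
    finally have "real (n - k) ^ j * \<omega> (k + j) \<le> real n ^ j * ((1 / real n) ^ j * (1 / real n) ^ j)"
      by (intro mult_mono power_mono) (auto simp: \<omega>_def)
    also have "\<dots> = (1 / real n) ^ j" using n by (simp add: power_divide)
    finally show "\<omega> (k + j) \<ge> 0 \<and> real (n - k) ^ j * \<omega> (k + j) \<le> (1 / real n) ^ j" by (simp add: \<omega>_def)
  qed simp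
  also have "\<dots> \<le> real (n choose k) * 1" using n by (intro mult_left_mono) auto
  finally have "real (card (packings n (Suc k))) \<le> exp (2 * ln (real n) * real (n choose k)) * exp (real (n choose k) * 1)"
    by (simp add: mult_left_mono)
  then show ?thesis by (simp add: exp_add[symmetric] algebra_simps)
qed

text \<open>For the truncations of rank one below the target, this exponent is smaller than the
  number of vertices of the hypergraph by a factor of order \<open>(ln n) / n\<close>, so no sharper
  bound is needed for the lower ranks.\<close>

lemma num_matroids_crude:
  assumes n: "n \<ge> 2" "n \<ge> k" and k: "k \<ge> 1"
  shows "real (num_matroids n (Suc k)) \<le> exp (real (Suc k) * real n ^ k * (2 * ln (real n) + 1))"
  using k n(2)
proof (induction k rule: nat_induct_at_least)
  case base
  have l: "2 * ln (real n) + 1 \<ge> 1" using n by simp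
  define L where "L = 2 * ln (real n) + 1"
  have "real (num_matroids n (Suc 1)) \<le> real (num_matroids n 1) * real (card (packings n (Suc 1)))"
    using num_matroids_Suc_le[of 1 n] unfolding of_nat_mult[symmetric] of_nat_le_iff by simp
  also have "\<dots> \<le> exp (real n * L) * exp (real (n choose 1) * L)"
  proof (rule mult_mono)
    have "real (num_matroids n 1) \<le> real (2 ^ n)" using num_matroids_1_le[of n] unfolding of_nat_le_iff .
    also have "\<dots> = 2 ^ n" by simp
    also have "(2::real) ^ n \<le> exp 1 ^ n" using exp_ge_add_one_self[of 1] by (intro power_mono) auto
    also have "exp 1 ^ n = exp (real n * 1)" by (simp add: exp_of_nat_mult[symmetric])
    also have "\<dots> \<le> exp (real n * L)" unfolding exp_le_cancel_iff using l by (intro mult_left_mono) (auto simp: L_def)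
    finally show "real (num_matroids n 1) \<le> exp (real n * L)" .
    show "real (card (packings n (Suc 1))) \<le> exp (real (n choose 1) * L)"
      unfolding L_def by (rule card_packings_crude) (use n in auto)
  qed auto
  also have "\<dots> = exp (real (Suc 1) * real n ^ 1 * L)" by (simp add: exp_add[symmetric] algebra_simps)
  finally show ?case by (simp only: L_def)
next
  case (Suc k)
  have l: "2 * ln (real n) + 1 \<ge> 0" using n by (simp add: add_nonneg_nonneg)
  have "real (num_matroids n (Suc (Suc k))) \<le> real (num_matroids n (Suc k)) * real (card (packings n (Suc (Suc k))))"
    using num_matroids_Suc_le[of "Suc k" n] by (metis of_nat_le_iff of_nat_mult le_add1 plus_1_eq_Suc)
  also have "\<dots> \<le> exp (real (Suc k) * real n ^ k * (2 * ln (real n) + 1)) * exp (real (n choose Suc k) * (2 * ln (real n) + 1))"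
    using Suc card_packings_crude[of "Suc k" n] n by (intro mult_mono) auto
  also have "\<dots> = exp ((real (Suc k) * real n ^ k + real (n choose Suc k)) * (2 * ln (real n) + 1))"
    by (simp only: exp_add[symmetric] distrib_right)
  also have "\<dots> \<le> exp ((real (Suc (Suc k)) * real n ^ Suc k) * (2 * ln (real n) + 1))"
  proof -
    have "real n ^ k \<le> real n ^ Suc k" using n by (intro power_increasing) auto
    then have "real (Suc k) * real n ^ k \<le> real (Suc k) * real n ^ Suc k" by (intro mult_left_mono) auto
    moreover have "real (n choose Suc k) \<le> real n ^ Suc k"
      using binomial_le_pow[of "Suc k" n] Suc.prems by (metis of_nat_le_iff of_nat_power)
    moreover have "real (Suc (Suc k)) * real n ^ Suc k = real (Suc k) * real n ^ Suc k + real n ^ Suc k"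
      by (simp add: algebra_simps)
    ultimately have "real (Suc k) * real n ^ k + real (n choose Suc k) \<le> real (Suc (Suc k)) * real n ^ Suc k" by linarith
    then show ?thesis using l by (simp only: exp_le_cancel_iff) (rule mult_right_mono)
  qed
  finally show ?case .
qed

text \<open>This is where rank at least four is needed: for \<open>k = j = 2\<close> the factor 5 drops to 4, so in rank
  three the blocks with one additional element contribute to the leading order.\<close>

lemma large_block_cost:
  assumes k: "k \<ge> 3" and j: "j \<ge> 2"
  shows "5 * j * Suc k \<le> 4 * ((k + j) choose k)"
  using j
proof (induction j rule: nat_induct_at_least)
  case base
  have "2 * ((k + 2) choose k) = (k + 2) * (k + 1)"
  proof -
    have "(k + 2) choose k = (k + 2) choose 2" using binomial_symmetric[of k "k + 2"] by simp
    moreover have "2 * ((k + 2) choose 2) = (k + 2) * (k + 1)" by (simp add: choose_two)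
    ultimately show ?thesis by simp
  qed
  then have "4 * ((k + 2) choose k) = 2 * ((k + 2) * (k + 1))" by simp
  \<comment> \<open>Equality holds for \<open>k = 3\<close>, so \<open>5 / 4\<close> is the best
    factor available in rank four.\<close>
  moreover have "10 * (k + 1) \<le> 2 * (k + 2) * (k + 1)" using k by (intro mult_right_mono) auto
  ultimately show ?case by simp
next
  case (Suc j)
  have e: "Suc j * ((k + Suc j) choose k) = (k + Suc j) * ((k + j) choose k)"
  proof -
    have "(k + Suc j) choose k = Suc (k + j) choose Suc j" using binomial_symmetric[of k "k + Suc j"] by simp
    moreover have "(k + j) choose k = (k + j) choose j" using binomial_symmetric[of k "k + j"] by simp
    moreover have "Suc j * (Suc (k + j) choose Suc j) = Suc (k + j) * ((k + j) choose j)"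
      by (rule Suc_times_binomial)
    ultimately show ?thesis by simp
  qed
  \<comment> \<open>From \<open>j\<close> to \<open>j + 1\<close> the binomial grows by the factor
    \<open>(k + j + 1) / (j + 1)\<close>, which is thus at least \<open>(j + 1) / j\<close>, the
    growth of the left side.\<close>
  have "Suc j * Suc j \<le> j * (k + Suc j)"
  proof -
    have "j * 3 \<le> j * k" using k by (rule mult_le_mono2)
    then have "Suc j \<le> j * k" using Suc.hyps by linarith
    then show ?thesis by (simp add: algebra_simps)
  qed
  then have "5 * Suc k * (Suc j * Suc j) \<le> 5 * Suc k * (j * (k + Suc j))" by (rule mult_le_mono2)
  also have "\<dots> = (k + Suc j) * (5 * j * Suc k)" by (simp only: mult_ac)
  also have "\<dots> \<le> (k + Suc j) * (4 * ((k + j) choose k))" using Suc.IH by (rule mult_le_mono2)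
  also have "\<dots> = 4 * (Suc j * ((k + Suc j) choose k))" unfolding e by simp
  finally have "Suc j * (5 * Suc j * Suc k) \<le> Suc j * (4 * ((k + Suc j) choose k))" by (simp only: mult_ac)
  then show ?case by (simp only: mult_le_cancel1)
qed

section \<open>The number of matroids\<close>

text \<open>A packing splits into its set \<open>B\<close> of blocks with more than
  \<open>k + 1\<close> elements and a matching. Every \<open>k\<close>-subset used by
  \<open>B\<close> is uncovered by the matching and lowers the bound for the number of matchings by
  the factor \<open>exp (- c)\<close>. Each block of \<open>B\<close> thus carries its own weight,
  and \<open>B\<close> may range over all families of large sets.\<close>

lemma card_packings_le:
  fixes \<epsilon> :: real
  assumes k: "k \<ge> 3" and \<epsilon>: "\<epsilon> > 0"
  shows "\<exists>D0. \<forall>n. n \<ge> k \<longrightarrow> D0 \<le> real (n - k) \<longrightarrow> real (card (packings n (Suc k)))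
    \<le> (real (n choose k) + 1) * exp (real (n choose k) / real (Suc k) * (ln (real (n - k)) + 1 - real (Suc k) + \<epsilon>)
         + real k * (ln (real (n choose k) / real (Suc k)) + 1))
       * exp (real (n choose k) * (2 * real (n - k) powr (- (1 / 4))))"
proof -
  obtain D1 where D1: "\<And>D (U :: nat set set) E m. D1 \<le> real D \<Longrightarrow> finite U \<Longrightarrow> E \<subseteq> Pow U \<Longrightarrow> \<forall>f\<in>E. card f = Suc k \<Longrightarrow>
     linear_hg E \<Longrightarrow> \<forall>v\<in>U. degree E v \<le> D \<Longrightarrow> Suc k \<le> card U \<Longrightarrow> Suc k * m \<le> card U \<Longrightarrow>
     real (card {T \<in> matchings E. card T = m})
      \<le> exp (real (card U) / real (Suc k) * (ln (real D) + 1 - real (Suc k) + \<epsilon>)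
          + (real (Suc k) - 1) * (ln (real (card U) / real (Suc k)) + 1)
          - 9 / 10 * ((real (card U) - real (Suc k) * real m) / real (Suc k)) * ln (real D))"
  proof -
    \<comment> \<open>\<open>9 / 10\<close> is a value of \<open>\<gamma>\<close> below
      \<open>1\<close> whose product with the factor \<open>5 / 4\<close> from
      \<open>large_block_cost\<close> still exceeds \<open>1\<close>.\<close>
    have "Suc k \<ge> 1" "(0::real) \<le> 9 / 10" "9 / 10 < (1::real)" by auto
    from matchings_le_exp[OF this \<epsilon>, where 'v = "nat set"] that show ?thesis by blast
  qed
  show ?thesis
  \<comment> \<open>\<open>256 = 2 ^ 8\<close> brings the ratio \<open>D powr (- (1 / 8))\<close> of
    the geometric series down to at most \<open>1 / 2\<close>.\<close>
  proof (intro exI[of _ "max D1 (max (real (Suc k)) 256)"] allI impI)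
    fix n assume n: "k \<le> n" and "max D1 (max (real (Suc k)) 256) \<le> real (n - k)"
    define D where "D = n - k"
    have D: "D1 \<le> real D" "real (Suc k) \<le> real D" "256 \<le> real D"
      using \<open>max D1 (max (real (Suc k)) 256) \<le> real (n - k)\<close> by (auto simp: D_def)
    define V where "V = n choose k"
    define Q where "Q = real V / real (Suc k) * (ln (real D) + 1 - real (Suc k) + \<epsilon>)
         + real k * (ln (real V / real (Suc k)) + 1)"
    define c where "c = 9 / 10 * ln (real D) / real (Suc k)"
    define w where "w u = exp (- c * real (u choose k))" for u
    define X where "X = {U. U \<subseteq> {1..n} \<and> k + 2 \<le> card U}"
    define cov where "cov B = (\<Sum>U\<in>B. card U choose k)" for B :: "nat set set"
    define M where "M B = {m. m \<le> V \<and> Suc k * m + cov B \<le> V}" for B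
    define G where "G m = {G. G \<subseteq> {R. R \<subseteq> {1..n} \<and> card R = Suc k} \<and>
        (\<forall>R\<in>G. \<forall>R'\<in>G. R \<noteq> R' \<longrightarrow> card (R \<inter> R') < k) \<and> card G = m}" for m
    have k1: "k \<ge> 1" using k by simp
    have lnD: "ln (real D) \<ge> 0" using D by simp
    have c0: "c \<ge> 0" using lnD by (simp add: c_def)
    have DV: "D \<le> V" using binomial_ge_linear[OF k1, of D] n by (simp add: D_def V_def)
    have finG: "finite (G m)" for m
      by (rule finite_subset[of _ "Pow (Pow {1..n})"]) (auto simp: G_def)
    have finX: "finite X" by (simp add: X_def)
    have finM: "finite (M B)" for B by (simp add: M_def)
    have cG: "real (card (G m)) \<le> exp Q * (\<Prod>U\<in>B. w (card U))" if B: "B \<in> Pow X" and m: "m \<in> M B" for B m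
    proof -
      have fB: "finite B" using B finX finite_subset by blast
      have rm: "Suc k * m + cov B \<le> V" using m by (simp add: M_def)
      have "real (card (G m)) \<le> real (card {T \<in> matchings (subsets_hg n k). card T = m})"
        using card_separated_le[OF k1, of n m] by (simp add: G_def)
      also have "\<dots> \<le> exp (real (card (facets k {1..n})) / real (Suc k) * (ln (real D) + 1 - real (Suc k) + \<epsilon>)
          + (real (Suc k) - 1) * (ln (real (card (facets k {1..n})) / real (Suc k)) + 1)
          - 9 / 10 * ((real (card (facets k {1..n})) - real (Suc k) * real m) / real (Suc k)) * ln (real D))"
      proof (rule D1[OF D(1)])
        show "finite (facets k {1..n})" by (rule finite_facets) simp
        show "subsets_hg n k \<subseteq> Pow (facets k {1..n})" by (rule subsets_hg_sub[OF k1])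
        show "\<forall>f\<in>subsets_hg n k. card f = Suc k" using subsets_hg_uniform[OF k1] by blast
        show "linear_hg (subsets_hg n k)" by (rule linear_subsets_hg[OF k1])
        show "\<forall>v\<in>facets k {1..n}. degree (subsets_hg n k) v \<le> D" using degree_subsets_hg[OF k1] by (simp add: D_def)
        have "Suc k \<le> D" using D(2) by linarith
        then show "Suc k \<le> card (facets k {1..n})" using DV unfolding card_facets_ground[OF k1] V_def by linarith
        show "Suc k * m \<le> card (facets k {1..n})" using rm unfolding card_facets_ground[OF k1] V_def by linarith
      qed
      also have "\<dots> = exp (Q - c * (real V - real (Suc k) * real m))"
        unfolding card_facets_ground[OF k1] V_def[symmetric] Q_def c_def by (simp del: of_nat_Suc) (simp add: field_simps)
      also have "\<dots> \<le> exp (Q - c * real (cov B))"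
      proof -
        have "real (Suc k * m + cov B) \<le> real V" using rm by (simp only: of_nat_le_iff)
        then have "real (cov B) \<le> real V - real (Suc k) * real m" by (simp only: of_nat_add of_nat_mult)
        then show ?thesis using c0 by (simp add: mult_left_mono del: of_nat_Suc)
      qed
      also have "\<dots> = exp Q * exp (\<Sum>U\<in>B. - c * real (card U choose k))"
        unfolding cov_def by (simp add: exp_diff exp_minus sum_negf sum_distrib_left field_simps)
      also have "exp (\<Sum>U\<in>B. - c * real (card U choose k)) = (\<Prod>U\<in>B. w (card U))"
        using fB by (simp only: w_def exp_sum)
      finally show ?thesis .
    qed
    let ?f = "\<lambda>P. ({U \<in> P. k + 2 \<le> card U}, {U \<in> P. card U = Suc k})"
    have "card (packings n (Suc k)) \<le> card (Sigma (Pow X) (\<lambda>B. \<Union>m\<in>M B. G m))"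
    proof (rule card_inj_on_le)
      have un: "P = {U \<in> P. k + 2 \<le> card U} \<union> {U \<in> P. card U = Suc k}" if "P \<in> packings n (Suc k)" for P
      proof -
        have "k + 2 \<le> card U \<or> card U = Suc k" if "U \<in> P" for U
        proof -
          have "Suc k \<le> card U" using \<open>P \<in> packings n (Suc k)\<close> that by (auto simp: packings_def)
          then show ?thesis by linarith
        qed
        then show ?thesis by blast
      qed
      show "inj_on ?f (packings n (Suc k))"
      proof (rule inj_onI)
        fix P P' assume P: "P \<in> packings n (Suc k)" "P' \<in> packings n (Suc k)" "?f P = ?f P'"
        show "P = P'" using un[OF P(1)] un[OF P(2)] P(3) by simp
      qed
      show "?f ` packings n (Suc k) \<subseteq> Sigma (Pow X) (\<lambda>B. \<Union>m\<in>M B. G m)"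
      proof (rule image_subsetI)
        fix P assume P: "P \<in> packings n (Suc k)"
        let ?B = "{U \<in> P. k + 2 \<le> card U}" and ?G = "{U \<in> P. card U = Suc k}"
        have fP: "finite P" by (rule finite_subset[of _ "Pow {1..n}"]) (use P in \<open>auto simp: packings_def\<close>)
        have B: "?B \<in> Pow X" using P by (auto simp: packings_def X_def)
        have G: "?G \<in> G (card ?G)" using P by (auto simp: packings_def G_def)
        have "cov P = cov ?B + cov ?G"
          unfolding cov_def by (subst un[OF P], rule sum.union_disjoint) (use fP in auto)
        moreover have "cov ?G = Suc k * card ?G"
          unfolding cov_def by simp
        moreover have "cov P \<le> V" using packing_sum_le[OF P] by (simp add: cov_def V_def)
        ultimately have "Suc k * card ?G + cov ?B \<le> V" by linarith
        moreover have "card ?G \<le> Suc k * card ?G" by simp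
        ultimately have "card ?G \<in> M ?B" unfolding M_def by (intro CollectI conjI) linarith+
        then show "?f P \<in> Sigma (Pow X) (\<lambda>B. \<Union>m\<in>M B. G m)" using B G by blast
      qed
      show "finite (Sigma (Pow X) (\<lambda>B. \<Union>m\<in>M B. G m))" using finX finM finG by blast
    qed
    also have "\<dots> = (\<Sum>B\<in>Pow X. card (\<Union>m\<in>M B. G m))"
      by (rule card_SigmaI) (use finX finM finG in auto)
    also have "\<dots> \<le> (\<Sum>B\<in>Pow X. \<Sum>m\<in>M B. card (G m))"
      by (intro sum_mono card_UN_le finM)
    finally have "real (card (packings n (Suc k))) \<le> real (\<Sum>B\<in>Pow X. \<Sum>m\<in>M B. card (G m))"
      by (simp only: of_nat_le_iff)
    also have "\<dots> = (\<Sum>B\<in>Pow X. \<Sum>m\<in>M B. real (card (G m)))" by simp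
    also have "\<dots> \<le> (\<Sum>B\<in>Pow X. \<Sum>m\<in>M B. exp Q * (\<Prod>U\<in>B. w (card U)))"
      by (intro sum_mono cG)
    also have "\<dots> \<le> (\<Sum>B\<in>Pow X. (real V + 1) * (exp Q * (\<Prod>U\<in>B. w (card U))))"
    proof (rule sum_mono)
      fix B
      have "card (M B) \<le> card {..V}" by (rule card_mono) (auto simp: M_def)
      then have "real (card (M B)) \<le> real V + 1" by simp
      moreover have "(\<Prod>U\<in>B. w (card U)) \<ge> 0" by (intro prod_nonneg) (simp add: w_def)
      ultimately show "(\<Sum>m\<in>M B. exp Q * (\<Prod>U\<in>B. w (card U))) \<le> (real V + 1) * (exp Q * (\<Prod>U\<in>B. w (card U)))"
        unfolding sum_constant by (intro mult_right_mono) auto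
    qed
    also have "\<dots> = (real V + 1) * exp Q * (\<Sum>B\<in>Pow X. \<Prod>U\<in>B. w (card U))"
      by (simp only: sum_distrib_left[symmetric] mult.assoc)
    also have "(\<Sum>B\<in>Pow X. \<Prod>U\<in>B. w (card U)) \<le> exp (\<Sum>U\<in>X. w (card U))"
      by (rule sum_prod_Pow_le_exp[OF finX]) (simp add: w_def)
    also have "(\<Sum>U\<in>X. w (card U)) \<le> real V * (2 * (real D powr (- (1 / 8))) ^ 2)"
      unfolding X_def V_def
    proof (rule sum_weights_le[OF n])
      show "0 \<le> real D powr (- (1 / 8))" by simp
      have "real D powr (- (1 / 8)) \<le> 256 powr (- (1 / 8))" using D(3) by (intro powr_mono2') auto
      also have "(256 :: real) powr (- (1 / 8)) = 1 / 2"
      proof -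
        have "(256 :: real) = 2 powr 8" by simp
        then have "(256 :: real) powr (- (1 / 8)) = 2 powr (-1)" by (simp only: powr_powr) simp
        then show ?thesis by (simp add: powr_minus)
      qed
      finally show "real D powr (- (1 / 8)) \<le> 1 / 2" .
      fix j :: nat assume j: "2 \<le> j" "k + j \<le> n"
      have Dp: "real D > 0" using D by linarith
      have "real (5 * j * Suc k) \<le> real (4 * ((k + j) choose k))"
        using large_block_cost[OF k j(1)] by (simp only: of_nat_le_iff)
      then have "5 * real j * real (Suc k) \<le> 4 * real ((k + j) choose k)"
        by (simp only: of_nat_mult of_nat_numeral)
      then have "5 / 4 * real j * real (Suc k) \<le> real ((k + j) choose k)" by linarith
      then have "5 / 4 * real j \<le> real ((k + j) choose k) / real (Suc k)"
        by (simp only: pos_le_divide_eq of_nat_0_less_iff zero_less_Suc)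
      then have "9 / 10 * ln (real D) * (5 / 4 * real j) \<le> 9 / 10 * ln (real D) * (real ((k + j) choose k) / real (Suc k))"
        using lnD by (intro mult_left_mono) auto
      moreover have "c * real ((k + j) choose k) = 9 / 10 * ln (real D) * (real ((k + j) choose k) / real (Suc k))"
        by (simp add: c_def)
      moreover have "9 / 10 * ln (real D) * (5 / 4 * real j) = 9 / 8 * ln (real D) * real j" by simp
      ultimately have "- c * real ((k + j) choose k) \<le> - (9 / 8 * ln (real D) * real j)" by linarith
      then have "w (k + j) \<le> exp (- (9 / 8 * ln (real D) * real j))" by (simp add: w_def)
      \<comment> \<open>Since \<open>9 / 10 * 5 / 4 = 9 / 8\<close>, the weight outdoes
        \<open>D ^ j\<close> by \<open>1 / 8\<close> in the exponent for each of the
        \<open>j\<close> elements beyond \<open>k\<close>; as \<open>j \<ge> 2\<close>, the series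
        has order \<open>D powr (- (1 / 4))\<close>.\<close>
      then have "real D ^ j * w (k + j) \<le> exp (real j * ln (real D)) * exp (- (9 / 8 * ln (real D) * real j))"
        using Dp by (intro mult_mono) (auto simp: exp_of_nat_mult w_def)
      also have "\<dots> = exp (real j * (- (1 / 8) * ln (real D)))" by (simp add: mult_exp_exp algebra_simps)
      also have "\<dots> = (real D powr (- (1 / 8))) ^ j" using Dp by (simp only: exp_of_nat_mult powr_def) simp
      finally show "w (k + j) \<ge> 0 \<and> real (n - k) ^ j * w (k + j) \<le> (real D powr (- (1 / 8))) ^ j"
        by (simp add: w_def D_def)
    qed
    also have "(real D powr (- (1 / 8))) ^ 2 = real D powr (- (1 / 4))"
      by (simp add: power2_eq_square powr_add[symmetric])
    finally have "real (card (packings n (Suc k))) \<le> (real V + 1) * exp Q * exp (real V * (2 * real D powr (- (1 / 4))))"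
      by (simp add: mult_left_mono)
    then show "real (card (packings n (Suc k)))
    \<le> (real (n choose k) + 1) * exp (real (n choose k) / real (Suc k) * (ln (real (n - k)) + 1 - real (Suc k) + \<epsilon>)
         + real k * (ln (real (n choose k) / real (Suc k)) + 1))
       * exp (real (n choose k) * (2 * real (n - k) powr (- (1 / 4))))"
      by (simp only: V_def D_def Q_def)
  qed
qed

lemma binomial_order:
  assumes "k \<ge> 1" "k \<le> n"
  defines "q \<equiv> real (n choose k) / real (Suc k)"
  shows "real n ^ (k - 1) \<le> q * (real (Suc k) * real k ^ k / real n)" and "real (n choose k) \<le> real n ^ k"
    and "real (n choose k) \<ge> 1"
proof -
  have n0: "real n > 0" and k0: "real k > 0" using assms by auto
  have "(real n / real k) ^ k \<le> real (n choose k)" by (rule binomial_ge_n_over_k_pow_k[OF assms(2)])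
  then have "real n ^ k \<le> real (n choose k) * real k ^ k" using k0 by (simp add: power_divide pos_divide_le_eq)
  moreover have "real n ^ k = real n * real n ^ (k - 1)" using assms by (cases k) auto
  ultimately have "real n ^ (k - 1) \<le> real (n choose k) * real k ^ k / real n"
    using n0 by (simp add: pos_le_divide_eq mult.commute)
  then show "real n ^ (k - 1) \<le> q * (real (Suc k) * real k ^ k / real n)" by (simp add: q_def del: of_nat_Suc)
  show "real (n choose k) \<le> real n ^ k"
    using binomial_le_pow[OF assms(2)] unfolding of_nat_power[symmetric] of_nat_le_iff .
  have "n choose k \<ge> 1" using assms by (simp add: Suc_le_eq)
  then show "real (n choose k) \<ge> 1" by linarith
qed

lemma num_matroids_pos:
  assumes "r \<ge> 1" "r < n"
  shows "num_matroids n r \<ge> 1"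
proof -
  let ?S = "{G. G \<subseteq> {R. R \<subseteq> {1..n} \<and> card R = r} \<and> (\<forall>R\<in>G. \<forall>R'\<in>G. R \<noteq> R' \<longrightarrow> card (R \<inter> R') < r - 1)}"
  have "finite ?S" by (rule finite_subset[of _ "Pow (Pow {1..n})"]) auto
  moreover have "{} \<in> ?S" by simp
  ultimately have "card ?S \<ge> 1" by (metis (no_types, lifting) One_nat_def Suc_leI card_gt_0_iff empty_iff)
  then show ?thesis using num_matroids_ge[OF assms] by linarith
qed

text \<open>The truncation, the number of matching sizes and the remainder of Stirling's formula
  contribute at most order \<open>n ^ (k - 1) * (ln n + 1)\<close> to the exponent. Relative to
  \<open>(n choose k) / Suc k\<close> this is \<open>(ln n + 1) / n\<close> up to the constant
  \<open>C\<close>.\<close>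

lemma ln_num_matroids_le:
  fixes \<epsilon> :: real
  assumes k: "k \<ge> 3" and \<epsilon>: "\<epsilon> > 0"
  shows "\<exists>C n0. \<forall>n\<ge>n0. ln (real (num_matroids n (Suc k)))
     \<le> real (n choose k) / real (Suc k) * (ln (real n - real k) + 1 - real (Suc k) + \<epsilon>
          + C * ((ln (real n) + 1) / real n) + 2 * real (Suc k) * (real n - real k) powr (- (1 / 4)))"
proof -
  obtain D0 where D0: "\<And>n. n \<ge> k \<Longrightarrow> D0 \<le> real (n - k) \<Longrightarrow> real (card (packings n (Suc k)))
    \<le> (real (n choose k) + 1) * exp (real (n choose k) / real (Suc k) * (ln (real (n - k)) + 1 - real (Suc k) + \<epsilon>)
         + real k * (ln (real (n choose k) / real (Suc k)) + 1))
       * exp (real (n choose k) * (2 * real (n - k) powr (- (1 / 4))))"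
    using card_packings_le[OF k \<epsilon>] by blast
  define C where "C = (3 * real k + real k * real k) * (real (Suc k) * real k ^ k)"
  show ?thesis
  proof (intro exI[of _ C] exI[of _ "k + 2 + nat \<lceil>D0\<rceil>"] allI impI)
    fix n assume n: "k + 2 + nat \<lceil>D0\<rceil> \<le> n"
    define V where "V = real (n choose k)"
    define q where "q = V / real (Suc k)"
    define l where "l = ln (real n)"
    define D where "D = real n - real k"
    have kn: "k \<le> n" "n \<ge> 2" "Suc k < n" using n k by auto
    have D: "real (n - k) = D" using kn by (simp add: D_def of_nat_diff)
    have "D0 \<le> real (nat \<lceil>D0\<rceil>)" by linarith
    also have "\<dots> \<le> real (n - k)" using n by simp
    finally have DD: "D0 \<le> real (n - k)" .
    have k1: "k \<ge> 1" using k by simp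
    note bo = binomial_order[OF k1 kn(1)]
    have V1: "V \<ge> 1" using bo(3) by (simp add: V_def)
    have q0: "q > 0" using V1 by (simp add: q_def)
    have l0: "l \<ge> 0" using kn by (simp add: l_def)
    have lV: "ln V \<le> real k * l"
    proof -
      have "ln V \<le> ln (real n ^ k)" using bo(2) V1 kn by (intro ln_mono) (auto simp: V_def)
      also have "\<dots> = real k * l" unfolding l_def by (rule ln_realpow)
      finally show ?thesis .
    qed
    have lq: "ln q \<le> real k * l"
    proof -
      have "q \<le> V" unfolding q_def using V1 by (simp add: divide_le_eq mult_le_cancel_left1)
      then have "ln q \<le> ln V" using q0 by (intro ln_mono) auto
      then show ?thesis using lV by linarith
    qed
    have lV1: "ln (V + 1) \<le> 1 + real k * l"
    proof -
      have "ln (V + 1) \<le> ln (2 * V)" using V1 by (intro ln_mono) auto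
      also have "\<dots> = ln 2 + ln V" using V1 by (simp add: ln_mult_pos)
      also have "ln (2::real) \<le> 2 - 1" by (rule ln_le_minus_one) simp
      finally show ?thesis using lV by simp
    qed
    have kk: "k = Suc (k - 1)" using k by simp
    have m1: "real (num_matroids n k) \<le> exp (real k * real n ^ (k - 1) * (2 * l + 1))"
      using num_matroids_crude[of n "k - 1"] kn k unfolding l_def kk[symmetric] by simp
    have p1: "num_matroids n (Suc k) \<ge> 1" using num_matroids_pos[of "Suc k" n] kn by simp
    have "real (num_matroids n (Suc k)) \<le> real (num_matroids n k) * real (card (packings n (Suc k)))"
      using num_matroids_Suc_le[OF k1, of n] unfolding of_nat_mult[symmetric] of_nat_le_iff .
    also have "\<dots> \<le> exp (real k * real n ^ (k - 1) * (2 * l + 1)) *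
        ((V + 1) * exp (q * (ln D + 1 - real (Suc k) + \<epsilon>) + real k * (ln q + 1)) * exp (V * (2 * D powr (- (1 / 4)))))"
      using m1 D0[OF kn(1) DD] unfolding D V_def[symmetric] q_def[symmetric] by (intro mult_mono) auto
    also have "V + 1 = exp (ln (V + 1))" using V1 by simp
    finally have "real (num_matroids n (Suc k)) \<le> exp (real k * real n ^ (k - 1) * (2 * l + 1) +
        (ln (V + 1) + (q * (ln D + 1 - real (Suc k) + \<epsilon>) + real k * (ln q + 1)) + V * (2 * D powr (- (1 / 4)))))"
      by (simp only: exp_add)
    then have "ln (real (num_matroids n (Suc k))) \<le> real k * real n ^ (k - 1) * (2 * l + 1) +
        (ln (V + 1) + (q * (ln D + 1 - real (Suc k) + \<epsilon>) + real k * (ln q + 1)) + V * (2 * D powr (- (1 / 4))))"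
    proof -
      assume le: "real (num_matroids n (Suc k)) \<le> exp (real k * real n ^ (k - 1) * (2 * l + 1) +
        (ln (V + 1) + (q * (ln D + 1 - real (Suc k) + \<epsilon>) + real k * (ln q + 1)) + V * (2 * D powr (- (1 / 4)))))"
      have "real (num_matroids n (Suc k)) > 0" using p1 by simp
      from ln_mono[OF le this] show ?thesis by (simp only: ln_exp)
    qed
    moreover have "real k * real n ^ (k - 1) * (2 * l + 1) + ln (V + 1) + real k * (ln q + 1)
      \<le> q * (C * ((l + 1) / real n))"
    proof -
      have n1: "1 \<le> real n ^ (k - 1)" using kn by (intro one_le_power) auto
      have k1': "real k \<ge> 1" using k1 by simp
      have "ln (V + 1) \<le> real k * (l + 1)" using lV1 k1' by (simp add: algebra_simps)
      also have "\<dots> \<le> real n ^ (k - 1) * (real k * (l + 1))" using mult_right_mono[OF n1, of "real k * (l + 1)"] l0 by simp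
      finally have 1: "ln (V + 1) \<le> real n ^ (k - 1) * (real k * (l + 1))" .
      have "ln q + 1 \<le> real k * (l + 1)" using lq k1' by (simp add: algebra_simps)
      then have "real k * (ln q + 1) \<le> real k * (real k * (l + 1))" by (intro mult_left_mono) auto
      also have "\<dots> \<le> real n ^ (k - 1) * (real k * (real k * (l + 1)))" using mult_right_mono[OF n1, of "real k * (real k * (l + 1))"] l0 by simp
      finally have 2: "real k * (ln q + 1) \<le> real n ^ (k - 1) * (real k * (real k * (l + 1)))" .
      have "real k * real n ^ (k - 1) * (2 * l + 1) \<le> real k * real n ^ (k - 1) * (2 * (l + 1))"
        by (intro mult_left_mono) auto
      then have "real k * real n ^ (k - 1) * (2 * l + 1) + ln (V + 1) + real k * (ln q + 1)
        \<le> real n ^ (k - 1) * ((3 * real k + real k * real k) * (l + 1))"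
      proof -
        assume 3: "real k * real n ^ (k - 1) * (2 * l + 1) \<le> real k * real n ^ (k - 1) * (2 * (l + 1))"
        have "real n ^ (k - 1) * ((3 * real k + real k * real k) * (l + 1)) = real k * real n ^ (k - 1) * (2 * (l + 1))
          + real n ^ (k - 1) * (real k * (l + 1)) + real n ^ (k - 1) * (real k * (real k * (l + 1)))"
          by (simp add: algebra_simps)
        then show ?thesis using 1 2 3 by linarith
      qed
      also have "\<dots> \<le> q * (real (Suc k) * real k ^ k / real n) * ((3 * real k + real k * real k) * (l + 1))"
        using bo(1) l0 by (intro mult_right_mono) (auto simp: q_def V_def simp del: of_nat_Suc)
      also have "\<dots> = q * (C * ((l + 1) / real n))" by (simp add: C_def)
      finally show ?thesis .
    qed
    moreover have "V * (2 * D powr (- (1 / 4))) = q * (2 * real (Suc k) * D powr (- (1 / 4)))" by (simp add: q_def del: of_nat_Suc)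
    ultimately have "ln (real (num_matroids n (Suc k))) \<le> q * (ln D + 1 - real (Suc k) + \<epsilon>)
        + q * (C * ((l + 1) / real n)) + q * (2 * real (Suc k) * D powr (- (1 / 4)))" by linarith
    then show "ln (real (num_matroids n (Suc k)))
     \<le> real (n choose k) / real (Suc k) * (ln (real n - real k) + 1 - real (Suc k) + \<epsilon>
          + C * ((ln (real n) + 1) / real n) + 2 * real (Suc k) * (real n - real k) powr (- (1 / 4)))"
      unfolding V_def[symmetric] q_def[symmetric] l_def[symmetric] D_def[symmetric] by (simp only: distrib_left)
  qed
qed

text \<open>Each of the four \<open>\<eta>\<close> pays for one loss: the slack of the greedy
  process, its noise \<open>\<nu>\<close>, the fraction \<open>\<tau>\<close> of vertices never
  covered, and rounding together with logarithmic terms.\<close>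

lemma ln_num_matroids_ge:
  fixes \<eta> :: real
  assumes k: "k \<ge> 1" and \<eta>: "\<eta> > 0"
  shows "\<forall>\<^sub>F n in sequentially. ln (real (num_matroids n (Suc k)))
     \<ge> real (n choose k) / real (Suc k) * (ln (real n - real k) + 1 - real (Suc k) - 4 * \<eta>)"
proof -
  define r where "r = Suc k"
  \<comment> \<open>With \<open>\<tau> = D powr (- \<kappa>)\<close> this gives
    \<open>D * \<tau> ^ (6 * r + 4) = sqrt D\<close>: the uncovered fraction tends to zero, yet the
    noise is only of order \<open>(ln n) / sqrt D\<close>.\<close>
  define \<kappa> where "\<kappa> = 1 / (2 * real (6 * r + 4))"
  define s where "s = step_noise (real r)"
  have \<kappa>: "\<kappa> > 0" by (simp add: \<kappa>_def)
  have k0: "real k \<ge> 0" by simp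
  have "(\<lambda>n. s * (4 * (real k + 1) * ln (real n) + 2 / \<eta>) / sqrt (real n - real k)) \<longlonglongrightarrow> 0" by real_asymp
  then have e1: "\<forall>\<^sub>F n in sequentially. s * (4 * (real k + 1) * ln (real n) + 2 / \<eta>) / sqrt (real n - real k) < \<eta>"
    using \<eta> by (intro order_tendstoD(2)) auto
  have "(\<lambda>n. (real n - real k) powr (- \<kappa>) * ln (real n - real k)) \<longlonglongrightarrow> 0" using \<kappa> by real_asymp
  then have e2: "\<forall>\<^sub>F n in sequentially. (real n - real k) powr (- \<kappa>) * ln (real n - real k) < \<eta>"
    using \<eta> by (intro order_tendstoD(2)) auto
  have "(\<lambda>n. ((real k + 2) * ln (real n) + 1) * (real r * real k ^ k / real n)) \<longlonglongrightarrow> 0" by real_asymp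
  then have e3: "\<forall>\<^sub>F n in sequentially. ((real k + 2) * ln (real n) + 1) * (real r * real k ^ k / real n) < \<eta>"
    using \<eta> by (intro order_tendstoD(2)) auto
  have e4: "\<forall>\<^sub>F n in sequentially. ln (real n - real k) > real r + 2 * \<eta>" by real_asymp
  have e5: "\<forall>\<^sub>F n in sequentially. sqrt (real n - real k) > real r / 2" by real_asymp
  have e6: "\<forall>\<^sub>F n in sequentially. real n - real k > 6 * real r" by real_asymp
  have "(\<lambda>n. (real n - real k) powr (- \<kappa>)) \<longlonglongrightarrow> 0" using \<kappa> by real_asymp
  then have e7: "\<forall>\<^sub>F n in sequentially. (real n - real k) powr (- \<kappa>) < 1 / 2"
    by (intro order_tendstoD(2)) auto
  have e8: "\<forall>\<^sub>F n in sequentially. n \<ge> k + 2" by (rule eventually_ge_at_top)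
  show ?thesis
    using e1 e2 e3 e4 e5 e6 e7 e8
  proof eventually_elim
    case (elim n)
    define D where "D = n - k"
    define V where "V = real (n choose k)"
    define q where "q = V / real r"
    define \<tau> where "\<tau> = real D powr (- \<kappa>)"
    \<comment> \<open>The subtracted \<open>1\<close> leaves room for rounding
      \<open>\<tau> * V\<close> up to an integer. It costs \<open>1 / r\<close> edges and the floor
      less than one, so \<open>m\<close> falls short of \<open>q * (1 - \<tau>)\<close> by at most
      \<open>2\<close>.\<close>
    define m where "m = nat \<lfloor>(V * (1 - \<tau>) - 1) / real r\<rfloor>"
    have kn: "k \<le> n" and rn: "r < n" using elim(8) by (auto simp: r_def)
    have D: "real n - real k = real D" using kn by (simp add: D_def of_nat_diff)
    have r0: "real r \<ge> 2" using k by (simp add: r_def)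
    have D6: "real D > 6 * real r" using elim(6) D by simp
    have D1: "real D \<ge> 1" using D6 r0 by linarith
    have DVn: "D \<le> n choose k" using binomial_ge_linear[OF k, of D] kn by (simp add: D_def)
    then have DV: "real D \<le> V" by (simp add: V_def)
    have lnD: "ln (real D) \<ge> 0" using D1 by simp
    note bo = binomial_order[OF k kn]
    have q6: "q > 6" unfolding q_def using D6 DV r0 by (simp add: pos_less_divide_eq)
    have q0: "q > 0" using q6 by simp
    have Vq: "V = real r * q" using r0 by (simp add: q_def)
    have \<tau>: "0 < \<tau>" "\<tau> < 1 / 2" using elim(7) D1 unfolding \<tau>_def D by auto
    have x1: "q * (1 - \<tau>) \<ge> 3"
    proof -
      have "6 * (1 / 2) \<le> q * (1 - \<tau>)" using q6 \<tau> by (intro mult_mono) auto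
      then show ?thesis by simp
    qed
    have xeq: "(V * (1 - \<tau>) - 1) / real r = q * (1 - \<tau>) - 1 / real r" using r0 by (simp add: Vq field_simps)
    have r1: "1 / real r \<le> 1" using r0 by simp
    have m_le: "real m \<le> (V * (1 - \<tau>) - 1) / real r" and m_ge: "real m \<ge> q * (1 - \<tau>) - 2"
      unfolding m_def xeq using x1 r1 by linarith+
    have m1: "m \<ge> 1"
    proof -
      have "real m \<ge> 1" using m_ge x1 by linarith
      then show ?thesis by linarith
    qed
    have mV: "\<tau> * V + 1 + real r * real m \<le> V"
    proof -
      have "real m * real r \<le> V * (1 - \<tau>) - 1" using m_le r0 by (simp add: pos_le_divide_eq)
      then show ?thesis by (simp add: algebra_simps)
    qed
    have \<tau>p: "real D * \<tau> ^ (6 * r + 4) = sqrt (real D)"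
    proof -
      have "\<tau> ^ (6 * r + 4) = real D powr (- \<kappa> * real (6 * r + 4))"
        unfolding \<tau>_def using D1 by (simp add: powr_realpow[symmetric] powr_powr)
      also have "- \<kappa> * real (6 * r + 4) = - (1 / 2)"
      proof -
        have "real (6 * r + 4) > 0" by simp
        then show ?thesis unfolding \<kappa>_def by (simp add: field_simps del: of_nat_add of_nat_mult)
      qed
      finally have "real D * \<tau> ^ (6 * r + 4) = real D powr 1 * real D powr (- (1 / 2))" using D1 by simp
      also have "\<dots> = real D powr (1 / 2)" by (simp only: powr_add[symmetric]) simp
      also have "\<dots> = sqrt (real D)" using D1 by (simp add: powr_half_sqrt)
      finally show ?thesis .
    qed
    have \<tau>r: "real r / 2 \<le> real D * \<tau> ^ (r - 1)"
    proof -
      have "real r / 2 \<le> real D * \<tau> ^ (6 * r + 4)" unfolding \<tau>p using elim(5) D by simp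
      also have "\<dots> \<le> real D * \<tau> ^ (r - 1)" using \<tau> by (intro mult_left_mono power_decreasing) auto
      finally show ?thesis .
    qed
    define \<nu> where "\<nu> = s * (4 * ln (V * real D) + 2 / \<eta>) / sqrt (real D)"
    have s0: "s \<ge> 0" unfolding s_def using r0 by (intro step_noise_nonneg) auto
    have Vpos: "V > 0" using DV D1 by linarith
    have lV: "ln V \<le> real k * ln (real n)"
    proof -
      have "ln V \<le> ln (real n ^ k)" using bo(2) Vpos by (intro ln_mono) (auto simp: V_def)
      also have "\<dots> = real k * ln (real n)" by (rule ln_realpow)
      finally show ?thesis .
    qed
    have lDn: "ln (real D) \<le> ln (real n)" using D1 by (intro ln_mono) (auto simp: D_def)
    have \<nu>\<eta>: "\<nu> \<le> \<eta>"
    proof -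
      have "ln (V * real D) \<le> (real k + 1) * ln (real n)"
        using lV lDn Vpos D1 by (simp add: ln_mult_pos algebra_simps)
      then have "4 * ln (V * real D) + 2 / \<eta> \<le> 4 * (real k + 1) * ln (real n) + 2 / \<eta>" by linarith
      then have "s * (4 * ln (V * real D) + 2 / \<eta>) \<le> s * (4 * (real k + 1) * ln (real n) + 2 / \<eta>)"
        using s0 by (rule mult_left_mono)
      then have "\<nu> \<le> s * (4 * (real k + 1) * ln (real n) + 2 / \<eta>) / sqrt (real D)"
        unfolding \<nu>_def by (rule divide_right_mono) simp
      then show ?thesis using elim(1) unfolding D by linarith
    qed
    let ?E = "subsets_hg n k" and ?U = "facets k {1..n}"
    have cU: "real (card ?U) = V" using card_facets_ground[OF k, of n] by (simp only: V_def)
    have "ln (real (card {T \<in> matchings ?E. card T \<le> m}))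
      \<ge> real m * (ln (real D) + 1 - real r) - ln (real m) - 1 - real m * (\<eta> + \<nu>)"
      unfolding \<nu>_def s_def \<tau>p[symmetric] cU[symmetric]
    proof (rule ln_matchings_ge[where \<tau> = \<tau> and U = ?U])
      show "finite ?U" by (rule finite_facets) simp
      show "?E \<subseteq> Pow ?U" by (rule subsets_hg_sub[OF k])
      show "card f = r" if "f \<in> ?E" for f using subsets_hg_uniform[OF k that] by (simp add: r_def)
      show "linear_hg ?E" by (rule linear_subsets_hg[OF k])
      show "degree ?E v = D" if "v \<in> ?U" for v using degree_subsets_hg[OF k that] by (simp add: D_def)
      show "2 \<le> r" using r0 by simp
      show "1 \<le> D" using D1 by simp
      show "real D \<le> real (card ?U)" using DV cU by simp
      show "\<tau> * real (card ?U) + 1 + real r * real m \<le> real (card ?U)" using mV unfolding cU .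
    qed (use \<tau> \<tau>r \<eta> m1 in auto)
    also have "ln (real (card {T \<in> matchings ?E. card T \<le> m})) \<le> ln (real (num_matroids n r))"
    proof -
      have fE: "finite ?E" by (simp add: subsets_hg_def)
      have "card {T \<in> matchings ?E. card T \<le> m} \<le> card (matchings ?E)"
        by (rule card_mono[OF finite_matchings[OF fE]]) auto
      also have "\<dots> \<le> num_matroids n r"
        using order_trans[OF card_matchings_le_separated[OF k, of n]] num_matroids_ge[of r n] rn by (simp add: r_def)
      finally have "real (card {T \<in> matchings ?E. card T \<le> m}) \<le> real (num_matroids n r)" by (simp only: of_nat_le_iff)
      then show ?thesis using small_matchings_pos[OF fE, of m] by (intro ln_mono) auto
    qed
    finally have main: "ln (real (num_matroids n r)) \<ge> real m * (ln (real D) + 1 - real r) - ln (real m) - 1 - real m * (\<eta> + \<nu>)" .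
    define L where "L = ln (real D) + 1 - real r - 2 * \<eta>"
    have L: "0 \<le> L" "L \<le> ln (real D)" using elim(4) \<eta> r0 unfolding L_def D by auto
    have mq: "real m \<le> q"
    proof -
      have "q * (1 - \<tau>) \<le> q * 1" using q0 \<tau> by (intro mult_left_mono) auto
      moreover have "1 / real r \<ge> 0" by simp
      ultimately show ?thesis using m_le unfolding xeq by linarith
    qed
    have lm: "ln (real m) \<le> ln q" using mq m1 by (intro ln_mono) auto
    have lq: "ln q \<le> real k * ln (real n)"
    proof -
      have "q \<le> V" unfolding q_def using Vpos r0 by (simp add: divide_le_eq mult_le_cancel_left1)
      then have "ln q \<le> ln V" using q0 by (intro ln_mono) auto
      then show ?thesis using lV by linarith
    qed
    have "real m * L \<le> real m * (ln (real D) + 1 - real r) - real m * (\<eta> + \<nu>)"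
    proof -
      have "real m * \<nu> \<le> real m * \<eta>" using \<nu>\<eta> by (intro mult_left_mono) auto
      then show ?thesis by (simp add: L_def algebra_simps)
    qed
    moreover have "real m * L \<ge> (q * (1 - \<tau>) - 2) * L" using m_ge L by (intro mult_right_mono) auto
    moreover have "(q * (1 - \<tau>) - 2) * L = q * L - q * (\<tau> * L) - 2 * L" by (simp add: algebra_simps)
    moreover have "q * (\<tau> * L) \<le> q * \<eta>"
    proof -
      have "\<tau> * L \<le> \<tau> * ln (real D)" using L \<tau> by (intro mult_left_mono) auto
      also have "\<dots> \<le> \<eta>" using elim(2) unfolding D \<tau>_def by simp
      finally show ?thesis using q0 by (intro mult_left_mono) auto
    qed
    moreover have "2 * L + ln q + 1 \<le> q * \<eta>"
    proof -
      define l where "l = (real k + 2) * ln (real n) + 1"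
      have n1: "real n \<ge> 1" using kn k by simp
      then have l0: "l \<ge> 0" by (simp add: l_def)
      have "2 * L + ln q + 1 \<le> l" using L lDn lq by (simp add: l_def algebra_simps)
      also have "l * 1 \<le> l * real n ^ (k - 1)" using l0 n1 by (intro mult_left_mono one_le_power) auto
      then have "l \<le> l * real n ^ (k - 1)" by simp
      also have "\<dots> \<le> l * (q * (real r * real k ^ k / real n))"
        using bo(1) l0 unfolding q_def V_def r_def by (intro mult_left_mono) auto
      also have "\<dots> = q * (l * (real r * real k ^ k / real n))" by simp
      also have "\<dots> \<le> q * \<eta>" using elim(3) q0 unfolding l_def by (intro mult_left_mono) auto
      finally show ?thesis .
    qed
    ultimately have "ln (real (num_matroids n r)) \<ge> q * L - q * \<eta> - q * \<eta>" using main lm by linarith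
    also have "q * L - q * \<eta> - q * \<eta> = q * (ln (real n - real k) + 1 - real r - 4 * \<eta>)"
      unfolding L_def D by (simp add: algebra_simps)
    finally show ?case unfolding q_def V_def r_def by simp
  qed
qed

theorem theorem1:
  fixes r :: nat
  assumes "r \<ge> 4"
  shows "\<exists>\<epsilon> :: nat \<Rightarrow> real. \<epsilon> \<in> o[at_top](\<lambda>_. 1) \<and>
           (\<forall>n \<ge> r. ln (real (num_matroids n r)) =
              1 / (real n - real r + 1) * real (n choose r) *
                (ln (real n - real r + 1) + 1 - real r + \<epsilon> n))"
proof -
  define k where "k = r - 1"
  have r: "r = Suc k" "k \<ge> 3" using assms by (auto simp: k_def)
  define Q where "Q n = 1 / (real n - real r + 1) * real (n choose r)" for n
  \<comment> \<open>The identity is solved for its error term, which \<open>Q n > 0\<close> permits,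
    so only the limit is left to prove.\<close>
  define \<epsilon> where "\<epsilon> n = ln (real (num_matroids n r)) / Q n - (ln (real n - real r + 1) + 1 - real r)" for n
  have Qpos: "Q n > 0" if "n \<ge> r" for n
    unfolding Q_def using that by (intro mult_pos_pos divide_pos_pos) auto
  \<comment> \<open>By the absorption identity for binomials the prefactor is
    \<open>(n choose k) / Suc k\<close>, the number of edges of a perfect matching if there is
    one.\<close>
  have Qeq: "Q n = real (n choose k) / real (Suc k)" if "n \<ge> r" for n
  proof -
    have "Suc k * (n choose Suc k) = (n - k) * (n choose k)"
      by (rule trans[OF binomial_absorption binomial_absorb_comp[symmetric]])
    then have "real (Suc k * (n choose Suc k)) = real ((n - k) * (n choose k))" by (simp only:)
    moreover have "real (n - k) = real n - real r + 1" using that r by (simp add: of_nat_diff)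
    ultimately have "real (Suc k) * real (n choose r) = (real n - real r + 1) * real (n choose k)"
      by (simp only: of_nat_mult r(1))
    moreover have "real n - real r + 1 > 0" using that by simp
    ultimately show ?thesis unfolding Q_def by (simp add: field_simps del: of_nat_Suc)
  qed
  have Dk: "real n - real r + 1 = real n - real k" for n by (simp add: r)
  have "\<epsilon> \<longlonglongrightarrow> 0"
  proof (rule tendstoI)
    fix e :: real assume e: "e > 0"
    obtain C n0 where up: "\<And>n. n \<ge> n0 \<Longrightarrow> ln (real (num_matroids n (Suc k)))
     \<le> real (n choose k) / real (Suc k) * (ln (real n - real k) + 1 - real (Suc k) + e / 3
          + C * ((ln (real n) + 1) / real n) + 2 * real (Suc k) * (real n - real k) powr (- (1 / 4)))"
      using ln_num_matroids_le[OF r(2), of "e / 3"] e by auto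
    have "(\<lambda>n. C * ((ln (real n) + 1) / real n) + 2 * real (Suc k) * (real n - real k) powr (- (1 / 4))) \<longlonglongrightarrow> 0"
      by real_asymp
    then have e1: "\<forall>\<^sub>F n in sequentially. C * ((ln (real n) + 1) / real n) + 2 * real (Suc k) * (real n - real k) powr (- (1 / 4)) < e / 3"
      using e by (intro order_tendstoD(2)) auto
    have e2: "\<forall>\<^sub>F n in sequentially. ln (real (num_matroids n (Suc k)))
     \<ge> real (n choose k) / real (Suc k) * (ln (real n - real k) + 1 - real (Suc k) - 4 * (e / 8))"
      by (rule ln_num_matroids_ge) (use r e in auto)
    have e3: "\<forall>\<^sub>F n in sequentially. n \<ge> max n0 r" by (rule eventually_ge_at_top)
    show "\<forall>\<^sub>F n in sequentially. dist (\<epsilon> n) 0 < e"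
      using e1 e2 e3
    proof eventually_elim
      case (elim n)
      have n: "n \<ge> n0" "n \<ge> r" using elim(3) by auto
      note Q = Qpos[OF n(2)]
      have "ln (real (num_matroids n r)) \<le> Q n * (ln (real n - real k) + 1 - real (Suc k) + e / 3
          + C * ((ln (real n) + 1) / real n) + 2 * real (Suc k) * (real n - real k) powr (- (1 / 4)))"
        using up[OF n(1)] unfolding Qeq[OF n(2)] r(1) .
      then have "ln (real (num_matroids n r)) / Q n \<le> ln (real n - real k) + 1 - real (Suc k) + e / 3
          + C * ((ln (real n) + 1) / real n) + 2 * real (Suc k) * (real n - real k) powr (- (1 / 4))"
        using Q by (simp only: pos_divide_le_eq mult.commute)
      then have 1: "\<epsilon> n < e" using elim(1) e unfolding \<epsilon>_def Dk unfolding r(1) by linarith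
      have "Q n * (ln (real n - real k) + 1 - real (Suc k) - 4 * (e / 8)) \<le> ln (real (num_matroids n r))"
        using elim(2) unfolding Qeq[OF n(2)] r(1) .
      then have "ln (real n - real k) + 1 - real (Suc k) - 4 * (e / 8) \<le> ln (real (num_matroids n r)) / Q n"
        using Q by (simp only: pos_le_divide_eq mult.commute)
      then have "- e < \<epsilon> n" using e unfolding \<epsilon>_def Dk unfolding r(1) by linarith
      then show ?case using 1 by (simp add: dist_real_def)
    qed
  qed
  then have "\<epsilon> \<in> o[at_top](\<lambda>_. 1)" by (intro smalloI_tendsto) auto
  moreover have "ln (real (num_matroids n r)) = Q n * (ln (real n - real r + 1) + 1 - real r + \<epsilon> n)" if "n \<ge> r" for n
    using Qpos[OF that] by (simp add: \<epsilon>_def)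
  ultimately show ?thesis unfolding Q_def by blast
qed

end
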